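(* Let $R$ be a standard graded algebra over a Noetherian ring $A$ with unity. Let $I$ be a graded ideal of $R$ and $M$ a finitely generated $\mathbb{Z}$-graded $R$-module, and let $\Gamma$ be a generalized regularity function for $R$. Then there exists an integer $e\ge d(M)$ such that $\Gamma(I^nM)=\rho_I(M)\,n+e$ for $n\gg 0$.
   Context: "Standard graded over $A$" means that $R=\bigoplus_{n\ge 0}R_n$ with $R_0=A$ and $R=A[R_1]$; $R_+=\bigoplus_{n>0}R_n$. Let $\mathcal{M}_R$ be the category of finitely generated graded $R$-modules; $M(-p)$ denotes the shifted module with $M(-p)_n=M_{n-p}$. For a finitely generated nonzero $\mathbb{Z}$-graded $R$-module $M$, $D(M):=\max\{n\in\mathbb{Z}:(M/R_+M)_n\neq0\}$ and $d(M):=\min\{n\in\mathbb{Z}:M_n\ne0\}$, the largest and least degrees of a minimal system of generators of $M$. A graded ideal $J$ contained in $I$ is an $M$-reduction of $I$ if $JI^nM=I^{n+1}M$ for some $n>0$, and $\rho_I(M):=\min\{D(J): J\text{ is an }M\text{-reduction of }I\}$, where $D(J)$ is $D$ of $J$ viewed as a graded $R$-module. A generalized regularity function for $R$ is a function $\Gamma$ which assigns to each $M\in\mathcal{M}_R$ an integer $\Gamma(M)$ such that for all $M,N,P\in\mathcal{M}_R$: 1. if $M\cong N$, then $\Gamma(M)=\Gamma(N)$; 2. $\Gamma(M(-p))=\Gamma(M)+p$ for all $p\in\mathbb{Z}$; 3. $\Gamma(M)\ge D(M)$; 4. $\Gamma(M\oplus N)=\max\{\Gamma(M),\Gamma(N)\}$;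 5. if $0\to M\to N\to P\to0$ is a short exact sequence of graded modules, then $\Gamma(P)\le\max\{\Gamma(N),\Gamma(M)-1\}$.
   Formalization: Γ is required to be an integer with properties 1–5 only on nonzero modules (Γ(0) cannot satisfy property 2), M is nonzero, the equation is claimed when I^nM is nonzero, and R is generated over A by finitely many elements of R_1, so that I^nM is finitely generated. *)

theory Defs
  imports "HOL-Algebra.Module" "HOL-Algebra.Generated_Rings" "HOL-Algebra.Ideal_Product"
    "HOL-Algebra.Ring_Divisibility"
begin

text \<open>
  \<open>direct_decomposition G C\<close>: the additive group of \<open>G\<close> is the internal direct sum of the
  subgroups \<open>C i\<close>. It applies to rings and to modules, since both records extend \<open>ring\<close>.
\<close>

definition direct_decomposition :: "('b, 'd) ring_scheme \<Rightarrow> ('i \<Rightarrow> 'b set) \<Rightarrow> bool" where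
  "direct_decomposition G C \<longleftrightarrow>
     (\<forall>i. subgroup (C i) (add_monoid G)) \<and>
     (\<forall>x \<in> carrier G. \<exists>!f. (\<forall>i. f i \<in> C i) \<and> finite {i. f i \<noteq> \<zero>\<^bsub>G\<^esub>} \<and>
        x = (\<Oplus>\<^bsub>G\<^esub>i \<in> {i. f i \<noteq> \<zero>\<^bsub>G\<^esub>}. f i))"

record 'a graded_ring = "'a ring" +
  rcomp :: "nat \<Rightarrow> 'a set"

text \<open>
  The base ring of a standard graded algebra is its degree zero part \<open>R\<^sub>0\<close>. As usual, standard
  graded algebras are finitely generated: finitely many elements of \<open>R\<^sub>1\<close> generate \<open>R\<close> over
  \<open>R\<^sub>0\<close>; equivalently, \<open>R = R\<^sub>0[R\<^sub>1]\<close> and \<open>R\<^sub>1\<close> is a finitely generated \<open>R\<^sub>0\<close>-module.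
\<close>

definition base_ring :: "'a graded_ring \<Rightarrow> 'a graded_ring" where
  "base_ring R = R\<lparr>carrier := rcomp R 0\<rparr>"

definition standard_graded :: "'a graded_ring \<Rightarrow> bool" where
  "standard_graded R \<longleftrightarrow>
     cring R \<and>
     direct_decomposition R (rcomp R) \<and>
     (\<forall>i j. \<forall>x \<in> rcomp R i. \<forall>y \<in> rcomp R j. x \<otimes>\<^bsub>R\<^esub> y \<in> rcomp R (i + j)) \<and>
     (\<exists>B \<subseteq> rcomp R 1. finite B \<and> carrier R = generate_ring R (rcomp R 0 \<union> B))"

definition irrelevant_ideal :: "'a graded_ring \<Rightarrow> 'a set" where
  "irrelevant_ideal R = generate (add_monoid R) (\<Union>n \<in> {0<..}. rcomp R n)"

definition graded_ideal :: "'a graded_ring \<Rightarrow> 'a set \<Rightarrow> bool" where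
  "graded_ideal R I \<longleftrightarrow>
     ideal I R \<and> direct_decomposition (R\<lparr>carrier := I\<rparr>) (\<lambda>n. I \<inter> rcomp R n)"

text \<open>
  The record \<open>module\<close> inherits the fields \<open>mult\<close> and \<open>one\<close> from \<open>ring\<close>; they play no role for
  modules and are filled arbitrarily in the constructions below.
\<close>

record ('a, 'b) graded_module = "('a, 'b) module" +
  mcomp :: "int \<Rightarrow> 'b set"

definition set_smult :: "('a, 'b, 'd) module_scheme \<Rightarrow> 'a set \<Rightarrow> 'b set \<Rightarrow> 'b set" where
  "set_smult M S B = generate (add_monoid M) {a \<odot>\<^bsub>M\<^esub> x | a x. a \<in> S \<and> x \<in> B}"

definition fg_graded_module :: "'a graded_ring \<Rightarrow> ('a, 'b) graded_module \<Rightarrow> bool" where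
  "fg_graded_module R M \<longleftrightarrow>
     module R M \<and>
     direct_decomposition M (mcomp M) \<and>
     (\<forall>i n. \<forall>r \<in> rcomp R i. \<forall>x \<in> mcomp M n. r \<odot>\<^bsub>M\<^esub> x \<in> mcomp M (int i + n)) \<and>
     (\<exists>B \<subseteq> carrier M. finite B \<and> carrier M = set_smult M (carrier R) B)"

definition nonzero_module :: "('a, 'b) graded_module \<Rightarrow> bool" where
  "nonzero_module M \<longleftrightarrow> carrier M \<noteq> {\<zero>\<^bsub>M\<^esub>}"

definition shift :: "int \<Rightarrow> ('a, 'b) graded_module \<Rightarrow> ('a, 'b) graded_module" where
  "shift p M = M\<lparr>mcomp := (\<lambda>n. mcomp M (n - p))\<rparr>"

definition graded_submodule ::
  "('a, 'b) graded_module \<Rightarrow> 'b set \<Rightarrow> ('a, 'b) graded_module" where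
  "graded_submodule M N = M\<lparr>carrier := N, mcomp := (\<lambda>n. N \<inter> mcomp M n)\<rparr>"

definition quotient_module ::
  "('a, 'b) graded_module \<Rightarrow> 'b set \<Rightarrow> ('a, 'b set) graded_module" where
  "quotient_module M N =
     \<lparr>carrier = a_rcosets\<^bsub>M\<^esub> N, monoid.mult = (\<lambda>_ _. N), one = N, ring.zero = N, add = set_add M,
      smult = (\<lambda>r B. \<Union>x \<in> B. N +>\<^bsub>M\<^esub> (r \<odot>\<^bsub>M\<^esub> x)),
      mcomp = (\<lambda>n. (\<lambda>x. N +>\<^bsub>M\<^esub> x) ` mcomp M n)\<rparr>"

definition direct_sum_module ::
  "('a, 'b) graded_module \<Rightarrow> ('a, 'c) graded_module \<Rightarrow> ('a, 'b \<times> 'c) graded_module" where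
  "direct_sum_module M N =
     \<lparr>carrier = carrier M \<times> carrier N, monoid.mult = (\<lambda>_ _. (\<zero>\<^bsub>M\<^esub>, \<zero>\<^bsub>N\<^esub>)), one = (\<zero>\<^bsub>M\<^esub>, \<zero>\<^bsub>N\<^esub>),
      ring.zero = (\<zero>\<^bsub>M\<^esub>, \<zero>\<^bsub>N\<^esub>), add = (\<lambda>(x, y) (x', y'). (x \<oplus>\<^bsub>M\<^esub> x', y \<oplus>\<^bsub>N\<^esub> y')),
      smult = (\<lambda>r (x, y). (r \<odot>\<^bsub>M\<^esub> x, r \<odot>\<^bsub>N\<^esub> y)),
      mcomp = (\<lambda>n. mcomp M n \<times> mcomp N n)\<rparr>"

definition ideal_module :: "'a graded_ring \<Rightarrow> 'a set \<Rightarrow> ('a, 'a) graded_module" where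
  "ideal_module R J =
     \<lparr>carrier = J, monoid.mult = monoid.mult R, one = \<one>\<^bsub>R\<^esub>, ring.zero = \<zero>\<^bsub>R\<^esub>,
      add = add R, smult = monoid.mult R,
      mcomp = (\<lambda>n. if n < 0 then {\<zero>\<^bsub>R\<^esub>} else J \<inter> rcomp R (nat n))\<rparr>"

definition graded_hom ::
  "'a graded_ring \<Rightarrow> ('a, 'b) graded_module \<Rightarrow> ('a, 'c) graded_module \<Rightarrow> ('b \<Rightarrow> 'c) \<Rightarrow> bool" where
  "graded_hom R M N f \<longleftrightarrow>
     f \<in> carrier M \<rightarrow> carrier N \<and>
     (\<forall>x \<in> carrier M. \<forall>y \<in> carrier M. f (x \<oplus>\<^bsub>M\<^esub> y) = f x \<oplus>\<^bsub>N\<^esub> f y) \<and>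
     (\<forall>r \<in> carrier R. \<forall>x \<in> carrier M. f (r \<odot>\<^bsub>M\<^esub> x) = r \<odot>\<^bsub>N\<^esub> f x) \<and>
     (\<forall>n. f ` mcomp M n \<subseteq> mcomp N n)"

definition graded_iso ::
  "'a graded_ring \<Rightarrow> ('a, 'b) graded_module \<Rightarrow> ('a, 'c) graded_module \<Rightarrow> bool" where
  "graded_iso R M N \<longleftrightarrow> (\<exists>f. graded_hom R M N f \<and> bij_betw f (carrier M) (carrier N))"

definition short_exact ::
  "'a graded_ring \<Rightarrow> ('a, 'b) graded_module \<Rightarrow> ('a, 'c) graded_module \<Rightarrow> ('a, 'd) graded_module
     \<Rightarrow> ('b \<Rightarrow> 'c) \<Rightarrow> ('c \<Rightarrow> 'd) \<Rightarrow> bool" where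
  "short_exact R M N P f g \<longleftrightarrow>
     graded_hom R M N f \<and> graded_hom R N P g \<and>
     inj_on f (carrier M) \<and>
     f ` carrier M = {x \<in> carrier N. g x = \<zero>\<^bsub>P\<^esub>} \<and>
     g ` carrier N = carrier P"

text \<open>
  \<open>Dmax R M\<close> and \<open>dmin M\<close> are \<open>D(M)\<close> and \<open>d(M)\<close>, the maximum of \<open>{n. (M/R\<^sub>+M)\<^sub>n \<noteq> 0}\<close> and the
  minimum of \<open>{n. M\<^sub>n \<noteq> 0}\<close>. They are meaningful for nonzero finitely generated modules only.
\<close>

definition Dmax :: "'a graded_ring \<Rightarrow> ('a, 'b) graded_module \<Rightarrow> int" where
  "Dmax R M =
     (let Q = quotient_module M (set_smult M (irrelevant_ideal R) (carrier M))
      in GREATEST n. mcomp Q n \<noteq> {\<zero>\<^bsub>Q\<^esub>})"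

definition dmin :: "('a, 'b) graded_module \<Rightarrow> int" where
  "dmin M = (LEAST n. mcomp M n \<noteq> {\<zero>\<^bsub>M\<^esub>})"

definition power_smult :: "'a graded_ring \<Rightarrow> 'a set \<Rightarrow> nat \<Rightarrow> ('a, 'b) graded_module \<Rightarrow> 'b set" where
  "power_smult R I n M = set_smult M (I [^]\<^bsub>ideals_set R\<^esub> n) (carrier M)"

definition is_reduction ::
  "'a graded_ring \<Rightarrow> ('a, 'b) graded_module \<Rightarrow> 'a set \<Rightarrow> 'a set \<Rightarrow> bool" where
  "is_reduction R M I J \<longleftrightarrow>
     graded_ideal R J \<and> J \<subseteq> I \<and>
     (\<exists>n>0. set_smult M J (power_smult R I n M) = power_smult R I (n + 1) M)"

text \<open>
  \<open>D(J)\<close> is meaningful only for \<open>J \<noteq> 0\<close>. The zero ideal is an \<open>M\<close>-reduction of \<open>I\<close> only if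
  \<open>I\<^sup>nM = 0\<close> for large \<open>n\<close>; otherwise the minimum below ranges over nonzero ideals.
\<close>

definition rho :: "'a graded_ring \<Rightarrow> 'a set \<Rightarrow> ('a, 'b) graded_module \<Rightarrow> int" where
  "rho R I M = (LEAST k. \<exists>J. is_reduction R M I J \<and> k = Dmax R (ideal_module R J))"

text \<open>
  The category of finitely generated graded \<open>R\<close>-modules is represented by those whose carrier is
  a subset of a type \<open>'m\<close>; this is meant for \<open>'m\<close> large enough to contain an isomorphic copy of
  every such module. An injection from \<open>(nat \<Rightarrow> 'a) set\<close> into \<open>'m\<close> guarantees this, as every
  finitely generated module is a set of cosets in some \<open>R\<^sup>k\<close>.

  \<open>\<Gamma>\<close> is integer-valued on nonzero modules only (\<open>\<Gamma>(0) = -\<infinity>\<close>): no integer \<open>\<Gamma>(0)\<close> can satisfy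
  \<open>\<Gamma>(0(-p)) = \<Gamma>(0) + p\<close>, because \<open>0(-p) \<cong> 0\<close>. If one of the modules in \<open>direct_sum\<close> or \<open>exact\<close>
  is zero, the condition with \<open>\<Gamma>(0) = -\<infinity>\<close> follows from \<open>iso\<close>.
\<close>

locale generalized_regularity_function =
  fixes R :: "'a graded_ring" and \<Gamma> :: "('a, 'm) graded_module \<Rightarrow> int"
  assumes iso: "\<lbrakk>fg_graded_module R M; nonzero_module M; fg_graded_module R N; nonzero_module N;
      graded_iso R M N\<rbrakk> \<Longrightarrow> \<Gamma> M = \<Gamma> N"
    and shift: "\<lbrakk>fg_graded_module R M; nonzero_module M\<rbrakk> \<Longrightarrow> \<Gamma> (shift p M) = \<Gamma> M + p"
    and ge_D: "\<lbrakk>fg_graded_module R M; nonzero_module M\<rbrakk> \<Longrightarrow> \<Gamma> M \<ge> Dmax R M"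
    and direct_sum: "\<lbrakk>fg_graded_module R M; nonzero_module M; fg_graded_module R N; nonzero_module N;
      fg_graded_module R S; graded_iso R S (direct_sum_module M N)\<rbrakk> \<Longrightarrow> \<Gamma> S = max (\<Gamma> M) (\<Gamma> N)"
    and exact: "\<lbrakk>fg_graded_module R M; nonzero_module M; fg_graded_module R N; nonzero_module N;
      fg_graded_module R P; nonzero_module P; short_exact R M N P f g\<rbrakk>
      \<Longrightarrow> \<Gamma> P \<le> max (\<Gamma> N) (\<Gamma> M - 1)"

end

theory Submission
  imports Defs
begin

text \<open>
  Let \<open>J = (y\<^sub>1, \<dots>, y\<^sub>v)\<close> be an \<open>M\<close>-reduction of \<open>I\<close> with \<open>D(J) = \<rho>\<close>, where \<open>y\<^sub>j\<close> is homogeneous of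
  degree \<open>d\<^sub>j \<le> \<rho>\<close>. The Koszul complexes of the \<open>y\<^sub>j\<close> on the modules \<open>I\<^sup>nM\<close> are exact for large \<open>n\<close>: by
  the Hilbert basis theorem their cycles are generated in bounded degrees, and every \<open>y\<^sub>j\<close> kills the
  homology. Splitting an exact complex into short exact sequences bounds \<open>\<Gamma>(I\<^sup>nM)\<close> by the maximum of
  \<open>\<Gamma>(I\<^sup>n\<^sup>-\<^sup>lM) + l \<rho> - (l - 1)\<close> over \<open>1 \<le> l \<le> v\<close>. Hence \<open>h(n) = \<Gamma>(I\<^sup>nM) - \<rho> n\<close> satisfies
  \<open>h(n) \<le> max\<^sub>l (h(n - l) - (l - 1))\<close>, and an integer sequence with this property that is bounded below
  is eventually constant. It is bounded below by \<open>d(M)\<close>: if \<open>D(I\<^sup>nM) < \<rho> n + d(M)\<close>, then the elements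
  of \<open>I\<close> of degree less than \<open>\<rho>\<close> would already generate an \<open>M\<close>-reduction.
\<close>

section \<open>Homogeneous components\<close>

text \<open>The axioms of \<open>\<Gamma>\<close> bound only the right-hand term of a short exact
  sequence. An estimate for \<open>I^n M\<close> therefore needs a resolution that ends in it and
  consists of shifted copies of lower powers. Each short exact sequence passed on the way from a
  term on the left gains one unit, which is the origin of \<open>l - 1\<close>. Bounded generation
  of the cycles is Noetherianity of the direct sum of the \<open>I^n M\<close> over a polynomial
  ring in the \<open>y j\<close>. This sum is not built: \<open>eventually_generated\<close> speaks
  of families \<open>E n\<close> of subgroups of one module, with finitely many operators that raise
  the index. It serves twice: with the degree as index and elements of degree one as operators
  (whence the chain condition for graded submodules of \<open>M\<close>), and with the exponent of
  \<open>I\<close> as index and the \<open>y j\<close> as operators. Two obstacles shape the rest.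
  Koszul modules live on a function type outside the domain of \<open>\<Gamma>\<close>, so
  \<open>\<Gamma>\<close> is extended through isomorphic copies (\<open>reg\<close>). And
  \<open>\<Gamma>\<close> has no value at \<open>0\<close>, so zero modules are split off in every
  estimate.\<close>

lemmas sub_zero = additive_subgroup.zero_closed
  and sub_add = additive_subgroup.a_closed
  and sub_neg = additive_subgroup.a_inv_closed
  and sub_carrier = additive_subgroup.a_Hcarr
  and sub_subset = additive_subgroup.a_subset

definition hpart :: "('b, 'd) ring_scheme \<Rightarrow> ('i \<Rightarrow> 'b set) \<Rightarrow> 'i \<Rightarrow> 'b \<Rightarrow> 'b" where
  "hpart G C i x = (THE f. (\<forall>i. f i \<in> C i) \<and> finite {i. f i \<noteq> \<zero>\<^bsub>G\<^esub>} \<and>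
     x = (\<Oplus>\<^bsub>G\<^esub>i \<in> {i. f i \<noteq> \<zero>\<^bsub>G\<^esub>}. f i)) i"

locale graded_group = abelian_group G for G :: "('b, 'd) ring_scheme" (structure) +
  fixes C :: "'i \<Rightarrow> 'b set"
  assumes decomp: "direct_decomposition G C"
begin

abbreviation hp :: "'i \<Rightarrow> 'b \<Rightarrow> 'b" where "hp \<equiv> hpart G C"

lemma comp_subgroup: "additive_subgroup (C i) G"
  using decomp unfolding direct_decomposition_def additive_subgroup_def by blast

lemma comp_carrier: "x \<in> C i \<Longrightarrow> x \<in> carrier G"
  using sub_carrier[OF comp_subgroup] .

lemma comp_zero: "\<zero> \<in> C i"
  using sub_zero[OF comp_subgroup] .

lemma hpart_unique:
  assumes "\<And>i. f i \<in> C i" "finite S" "\<And>i. i \<notin> S \<Longrightarrow> f i = \<zero>" "x = (\<Oplus>i \<in> S. f i)"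
  shows "hp i x = f i"
proof -
  let ?P = "\<lambda>f. (\<forall>i. f i \<in> C i) \<and> finite {i. f i \<noteq> \<zero>} \<and> x = (\<Oplus>i \<in> {i. f i \<noteq> \<zero>}. f i)"
  have fc: "f \<in> A \<rightarrow> carrier G" for A
    using assms(1) comp_carrier by blast
  have sub: "{i. f i \<noteq> \<zero>} \<subseteq> S" using assms(3) by blast
  have "(\<Oplus>i \<in> {i. f i \<noteq> \<zero>}. f i) = (\<Oplus>i \<in> S. f i)"
    by (rule add.finprod_mono_neutral_cong_left) (use sub assms(2) fc in auto)
  then have P: "?P f" using assms finite_subset[OF sub] by simp
  have "x \<in> carrier G" using assms(4) fc finsum_closed by metis
  then have "\<exists>!f. ?P f"
    using decomp[unfolded direct_decomposition_def] by (elim conjE) (drule (1) bspec)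
  then have "The ?P = f" using P by (intro the1_equality)
  then show ?thesis unfolding hpart_def by (rule fun_cong)
qed

lemma hpart_expansion:
  assumes "x \<in> carrier G"
  shows "hp i x \<in> C i" "finite {i. hp i x \<noteq> \<zero>}"
    "x = (\<Oplus>i \<in> {i. hp i x \<noteq> \<zero>}. hp i x)"
proof -
  let ?P = "\<lambda>f. (\<forall>i. f i \<in> C i) \<and> finite {i. f i \<noteq> \<zero>} \<and> x = (\<Oplus>i \<in> {i. f i \<noteq> \<zero>}. f i)"
  have "\<exists>!f. ?P f"
    using decomp[unfolded direct_decomposition_def] assms by (elim conjE) (drule (1) bspec)
  then obtain f where f: "?P f" by (elim ex1E)
  have "hp i x = f i" for i
    using hpart_unique[of f "{i. f i \<noteq> \<zero>}" x] f by blast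
  then have "(\<lambda>i. hp i x) = f" by auto
  then show "hp i x \<in> C i" "finite {i. hp i x \<noteq> \<zero>}"
    "x = (\<Oplus>i \<in> {i. hp i x \<noteq> \<zero>}. hp i x)" using f by metis+
qed

lemma hpart_closed [simp]: "x \<in> carrier G \<Longrightarrow> hp i x \<in> carrier G"
  using hpart_expansion(1) comp_carrier by blast

lemma hpart_sum:
  assumes "x \<in> carrier G" "finite S" "\<And>i. i \<notin> S \<Longrightarrow> hp i x = \<zero>"
  shows "x = (\<Oplus>i \<in> S. hp i x)"
proof -
  have "(\<Oplus>i \<in> {i. hp i x \<noteq> \<zero>}. hp i x) = (\<Oplus>i \<in> S. hp i x)"
    by (rule add.finprod_mono_neutral_cong_left) (use assms in auto)
  then show ?thesis using hpart_expansion(3)[OF assms(1)] by simp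
qed

lemma hpart_add:
  assumes "x \<in> carrier G" "y \<in> carrier G"
  shows "hp i (x \<oplus> y) = hp i x \<oplus> hp i y"
proof (rule hpart_unique[where S = "{i. hp i x \<noteq> \<zero>} \<union> {i. hp i y \<noteq> \<zero>}"])
  let ?S = "{i. hp i x \<noteq> \<zero>} \<union> {i. hp i y \<noteq> \<zero>}"
  show fin: "finite ?S" using hpart_expansion(2) assms by blast
  show "hp i x \<oplus> hp i y \<in> C i" for i
    using sub_add[OF comp_subgroup] hpart_expansion(1) assms by blast
  have "x = (\<Oplus>i \<in> ?S. hp i x)" "y = (\<Oplus>i \<in> ?S. hp i y)"
    by (rule hpart_sum; use assms fin in auto)+
  moreover have "(\<Oplus>i \<in> ?S. hp i x \<oplus> hp i y) = (\<Oplus>i \<in> ?S. hp i x) \<oplus> (\<Oplus>i \<in> ?S. hp i y)"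
    by (rule finsum_addf) (use assms in auto)
  ultimately show "x \<oplus> y = (\<Oplus>i \<in> ?S. hp i x \<oplus> hp i y)" by simp
qed auto

lemma hpart_same: "x \<in> C i \<Longrightarrow> hp i x = x"
  and hpart_other: "x \<in> C j \<Longrightarrow> i \<noteq> j \<Longrightarrow> hp i x = \<zero>"
proof -
  have *: "hp i x = (if i = j then x else \<zero>)" if "x \<in> C j" for i j x
  proof (rule hpart_unique[where S = "{j}"])
    show "(if i = j then x else \<zero>) \<in> C i" for i using that comp_zero by simp
    show "x = (\<Oplus>i \<in> {j}. if i = j then x else \<zero>)"
      using comp_carrier[OF that] by simp
  qed auto
  show "x \<in> C i \<Longrightarrow> hp i x = x" "x \<in> C j \<Longrightarrow> i \<noteq> j \<Longrightarrow> hp i x = \<zero>"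
    using * by auto
qed

lemma hpart_zero [simp]: "hp i \<zero> = \<zero>"
  using hpart_same[OF comp_zero] .

lemma hpart_minus:
  assumes "x \<in> carrier G"
  shows "hp i (\<ominus> x) = \<ominus> hp i x"
proof -
  have "hp i (\<ominus> x) \<oplus> hp i x = \<zero>"
    using hpart_add[of "\<ominus> x" x] assms by (simp add: l_neg)
  then show ?thesis using assms by (metis a_inv_closed hpart_closed minus_equality)
qed

lemma finsum_in_additive_subgroup:
  assumes "additive_subgroup A G" "\<And>i. i \<in> S \<Longrightarrow> f i \<in> A"
  shows "(\<Oplus>i \<in> S. f i) \<in> A"
  using assms(2)
proof (induction S rule: infinite_finite_induct)
  case (insert i S)
  then have "f \<in> insert i S \<rightarrow> carrier G" using sub_carrier[OF assms(1)] by blast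
  then have "(\<Oplus>i \<in> insert i S. f i) = f i \<oplus> (\<Oplus>i \<in> S. f i)"
    using insert by (intro finsum_insert) auto
  then show ?case using insert sub_add[OF assms(1)] by simp
qed (use sub_zero[OF assms(1)] in \<open>auto simp: finsum_infinite\<close>)

lemma mem_of_hpart:
  assumes "additive_subgroup A G" "x \<in> carrier G" "\<And>i. hp i x \<in> A"
  shows "x \<in> A"
  using finsum_in_additive_subgroup[where f = "\<lambda>i. hp i x", OF assms(1,3)]
    hpart_expansion(3)[OF assms(2), symmetric] by metis

text \<open>Every element is a finite sum of homogeneous ones. Later proofs use this as an induction
  rule: the elements with a given property are shown to form an additive subgroup that contains each
  component.\<close>

lemma carrier_subset_of_comp:
  assumes "additive_subgroup A G" "\<And>i. C i \<subseteq> A"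
  shows "carrier G \<subseteq> A"
proof
  fix x assume "x \<in> carrier G"
  then show "x \<in> A"
    using mem_of_hpart[OF assms(1)] hpart_expansion(1) assms(2) by blast
qed

lemma hpart_eq_zero:
  assumes "x \<in> carrier G" "\<And>i. hp i x = \<zero>"
  shows "x = \<zero>"
  using hpart_expansion(3)[OF assms(1)] assms(2) by simp

end

lemma (in abelian_group) projections_determine_sum:
  assumes C: "\<And>i. additive_subgroup (C i) G"
    and add: "\<And>i x y. x \<in> carrier G \<Longrightarrow> y \<in> carrier G \<Longrightarrow> p i (x \<oplus> y) = p i x \<oplus> p i y"
    and same: "\<And>i x. x \<in> C i \<Longrightarrow> p i x = x"
    and other: "\<And>i j x. x \<in> C j \<Longrightarrow> i \<noteq> j \<Longrightarrow> p i x = \<zero>"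
    and f: "\<And>i. f i \<in> C i" and S: "finite S"
  shows "p i (\<Oplus>j \<in> S. f j) = (if i \<in> S then f i else \<zero>)"
  using S
proof induction
  case empty
  have "\<zero> \<in> C i" using sub_zero[OF C] .
  then show ?case using same by simp
next
  case (insert j S)
  have fc: "f \<in> A \<rightarrow> carrier G" for A using sub_carrier[OF C f] by blast
  have "(\<Oplus>j \<in> insert j S. f j) = f j \<oplus> (\<Oplus>j \<in> S. f j)"
    using insert fc by (intro finsum_insert) auto
  moreover have "f j \<in> carrier G" "(\<Oplus>j \<in> S. f j) \<in> carrier G"
    using fc by (auto intro: finsum_closed)
  ultimately show ?case
    using insert add[of "f j" "(\<Oplus>j \<in> S. f j)" i] same[OF f] other[OF f]
      sub_carrier[OF C f]
    by (cases "i = j") auto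
qed

text \<open>Additive maps \<open>p i\<close> that are the identity on \<open>C i\<close> and zero on
  every other \<open>C j\<close> force \<open>f i = p i x\<close>, which is uniqueness. For
  existence, \<open>x\<close> minus the sum of the \<open>p i x\<close> is annihilated by all
  \<open>p i\<close>, hence zero by \<open>inj\<close>. The gradings on submodules, function
  modules, shifts and transported copies are all obtained from such projections.\<close>

lemma (in abelian_group) direct_decompositionI:
  assumes C: "\<And>i. additive_subgroup (C i) G"
    and mem: "\<And>i x. x \<in> carrier G \<Longrightarrow> p i x \<in> C i"
    and add: "\<And>i x y. x \<in> carrier G \<Longrightarrow> y \<in> carrier G \<Longrightarrow> p i (x \<oplus> y) = p i x \<oplus> p i y"
    and same: "\<And>i x. x \<in> C i \<Longrightarrow> p i x = x"
    and other: "\<And>i j x. x \<in> C j \<Longrightarrow> i \<noteq> j \<Longrightarrow> p i x = \<zero>"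
    and fin: "\<And>x. x \<in> carrier G \<Longrightarrow> finite {i. p i x \<noteq> \<zero>}"
    and inj: "\<And>x. x \<in> carrier G \<Longrightarrow> (\<And>i. p i x = \<zero>) \<Longrightarrow> x = \<zero>"
  shows "direct_decomposition G C"
  unfolding direct_decomposition_def
proof (intro conjI ballI allI)
  show "subgroup (C i) (add_monoid G)" for i
    using C unfolding additive_subgroup_def .
  fix x assume x: "x \<in> carrier G"
  note psum = projections_determine_sum[where C = C and p = p, OF C add same other]
  show "\<exists>!f. (\<forall>i. f i \<in> C i) \<and> finite {i. f i \<noteq> \<zero>} \<and> x = (\<Oplus>i \<in> {i. f i \<noteq> \<zero>}. f i)"
  proof (rule ex1I[of _ "\<lambda>i. p i x"])
    let ?y = "\<Oplus>i \<in> {i. p i x \<noteq> \<zero>}. p i x"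
    have cl: "p i z \<in> carrier G" if "z \<in> carrier G" for i z
      using sub_carrier[OF C mem[OF that]] .
    have y: "?y \<in> carrier G" using cl x by (intro finsum_closed) auto
    have "p i ?y = p i x" for i
      using psum[where f = "\<lambda>i. p i x" and S = "{i. p i x \<noteq> \<zero>}"] mem[OF x] fin[OF x] by auto
    have "p i (x \<oplus> \<ominus> ?y) = \<zero>" for i
    proof -
      have "p i (x \<oplus> \<ominus> ?y) \<oplus> p i ?y = p i (x \<oplus> \<ominus> ?y \<oplus> ?y)"
        using add x y by simp
      also have "\<dots> = p i ?y" using x y \<open>p i ?y = p i x\<close> by (simp add: a_assoc l_neg)
      finally show ?thesis
        using cl[of "x \<oplus> \<ominus> ?y"] cl[OF y] x y by simp
    qed
    then have "x \<oplus> \<ominus> ?y = \<zero>" using inj x y by simp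
    then have "x = ?y" using x y by (metis a_inv_closed minus_equality minus_minus)
    then show "(\<forall>i. p i x \<in> C i) \<and> finite {i. p i x \<noteq> \<zero>} \<and> x = ?y"
      using mem fin x by blast
  next
    fix f assume "(\<forall>i. f i \<in> C i) \<and> finite {i. f i \<noteq> \<zero>} \<and> x = (\<Oplus>i \<in> {i. f i \<noteq> \<zero>}. f i)"
    then show "f = (\<lambda>i. p i x)"
      using psum[where f = f and S = "{i. f i \<noteq> \<zero>}"] by (intro ext) auto
  qed
qed

text \<open>Identifies the components of a constructed grading with the projections that were used
  to construct it.\<close>

lemma (in graded_group) hpart_eqI:
  assumes add: "\<And>i x y. x \<in> carrier G \<Longrightarrow> y \<in> carrier G \<Longrightarrow> p i (x \<oplus> y) = p i x \<oplus> p i y"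
    and same: "\<And>i x. x \<in> C i \<Longrightarrow> p i x = x"
    and other: "\<And>i j x. x \<in> C j \<Longrightarrow> i \<noteq> j \<Longrightarrow> p i x = \<zero>"
    and x: "x \<in> carrier G"
  shows "hp i x = p i x"
  using projections_determine_sum[where p = p and f = "\<lambda>i. hp i x" and S = "{i. hp i x \<noteq> \<zero>}"
      and i = i, OF comp_subgroup add same other hpart_expansion(1,2)[OF x]]
    hpart_expansion(3)[OF x, symmetric] same[OF comp_zero] by (cases "hp i x = \<zero>") auto

section \<open>Graded modules over a standard graded ring\<close>

text \<open>A list is fixed once and for all, because \<open>lsum\<close> and
  \<open>eventually_generated\<close> recurse over a list of operators.\<close>

definition degree_one_gens :: "'a graded_ring \<Rightarrow> 'a list" where
  "degree_one_gens R = (SOME xs. set xs \<subseteq> rcomp R 1 \<and>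
    carrier R = generate_ring R (rcomp R 0 \<union> set xs))"

text \<open>Closure under components stands in for a direct decomposition of \<open>U\<close>. In
  this form the property passes easily to sums, intersections, unions of chains, and images and
  preimages under homogeneous scalars.\<close>

definition graded_sub :: "'a graded_ring \<Rightarrow> ('a, 'b) graded_module \<Rightarrow> 'b set \<Rightarrow> bool" where
  "graded_sub R M U \<longleftrightarrow> submodule U R M \<and> (\<forall>x \<in> U. \<forall>n. hpart M (mcomp M) n x \<in> U)"

text \<open>This is \<open>y_1 U + ... + y_k U\<close>, without further multiples from the ring:
  \<open>U\<close> may be a mere subgroup, such as a single graded component.\<close>

fun lsum :: "('a, 'b, 'd) module_scheme \<Rightarrow> 'a list \<Rightarrow> 'b set \<Rightarrow> 'b set" where
  "lsum M [] U = {\<zero>\<^bsub>M\<^esub>}"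
| "lsum M (y # ys) U = {y \<odot>\<^bsub>M\<^esub> u \<oplus>\<^bsub>M\<^esub> z | u z. u \<in> U \<and> z \<in> lsum M ys U}"

definition add_sets :: "('b, 'd) ring_scheme \<Rightarrow> 'b set \<Rightarrow> 'b set \<Rightarrow> 'b set" where
  "add_sets G A B = {a \<oplus>\<^bsub>G\<^esub> b | a b. a \<in> A \<and> b \<in> B}"

section \<open>Additive subgroups, their sums, and spans\<close>

lemma (in abelian_group) additive_subgroupI':
  assumes "A \<subseteq> carrier G" "\<zero> \<in> A" "\<And>x y. x \<in> A \<Longrightarrow> y \<in> A \<Longrightarrow> x \<oplus> y \<in> A"
    "\<And>x. x \<in> A \<Longrightarrow> \<ominus> x \<in> A"
  shows "additive_subgroup A G"
  using assms by (intro additive_subgroupI add.subgroupI) (auto simp: a_inv_def)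

lemma (in abelian_group) add_sets_subgroup:
  assumes A: "additive_subgroup A G" and B: "additive_subgroup B G"
  shows "additive_subgroup (add_sets G A B) G"
proof (rule additive_subgroupI')
  note [simp] = sub_add[OF A] sub_add[OF B]
    sub_carrier[OF A] sub_carrier[OF B]
    sub_zero[OF A] sub_zero[OF B]
    sub_neg[OF A] sub_neg[OF B]
  show "add_sets G A B \<subseteq> carrier G" unfolding add_sets_def by auto
  show "\<zero> \<in> add_sets G A B" unfolding add_sets_def by (auto intro!: exI[of _ \<zero>])
  show "x \<oplus> y \<in> add_sets G A B" if "x \<in> add_sets G A B" "y \<in> add_sets G A B" for x y
  proof -
    obtain a b c d where *: "a \<in> A" "b \<in> B" "c \<in> A" "d \<in> B" "x = a \<oplus> b" "y = c \<oplus> d"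
      using \<open>x \<in> _\<close> \<open>y \<in> _\<close> unfolding add_sets_def by blast
    then have "x \<oplus> y = (a \<oplus> c) \<oplus> (b \<oplus> d)" by (simp add: a_ac)
    then show ?thesis using * unfolding add_sets_def by fastforce
  qed
  show "\<ominus> x \<in> add_sets G A B" if x: "x \<in> add_sets G A B" for x
  proof -
    obtain a b where *: "a \<in> A" "b \<in> B" "x = a \<oplus> b"
      using x unfolding add_sets_def by blast
    then have "\<ominus> x = \<ominus> a \<oplus> \<ominus> b" by (simp add: minus_add)
    then show ?thesis using * unfolding add_sets_def by fastforce
  qed
qed

lemma add_setsI: "a \<in> A \<Longrightarrow> b \<in> B \<Longrightarrow> a \<oplus>\<^bsub>G\<^esub> b \<in> add_sets G A B"
  unfolding add_sets_def by blast

lemma (in abelian_group) subset_add_sets: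
  assumes A: "additive_subgroup A G" and B: "additive_subgroup B G"
  shows "A \<subseteq> add_sets G A B" "B \<subseteq> add_sets G A B"
proof -
  have "a \<oplus> \<zero> \<in> add_sets G A B" if "a \<in> A" for a
    using that sub_zero[OF B] by (rule add_setsI)
  then show "A \<subseteq> add_sets G A B" using sub_carrier[OF A] by auto
  have "\<zero> \<oplus> b \<in> add_sets G A B" if "b \<in> B" for b
    using sub_zero[OF A] that by (rule add_setsI)
  then show "B \<subseteq> add_sets G A B" using sub_carrier[OF B] by auto
qed

lemma add_sets_least:
  assumes "additive_subgroup D G" "A \<subseteq> D" "B \<subseteq> D"
  shows "add_sets G A B \<subseteq> D"
  using assms sub_add[OF assms(1)] unfolding add_sets_def by auto

context module begin

lemma generate_least:
  assumes "additive_subgroup A M" "H \<subseteq> A"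
  shows "generate (add_monoid M) H \<subseteq> A"
  using assms M.add.generate_subgroup_incl additive_subgroup.a_subgroup by metis

lemma set_smult_least:
  assumes "additive_subgroup A M" "\<And>a x. a \<in> S \<Longrightarrow> x \<in> B \<Longrightarrow> a \<odot>\<^bsub>M\<^esub> x \<in> A"
  shows "set_smult M S B \<subseteq> A"
  unfolding set_smult_def using assms by (intro generate_least) auto

lemma set_smultI: "a \<in> S \<Longrightarrow> x \<in> B \<Longrightarrow> a \<odot>\<^bsub>M\<^esub> x \<in> set_smult M S B"
  unfolding set_smult_def by (intro generate.incl) auto

lemma set_smult_subgroup:
  assumes "S \<subseteq> carrier R" "B \<subseteq> carrier M"
  shows "additive_subgroup (set_smult M S B) M"
  unfolding set_smult_def
  by (intro additive_subgroupI M.add.generate_is_subgroup) (use assms in \<open>auto simp: subset_iff\<close>)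

lemma set_smult_mono: "S \<subseteq> S' \<Longrightarrow> B \<subseteq> B' \<Longrightarrow> set_smult M S B \<subseteq> set_smult M S' B'"
  unfolding set_smult_def by (intro M.add.mono_generate) auto

text \<open>Together with the next lemma this turns \<open>set_smult_least\<close> and
  \<open>lsum_least\<close> into induction rules: a statement about a whole span is reduced to
  single products of generators.\<close>

lemma smult_preimage_subgroup:
  assumes "additive_subgroup A M" "a \<in> carrier R"
  shows "additive_subgroup {x \<in> carrier M. a \<odot>\<^bsub>M\<^esub> x \<in> A} M"
  using assms sub_add[OF assms(1)] sub_zero[OF assms(1)]
    sub_neg[OF assms(1)]
  by (intro M.additive_subgroupI') (auto simp: smult_r_distr smult_r_minus)

lemma scalar_preimage_subgroup:
  assumes "additive_subgroup A M" "x \<in> carrier M"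
  shows "additive_subgroup {a \<in> carrier R. a \<odot>\<^bsub>M\<^esub> x \<in> A} R"
  using assms sub_add[OF assms(1)] sub_zero[OF assms(1)]
    sub_neg[OF assms(1)]
  by (intro R.additive_subgroupI') (auto simp: smult_l_distr smult_l_minus)

lemma smult_image_subgroup:
  assumes "additive_subgroup A M" "a \<in> carrier R"
  shows "additive_subgroup ((\<lambda>x. a \<odot>\<^bsub>M\<^esub> x) ` A) M"
proof (rule M.additive_subgroupI')
  note A [simp] = sub_add[OF assms(1)] sub_zero[OF assms(1)]
    sub_neg[OF assms(1)] sub_carrier[OF assms(1)] assms(2)
  show "(\<lambda>x. a \<odot>\<^bsub>M\<^esub> x) ` A \<subseteq> carrier M" by auto
  show "\<zero>\<^bsub>M\<^esub> \<in> (\<lambda>x. a \<odot>\<^bsub>M\<^esub> x) ` A" by (rule image_eqI[of _ _ "\<zero>\<^bsub>M\<^esub>"]) auto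
  fix x assume "x \<in> (\<lambda>x. a \<odot>\<^bsub>M\<^esub> x) ` A"
  then obtain u where u: "u \<in> A" "x = a \<odot>\<^bsub>M\<^esub> u" by blast
  then show "\<ominus>\<^bsub>M\<^esub> x \<in> (\<lambda>x. a \<odot>\<^bsub>M\<^esub> x) ` A"
    by (intro image_eqI[of _ _ "\<ominus>\<^bsub>M\<^esub> u"]) (auto simp: smult_r_minus)
  fix y assume "y \<in> (\<lambda>x. a \<odot>\<^bsub>M\<^esub> x) ` A"
  then obtain v where v: "v \<in> A" "y = a \<odot>\<^bsub>M\<^esub> v" by blast
  then show "x \<oplus>\<^bsub>M\<^esub> y \<in> (\<lambda>x. a \<odot>\<^bsub>M\<^esub> x) ` A"
    using u by (intro image_eqI[of _ _ "u \<oplus>\<^bsub>M\<^esub> v"]) (auto simp: smult_r_distr)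
qed

lemma lsum_Cons_add_sets: "lsum M (y # ys) U = add_sets M ((\<lambda>x. y \<odot>\<^bsub>M\<^esub> x) ` U) (lsum M ys U)"
  unfolding add_sets_def by auto

lemma lsum_subgroup:
  assumes "set ys \<subseteq> carrier R" "additive_subgroup U M"
  shows "additive_subgroup (lsum M ys U) M"
  using assms(1)
proof (induction ys)
  case Nil
  show ?case by (simp, rule M.additive_subgroupI') auto
next
  case (Cons y ys)
  then show ?case
    unfolding lsum_Cons_add_sets using assms(2)
    by (intro M.add_sets_subgroup smult_image_subgroup) auto
qed

lemma lsumI:
  assumes "set ys \<subseteq> carrier R" "additive_subgroup U M" "y \<in> set ys" "u \<in> U"
  shows "y \<odot>\<^bsub>M\<^esub> u \<in> lsum M ys U"
  using assms(1,3)
proof (induction ys)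
  case (Cons z ys)
  have "additive_subgroup ((\<lambda>x. z \<odot>\<^bsub>M\<^esub> x) ` U) M" "additive_subgroup (lsum M ys U) M"
    using Cons assms(2) smult_image_subgroup lsum_subgroup by auto
  from M.subset_add_sets[OF this] show ?case
    unfolding lsum_Cons_add_sets using Cons assms(4) by fastforce
qed auto

lemma lsum_least:
  assumes "additive_subgroup A M" "\<And>y u. y \<in> set ys \<Longrightarrow> u \<in> U \<Longrightarrow> y \<odot>\<^bsub>M\<^esub> u \<in> A"
  shows "lsum M ys U \<subseteq> A"
  using assms(2)
proof (induction ys)
  case Nil
  then show ?case using sub_zero[OF assms(1)] by simp
next
  case (Cons y ys)
  then show ?case
    unfolding lsum_Cons_add_sets by (intro add_sets_least assms(1)) auto
qed

lemma submodule_subgroup: "submodule U R M \<Longrightarrow> additive_subgroup U M"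
  unfolding submodule_def additive_subgroup_def by simp

lemma submodule_iff:
  "submodule U R M \<longleftrightarrow> additive_subgroup U M \<and> (\<forall>a \<in> carrier R. \<forall>x \<in> U. a \<odot>\<^bsub>M\<^esub> x \<in> U)"
  unfolding submodule_def submodule_axioms_def additive_subgroup_def by blast

lemma smult_smult_comm:
  "a \<in> carrier R \<Longrightarrow> b \<in> carrier R \<Longrightarrow> x \<in> carrier M \<Longrightarrow> a \<odot>\<^bsub>M\<^esub> (b \<odot>\<^bsub>M\<^esub> x) = b \<odot>\<^bsub>M\<^esub> (a \<odot>\<^bsub>M\<^esub> x)"
  by (metis smult_assoc1 R.m_comm)

end

section \<open>Standard graded rings and graded modules over them\<close>

locale std_graded = cring R for R :: "'a graded_ring" (structure) +
  assumes std: "standard_graded R"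
    and noeth: "noetherian_ring (base_ring R)"
begin

sublocale RG: graded_group R "rcomp R"
  using std unfolding standard_graded_def by unfold_locales auto

abbreviation xs where "xs \<equiv> degree_one_gens R"

lemma rcomp_mult: "a \<in> rcomp R i \<Longrightarrow> b \<in> rcomp R j \<Longrightarrow> a \<otimes> b \<in> rcomp R (i + j)"
  using std unfolding standard_graded_def by blast

lemma degree_one_gens: "set xs \<subseteq> rcomp R 1" "carrier R = generate_ring R (rcomp R 0 \<union> set xs)"
proof -
  obtain B where "B \<subseteq> rcomp R 1" "finite B" "carrier R = generate_ring R (rcomp R 0 \<union> B)"
    using std unfolding standard_graded_def by blast
  then have "\<exists>xs. set xs \<subseteq> rcomp R 1 \<and> carrier R = generate_ring R (rcomp R 0 \<union> set xs)"
    by (metis finite_list)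
  from someI_ex[OF this]
  show "set xs \<subseteq> rcomp R 1" "carrier R = generate_ring R (rcomp R 0 \<union> set xs)"
    unfolding degree_one_gens_def by blast+
qed

lemma xs_carrier: "set xs \<subseteq> carrier R"
  using degree_one_gens(1) RG.comp_carrier by blast

end

locale graded_mod = R?: std_graded R + module R M for R :: "'a graded_ring" (structure)
  and M :: "('a, 'b) graded_module" (structure) +
  assumes mdecomp: "direct_decomposition M (mcomp M)"
    and mdeg: "\<And>r x i n. r \<in> rcomp R i \<Longrightarrow> x \<in> mcomp M n \<Longrightarrow> r \<odot>\<^bsub>M\<^esub> x \<in> mcomp M (int i + n)"
begin

sublocale MG: graded_group M "mcomp M"
  using mdecomp by unfold_locales auto

lemma hp_smult:
  assumes r: "r \<in> rcomp R i" and x: "x \<in> carrier M"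
  shows "MG.hp n (r \<odot>\<^bsub>M\<^esub> x) = r \<odot>\<^bsub>M\<^esub> MG.hp (n - int i) x"
proof -
  note [simp] = RG.comp_carrier[OF r]
  let ?A = "{x \<in> carrier M. MG.hp n (r \<odot>\<^bsub>M\<^esub> x) = r \<odot>\<^bsub>M\<^esub> MG.hp (n - int i) x}"
  have "carrier M \<subseteq> ?A"
  proof (rule MG.carrier_subset_of_comp)
    show "additive_subgroup ?A M"
      by (rule M.additive_subgroupI')
        (auto simp: smult_r_distr smult_r_minus MG.hpart_add MG.hpart_minus)
    show "mcomp M m \<subseteq> ?A" for m
    proof
      fix x assume x: "x \<in> mcomp M m"
      have "r \<odot>\<^bsub>M\<^esub> x \<in> mcomp M (int i + m)" using mdeg r x .
      then show "x \<in> ?A"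
        using x MG.comp_carrier[OF x]
        by (cases "n = int i + m") (auto simp: MG.hpart_same MG.hpart_other)
    qed
  qed
  then show ?thesis using x by blast
qed

lemma gsub_submodule: "graded_sub R M U \<Longrightarrow> submodule U R M"
  unfolding graded_sub_def by simp

lemma gsub_subgroup: "graded_sub R M U \<Longrightarrow> additive_subgroup U M"
  using gsub_submodule submodule_subgroup by blast

lemma gsub_carrier: "graded_sub R M U \<Longrightarrow> x \<in> U \<Longrightarrow> x \<in> carrier M"
  using sub_carrier[OF gsub_subgroup] .

lemma gsub_smult: "graded_sub R M U \<Longrightarrow> x \<in> U \<Longrightarrow> a \<in> carrier R \<Longrightarrow> a \<odot>\<^bsub>M\<^esub> x \<in> U"
  using gsub_submodule submodule_iff by blast

lemma gsub_hp: "graded_sub R M U \<Longrightarrow> x \<in> U \<Longrightarrow> MG.hp n x \<in> U"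
  unfolding graded_sub_def by simp

lemma gsubI:
  assumes "additive_subgroup U M" "\<And>a x. a \<in> carrier R \<Longrightarrow> x \<in> U \<Longrightarrow> a \<odot>\<^bsub>M\<^esub> x \<in> U"
    "\<And>x n. x \<in> U \<Longrightarrow> MG.hp n x \<in> U"
  shows "graded_sub R M U"
  unfolding graded_sub_def submodule_iff using assms by blast

lemma gsub_carrier_self: "graded_sub R M (carrier M)"
  by (rule gsubI, rule M.additive_subgroupI') auto

lemma gsub_zero: "graded_sub R M {\<zero>\<^bsub>M\<^esub>}"
  by (rule gsubI, rule M.additive_subgroupI') auto

lemma gsub_add_sets:
  assumes U: "graded_sub R M U" and V: "graded_sub R M V"
  shows "graded_sub R M (add_sets M U V)"
proof (rule gsubI)
  show "additive_subgroup (add_sets M U V) M"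
    using M.add_sets_subgroup gsub_subgroup U V by blast
  fix x assume "x \<in> add_sets M U V"
  then obtain u v where *: "u \<in> U" "v \<in> V" "x = u \<oplus>\<^bsub>M\<^esub> v" unfolding add_sets_def by blast
  note carr = gsub_carrier[OF U *(1)] gsub_carrier[OF V *(2)]
  show "MG.hp n x \<in> add_sets M U V" for n
    using * carr gsub_hp[OF U *(1)] gsub_hp[OF V *(2)] by (simp add: MG.hpart_add add_setsI)
  show "a \<odot>\<^bsub>M\<^esub> x \<in> add_sets M U V" if "a \<in> carrier R" for a
    using * carr gsub_smult[OF U *(1)] gsub_smult[OF V *(2)] that
    by (simp add: smult_r_distr add_setsI)
qed

lemma gsub_image:
  assumes U: "graded_sub R M U" and r: "r \<in> rcomp R i"
  shows "graded_sub R M ((\<lambda>x. r \<odot>\<^bsub>M\<^esub> x) ` U)"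
proof (rule gsubI)
  note [simp] = RG.comp_carrier[OF r] gsub_carrier[OF U]
  show "additive_subgroup ((\<lambda>x. r \<odot>\<^bsub>M\<^esub> x) ` U) M"
    by (intro smult_image_subgroup gsub_subgroup U) simp
  show "a \<odot>\<^bsub>M\<^esub> x \<in> (\<lambda>x. r \<odot>\<^bsub>M\<^esub> x) ` U" if a: "a \<in> carrier R" and x: "x \<in> (\<lambda>x. r \<odot>\<^bsub>M\<^esub> x) ` U" for a x
  proof -
    obtain u where u: "u \<in> U" "x = r \<odot>\<^bsub>M\<^esub> u" using x by blast
    then have "a \<odot>\<^bsub>M\<^esub> x = r \<odot>\<^bsub>M\<^esub> (a \<odot>\<^bsub>M\<^esub> u)" using a smult_smult_comm by simp
    then show ?thesis using gsub_smult[OF U u(1) a] by blast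
  qed
  show "MG.hp n x \<in> (\<lambda>x. r \<odot>\<^bsub>M\<^esub> x) ` U" if "x \<in> (\<lambda>x. r \<odot>\<^bsub>M\<^esub> x) ` U" for n x
    using that hp_smult[OF r] gsub_hp[OF U] by auto
qed

lemma gsub_preimage:
  assumes U: "graded_sub R M U" and V: "graded_sub R M V" and r: "r \<in> rcomp R i"
  shows "graded_sub R M {x \<in> U. r \<odot>\<^bsub>M\<^esub> x \<in> V}"
proof (rule gsubI)
  note [simp] = RG.comp_carrier[OF r] gsub_carrier[OF U]
  have "additive_subgroup {x \<in> carrier M. r \<odot>\<^bsub>M\<^esub> x \<in> V} M"
    by (intro smult_preimage_subgroup gsub_subgroup V) simp
  then show "additive_subgroup {x \<in> U. r \<odot>\<^bsub>M\<^esub> x \<in> V} M"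
    using gsub_subgroup[OF U]
    by (intro M.additive_subgroupI')
      (auto simp: sub_zero sub_add[OF gsub_subgroup]
        smult_r_distr smult_r_minus U V sub_neg[OF gsub_subgroup] gsub_subgroup)
  show "a \<odot>\<^bsub>M\<^esub> x \<in> {x \<in> U. r \<odot>\<^bsub>M\<^esub> x \<in> V}" if "a \<in> carrier R" "x \<in> {x \<in> U. r \<odot>\<^bsub>M\<^esub> x \<in> V}" for a x
    using that gsub_smult[OF U] gsub_smult[OF V] smult_smult_comm[of r a x] by simp
  show "MG.hp n x \<in> {x \<in> U. r \<odot>\<^bsub>M\<^esub> x \<in> V}" if x: "x \<in> {x \<in> U. r \<odot>\<^bsub>M\<^esub> x \<in> V}" for n x
  proof -
    have "MG.hp (n + int i) (r \<odot>\<^bsub>M\<^esub> x) \<in> V" using gsub_hp[OF V] x by blast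
    then show ?thesis using x hp_smult[OF r, of x "n + int i"] gsub_hp[OF U] by simp
  qed
qed

lemma chain_Union_subgroup:
  assumes "\<And>k::nat. additive_subgroup (W k) M" "\<And>k. W k \<subseteq> W (Suc k)"
  shows "additive_subgroup (\<Union>k. W k) M"
proof -
  have mono: "W k \<subseteq> W l" if "k \<le> l" for k l using lift_Suc_mono_le[of W] assms(2) that by blast
  note [simp] = sub_add[OF assms(1)] sub_zero[OF assms(1)]
    sub_neg[OF assms(1)] sub_carrier[OF assms(1)]
  show ?thesis
  proof (rule M.additive_subgroupI')
    fix x y assume "x \<in> (\<Union>k. W k)" "y \<in> (\<Union>k. W k)"
    then obtain k l where k: "x \<in> W k" and "y \<in> W l" by blast
    then have "x \<in> W (max k l)" "y \<in> W (max k l)" using mono max.cobounded1 max.cobounded2 by blast+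
    then show "x \<oplus>\<^bsub>M\<^esub> y \<in> (\<Union>k. W k)" using sub_add[OF assms(1)] by blast
    show "\<ominus>\<^bsub>M\<^esub> x \<in> (\<Union>k. W k)"
      using k sub_neg[OF assms(1)] by blast
  qed (use sub_zero[OF assms(1)] sub_carrier[OF assms(1)] in auto)
qed

lemma gsub_chain_Union:
  assumes "\<And>k::nat. graded_sub R M (W k)" "\<And>k. W k \<subseteq> W (Suc k)"
  shows "graded_sub R M (\<Union>k. W k)"
  using chain_Union_subgroup[of W] assms gsub_subgroup
  by (intro gsubI) (auto intro: gsub_smult[OF assms(1)] gsub_hp[OF assms(1)])

text \<open>The common core of \<open>gsub_span\<close> and \<open>gsub_ideal_smult\<close>. It is
  enough to control the components of single products, since the elements whose components lie in
  the span form a subgroup.\<close>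

lemma gsub_set_smult:
  assumes S: "S \<subseteq> carrier R" "\<And>a s. a \<in> carrier R \<Longrightarrow> s \<in> S \<Longrightarrow> a \<otimes>\<^bsub>R\<^esub> s \<in> S"
    and B: "B \<subseteq> carrier M"
    and hp: "\<And>s b n. s \<in> S \<Longrightarrow> b \<in> B \<Longrightarrow> MG.hp n (s \<odot>\<^bsub>M\<^esub> b) \<in> set_smult M S B"
  shows "graded_sub R M (set_smult M S B)"
proof (rule gsubI)
  let ?V = "set_smult M S B"
  show V: "additive_subgroup ?V M" using set_smult_subgroup S(1) B by blast
  have Vc: "?V \<subseteq> carrier M" using sub_subset[OF V] .
  show "a \<odot>\<^bsub>M\<^esub> x \<in> ?V" if "a \<in> carrier R" "x \<in> ?V" for a x
  proof -
    have "?V \<subseteq> {x \<in> carrier M. a \<odot>\<^bsub>M\<^esub> x \<in> ?V}"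
    proof (rule set_smult_least)
      show "additive_subgroup {x \<in> carrier M. a \<odot>\<^bsub>M\<^esub> x \<in> ?V} M"
        using smult_preimage_subgroup V that by blast
      fix s b assume sb: "s \<in> S" "b \<in> B"
      then have "(a \<otimes>\<^bsub>R\<^esub> s) \<odot>\<^bsub>M\<^esub> b \<in> ?V" using S(2) that set_smultI by blast
      moreover have "(a \<otimes>\<^bsub>R\<^esub> s) \<odot>\<^bsub>M\<^esub> b = a \<odot>\<^bsub>M\<^esub> (s \<odot>\<^bsub>M\<^esub> b)"
        using sb S(1) B that smult_assoc1 by blast
      ultimately show "s \<odot>\<^bsub>M\<^esub> b \<in> {x \<in> carrier M. a \<odot>\<^bsub>M\<^esub> x \<in> ?V}"
        using sb S(1) B by auto
    qed
    then show ?thesis using that by blast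
  qed
  show "MG.hp n x \<in> ?V" if "x \<in> ?V" for n x
  proof -
    have "?V \<subseteq> {x \<in> carrier M. MG.hp n x \<in> ?V}"
    proof (rule set_smult_least)
      show "additive_subgroup {x \<in> carrier M. MG.hp n x \<in> ?V} M"
        using sub_add[OF V] sub_zero[OF V]
          sub_neg[OF V]
        by (intro M.additive_subgroupI') (auto simp: MG.hpart_add MG.hpart_minus)
    qed (use hp S(1) B in auto)
    then show ?thesis using that by blast
  qed
qed

lemma gsub_span:
  assumes X: "\<And>x. x \<in> X \<Longrightarrow> \<exists>n. x \<in> mcomp M n"
  shows "graded_sub R M (set_smult M (carrier R) X)" "X \<subseteq> set_smult M (carrier R) X"
proof -
  let ?V = "set_smult M (carrier R) X"
  have Xc: "X \<subseteq> carrier M" using X MG.comp_carrier by blast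
  have V: "additive_subgroup ?V M" using set_smult_subgroup Xc by blast
  show "X \<subseteq> ?V"
  proof
    fix x assume "x \<in> X"
    then have "\<one>\<^bsub>R\<^esub> \<odot>\<^bsub>M\<^esub> x \<in> ?V" by (intro set_smultI) auto
    then show "x \<in> ?V" using Xc \<open>x \<in> X\<close> by auto
  qed
  have hp: "MG.hp n (s \<odot>\<^bsub>M\<^esub> b) \<in> ?V" if "s \<in> carrier R" "b \<in> X" for s b n
  proof -
    obtain m where m: "b \<in> mcomp M m" using X \<open>b \<in> X\<close> by blast
    have bc: "b \<in> carrier M" using m MG.comp_carrier by blast
    let ?A = "{s \<in> carrier R. MG.hp n (s \<odot>\<^bsub>M\<^esub> b) \<in> ?V}"
    have "carrier R \<subseteq> ?A"
    proof (rule RG.carrier_subset_of_comp)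
      show "additive_subgroup ?A R"
        using sub_add[OF V] sub_zero[OF V]
          sub_neg[OF V] bc
        by (intro R.additive_subgroupI')
          (auto simp: MG.hpart_add MG.hpart_minus smult_l_distr smult_l_minus)
      show "rcomp R i \<subseteq> ?A" for i
      proof
        fix r assume r: "r \<in> rcomp R i"
        have rc: "r \<in> carrier R" using RG.comp_carrier[OF r] .
        have "r \<odot>\<^bsub>M\<^esub> MG.hp (n - int i) b \<in> ?V"
        proof (cases "n - int i = m")
          case True
          then show ?thesis using MG.hpart_same[OF m] set_smultI[OF rc \<open>b \<in> X\<close>] by simp
        next
          case False
          then show ?thesis using MG.hpart_other[OF m] rc sub_zero[OF V] by simp
        qed
        then show "r \<in> ?A" using hp_smult[OF r bc] rc by simp
      qed
    qed
    then show ?thesis using that by blast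
  qed
  show "graded_sub R M ?V"
    by (rule gsub_set_smult) (use Xc hp in auto)
qed

text \<open>The scalars that map \<open>A\<close> into itself form a subring, and the ring is
  generated by its degree zero part and \<open>xs\<close>. Inductions on generation therefore treat
  only scalars of degree 0 and 1.\<close>

lemma stable_under_generators:
  assumes A: "additive_subgroup A M"
    and R0: "\<And>r x. r \<in> rcomp R 0 \<Longrightarrow> x \<in> A \<Longrightarrow> r \<odot>\<^bsub>M\<^esub> x \<in> A"
    and R1: "\<And>r x. r \<in> set xs \<Longrightarrow> x \<in> A \<Longrightarrow> r \<odot>\<^bsub>M\<^esub> x \<in> A"
    and "a \<in> carrier R" "x \<in> A"
  shows "a \<odot>\<^bsub>M\<^esub> x \<in> A"
proof -
  note [simp] = sub_carrier[OF A] sub_add[OF A]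
    sub_neg[OF A]
  have sub: "rcomp R 0 \<union> set xs \<subseteq> carrier R" using RG.comp_carrier xs_carrier by blast
  have c: "generate_ring R (rcomp R 0 \<union> set xs) \<subseteq> carrier R" using degree_one_gens(2) by simp
  have "a \<in> generate_ring R (rcomp R 0 \<union> set xs)" using assms(4) degree_one_gens(2) by simp
  then have "\<forall>x \<in> A. a \<odot>\<^bsub>M\<^esub> x \<in> A"
  proof induction
    case (a_inv h)
    then show ?case using c by (auto simp: smult_l_minus)
  next
    case (eng_add h1 h2)
    then have "h1 \<in> carrier R" "h2 \<in> carrier R" using c by auto
    then show ?case using eng_add by (auto simp: smult_l_distr)
  next
    case (eng_mult h1 h2)
    then have "h1 \<in> carrier R" "h2 \<in> carrier R" using c by auto
    then show ?case using eng_mult by (auto simp: smult_assoc1)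
  qed (use R0 R1 in auto)
  then show ?thesis using assms(5) by blast
qed

end

section \<open>Finitely generated graded modules, degree by degree\<close>

locale fg_graded_mod = graded_mod +
  assumes fg: "\<exists>B \<subseteq> carrier M. finite B \<and> carrier M = set_smult M (carrier R) B"

lemma fg_graded_mod_iff:
  "standard_graded R \<Longrightarrow> noetherian_ring (base_ring R) \<Longrightarrow> fg_graded_module R M \<longleftrightarrow> fg_graded_mod R M"
  unfolding fg_graded_mod_def fg_graded_mod_axioms_def graded_mod_def graded_mod_axioms_def
    std_graded_def std_graded_axioms_def
    fg_graded_module_def module_def standard_graded_def by auto

text \<open>\<open>base_ring R\<close> differs from \<open>R\<close> only in its carrier, so both
  have the same unit; that \<open>base_ring R\<close> is a ring puts this unit in degree 0.\<close>

lemma (in std_graded) one_comp: "\<one> \<in> rcomp R 0"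
  using ring.ring_simprules(6)[OF noetherian_ring.axioms(1)[OF noeth]] unfolding base_ring_def by simp

context fg_graded_mod begin

lemma generation_induct:
  assumes A: "additive_subgroup A M"
    and R0: "\<And>r x. r \<in> rcomp R 0 \<Longrightarrow> x \<in> A \<Longrightarrow> r \<odot>\<^bsub>M\<^esub> x \<in> A"
    and R1: "\<And>r x. r \<in> set xs \<Longrightarrow> x \<in> A \<Longrightarrow> r \<odot>\<^bsub>M\<^esub> x \<in> A"
    and B: "B \<subseteq> A" "carrier M = set_smult M (carrier R) B"
  shows "carrier M \<subseteq> A"
  unfolding B(2) using assms stable_under_generators[OF A R0 R1]
  by (intro set_smult_least A) auto

text \<open>The sum of the degree-zero span of \<open>B\<close> and
  \<open>lsum M xs (carrier M)\<close> contains \<open>B\<close> and is stable under degree-zero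
  scalars and \<open>xs\<close>, so it is all of \<open>M\<close>; passing to components of degree
  \<open>a\<close> gives the last claim. The elements of \<open>B\<close> need not be homogeneous,
  hence their components \<open>MG.hp a b\<close>, which vanish for almost all \<open>a\<close>.
  This recursion on the degree is the form in which finite generation is used.\<close>

lemma component_generation:
  obtains B where "finite B" "B \<subseteq> carrier M" "carrier M = set_smult M (carrier R) B"
    "\<And>a. mcomp M a \<subseteq> add_sets M (set_smult M (rcomp R 0) (MG.hp a ` B)) (lsum M xs (mcomp M (a - 1)))"
proof -
  obtain B where B: "B \<subseteq> carrier M" "finite B" "carrier M = set_smult M (carrier R) B"
    using fg by blast
  let ?W = "set_smult M (rcomp R 0) B" and ?L = "lsum M xs (carrier M)"
  let ?A = "add_sets M ?W ?L"
  have R0: "rcomp R 0 \<subseteq> carrier R" using RG.comp_carrier by blast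
  have W: "additive_subgroup ?W M" using R0 B(1) set_smult_subgroup by blast
  have cM: "additive_subgroup (carrier M) M" by (rule M.additive_subgroupI') auto
  have L: "additive_subgroup ?L M" using lsum_subgroup xs_carrier cM by blast
  have A: "additive_subgroup ?A M" using M.add_sets_subgroup W L by blast
  note sub = M.subset_add_sets[OF W L]
  have Ac: "?A \<subseteq> carrier M" using sub_subset[OF A] .
  have "carrier M \<subseteq> ?A"
  proof (rule generation_induct[OF A _ _ _ B(3)])
    show "r \<odot>\<^bsub>M\<^esub> x \<in> ?A" if "r \<in> set xs" "x \<in> ?A" for r x
      using lsumI[OF xs_carrier cM that(1)] that(2) Ac sub(2) by blast
    have "\<one>\<^bsub>R\<^esub> \<odot>\<^bsub>M\<^esub> b \<in> ?W" if "b \<in> B" for b using one_comp that by (rule set_smultI)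
    then show "B \<subseteq> ?A" using B(1) sub(1) by fastforce
    fix r x assume r: "r \<in> rcomp R 0" and x: "x \<in> ?A"
    have rc: "r \<in> carrier R" using r R0 by blast
    have pre: "additive_subgroup {x \<in> carrier M. r \<odot>\<^bsub>M\<^esub> x \<in> ?A} M"
      by (rule smult_preimage_subgroup[OF A rc])
    have "?W \<subseteq> {x \<in> carrier M. r \<odot>\<^bsub>M\<^esub> x \<in> ?A}"
    proof (rule set_smult_least[OF pre])
      fix s b assume sb: "s \<in> rcomp R 0" "b \<in> B"
      have "r \<otimes>\<^bsub>R\<^esub> s \<in> rcomp R 0" using rcomp_mult[OF r sb(1)] by simp
      then have "(r \<otimes>\<^bsub>R\<^esub> s) \<odot>\<^bsub>M\<^esub> b \<in> ?W" using sb(2) by (rule set_smultI)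
      moreover have "s \<in> carrier R" "b \<in> carrier M" using sb R0 B(1) by auto
      ultimately show "s \<odot>\<^bsub>M\<^esub> b \<in> {x \<in> carrier M. r \<odot>\<^bsub>M\<^esub> x \<in> ?A}"
        using sub(1) rc by (auto simp: smult_assoc1)
    qed
    moreover have "?L \<subseteq> {x \<in> carrier M. r \<odot>\<^bsub>M\<^esub> x \<in> ?A}"
    proof (rule lsum_least[OF pre])
      fix y u assume yu: "y \<in> set xs" "u \<in> carrier M"
      have y: "y \<in> carrier R" using yu xs_carrier by blast
      have "y \<odot>\<^bsub>M\<^esub> (r \<odot>\<^bsub>M\<^esub> u) \<in> ?L" using lsumI[OF xs_carrier cM yu(1)] yu rc by simp
      then show "y \<odot>\<^bsub>M\<^esub> u \<in> {x \<in> carrier M. r \<odot>\<^bsub>M\<^esub> x \<in> ?A}"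
        using sub(2) y yu rc smult_smult_comm[of y r u] by auto
    qed
    ultimately have "?A \<subseteq> {x \<in> carrier M. r \<odot>\<^bsub>M\<^esub> x \<in> ?A}" using add_sets_least[OF pre] by blast
    then show "r \<odot>\<^bsub>M\<^esub> x \<in> ?A" using x by blast
  qed
  have "mcomp M a \<subseteq> add_sets M (set_smult M (rcomp R 0) (MG.hp a ` B)) (lsum M xs (mcomp M (a - 1)))"
    (is "_ \<subseteq> add_sets M ?W' ?L'") for a
  proof
    have W': "additive_subgroup ?W' M" using R0 B(1) by (intro set_smult_subgroup) auto
    have L': "additive_subgroup ?L' M" by (intro lsum_subgroup xs_carrier MG.comp_subgroup)
    have hpre: "additive_subgroup {x \<in> carrier M. MG.hp a x \<in> A} M" if "additive_subgroup A M" for A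
      using sub_add[OF that] sub_zero[OF that]
          sub_neg[OF that]
      by (intro M.additive_subgroupI') (auto simp: MG.hpart_add MG.hpart_minus)
    have 1: "?W \<subseteq> {x \<in> carrier M. MG.hp a x \<in> ?W'}"
    proof (rule set_smult_least[OF hpre[OF W']])
      fix s b assume "s \<in> rcomp R 0" "b \<in> B"
      then show "s \<odot>\<^bsub>M\<^esub> b \<in> {x \<in> carrier M. MG.hp a x \<in> ?W'}"
        using hp_smult[of s 0 b a] set_smultI[of s "rcomp R 0" "MG.hp a b" "MG.hp a ` B"] R0 B(1)
          by auto
    qed
    have 2: "?L \<subseteq> {x \<in> carrier M. MG.hp a x \<in> ?L'}"
    proof (rule lsum_least[OF hpre[OF L']])
      fix y u assume yu: "y \<in> set xs" "u \<in> carrier M"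
      have y: "y \<in> rcomp R 1" using yu degree_one_gens(1) by blast
      have "y \<odot>\<^bsub>M\<^esub> MG.hp (a - 1) u \<in> ?L'"
        by (intro lsumI xs_carrier MG.comp_subgroup yu MG.hpart_expansion(1))
      then show "y \<odot>\<^bsub>M\<^esub> u \<in> {x \<in> carrier M. MG.hp a x \<in> ?L'}"
        using hp_smult[OF y yu(2), of a] RG.comp_carrier[OF y] yu by simp
    qed
    fix x assume x: "x \<in> mcomp M a"
    then have "x \<in> ?A" using MG.comp_carrier \<open>carrier M \<subseteq> ?A\<close> by blast
    then obtain w l where wl: "w \<in> ?W" "l \<in> ?L" "x = w \<oplus>\<^bsub>M\<^esub> l" unfolding add_sets_def by blast
    moreover have "w \<in> carrier M" "l \<in> carrier M" using wl 1 2 by auto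
    ultimately have "MG.hp a x = MG.hp a w \<oplus>\<^bsub>M\<^esub> MG.hp a l" by (simp add: MG.hpart_add)
    moreover have "MG.hp a w \<oplus>\<^bsub>M\<^esub> MG.hp a l \<in> add_sets M ?W' ?L'"
      using wl 1 2 by (intro add_setsI) auto
    ultimately show "x \<in> add_sets M ?W' ?L'" using MG.hpart_same[OF x] by simp
  qed
  then show ?thesis using that B by blast
qed

text \<open>Scalars have nonnegative degree and cannot lower degrees, so any lower bound for the
  degrees that occur in a finite generating set will do.\<close>

lemma components_bounded_below: "\<exists>a0. \<forall>a<a0. mcomp M a = {\<zero>\<^bsub>M\<^esub>}"
proof -
  obtain B where B: "finite B" "B \<subseteq> carrier M" "carrier M = set_smult M (carrier R) B"
    using component_generation by metis
  have "finite (\<Union>b \<in> B. {a. MG.hp a b \<noteq> \<zero>\<^bsub>M\<^esub>})" using B MG.hpart_expansion(2) by blast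
  then obtain a0 where a0: "\<And>a. a \<in> (\<Union>b \<in> B. {a. MG.hp a b \<noteq> \<zero>\<^bsub>M\<^esub>}) \<Longrightarrow> a0 \<le> a"
    by (metis Min_le)
  let ?A = "{x \<in> carrier M. \<forall>a<a0. MG.hp a x = \<zero>\<^bsub>M\<^esub>}"
  have A: "additive_subgroup ?A M"
    by (rule M.additive_subgroupI') (auto simp: MG.hpart_add MG.hpart_minus)
  have "carrier M \<subseteq> ?A"
  proof (rule generation_induct[OF A _ _ _ B(3)])
    show "r \<odot>\<^bsub>M\<^esub> x \<in> ?A" if "r \<in> rcomp R 0" "x \<in> ?A" for r x
      using that hp_smult[OF that(1)] RG.comp_carrier by auto
    show "r \<odot>\<^bsub>M\<^esub> x \<in> ?A" if "r \<in> set xs" "x \<in> ?A" for r x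
    proof -
      have r: "r \<in> rcomp R 1" using that degree_one_gens(1) by blast
      then show ?thesis using that hp_smult[OF r] RG.comp_carrier[OF r] by auto
    qed
    show "B \<subseteq> ?A" using a0 B(2) by fastforce
  qed
  then have "mcomp M a = {\<zero>\<^bsub>M\<^esub>}" if "a < a0" for a
    using that MG.hpart_same MG.comp_carrier MG.comp_zero by fastforce
  then show ?thesis by blast
qed

end

section \<open>A graded Hilbert basis theorem\<close>

text \<open>The class \<open>adm\<close> is a parameter because the chain condition is required for
  two kinds of subsets: \<open>base_sub\<close> inside a single component and
  \<open>graded_sub\<close> inside a whole module.\<close>

definition acc_on :: "('b set \<Rightarrow> bool) \<Rightarrow> 'b set \<Rightarrow> bool" where
  "acc_on adm E \<longleftrightarrow> (\<forall>W::nat \<Rightarrow> 'b set. (\<forall>k. adm (W k) \<and> W k \<subseteq> W (Suc k) \<and> W k \<subseteq> E) \<longrightarrow>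
     (\<exists>k. \<forall>l\<ge>k. W l = W k))"

lemma acc_onD:
  assumes "acc_on adm E" "\<And>k. adm (W k)" "\<And>k::nat. W k \<subseteq> W (Suc k)" "\<And>k. W k \<subseteq> E"
  shows "\<exists>k. \<forall>l\<ge>k. W l = W k"
  using assms unfolding acc_on_def by blast

lemma acc_on_mono: "acc_on adm E \<Longrightarrow> E' \<subseteq> E \<Longrightarrow> acc_on adm E'"
  unfolding acc_on_def by (meson order_trans)

text \<open>The family \<open>E n\<close> takes the place of the graded pieces of a module over a
  polynomial ring whose variables act as the elements of \<open>Y\<close>. All \<open>E n\<close>
  lie in the same module and may overlap, so degrees are carried by the index alone. The class
  \<open>adm\<close> collects the admissible submodules; the closure properties are those that the
  filtration argument consumes.\<close>

locale graded_operators = module R M for R (structure) and M :: "('a, 'b, 'd) module_scheme"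
  (structure) +
  fixes adm :: "'b set \<Rightarrow> bool" and Y :: "'a set" and E :: "nat \<Rightarrow> 'b set"
  assumes Y: "Y \<subseteq> carrier R"
    and adm_subgroup: "adm A \<Longrightarrow> additive_subgroup A M"
    and adm_zero: "adm {\<zero>\<^bsub>M\<^esub>}"
    and adm_Int: "adm A \<Longrightarrow> adm B \<Longrightarrow> adm (A \<inter> B)"
    and adm_add: "adm A \<Longrightarrow> adm B \<Longrightarrow> adm (add_sets M A B)"
    and adm_image: "y \<in> Y \<Longrightarrow> adm A \<Longrightarrow> adm ((\<lambda>x. y \<odot>\<^bsub>M\<^esub> x) ` A)"
    and adm_preimage: "y \<in> Y \<Longrightarrow> adm A \<Longrightarrow> adm {x \<in> carrier M. y \<odot>\<^bsub>M\<^esub> x \<in> A}"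
    and adm_Union: "(\<And>k. adm (W k)) \<Longrightarrow> (\<And>k::nat. W k \<subseteq> W (Suc k)) \<Longrightarrow> adm (\<Union>k. W k)"
    and E: "adm (E n)" "acc_on adm (E n)" "\<And>y x. y \<in> Y \<Longrightarrow> x \<in> E n \<Longrightarrow> y \<odot>\<^bsub>M\<^esub> x \<in> E (Suc n)"
begin

lemma E_carrier: "x \<in> E n \<Longrightarrow> x \<in> carrier M"
  using sub_carrier[OF adm_subgroup[OF E(1)]] .

lemma smult_pow:
  assumes "y \<in> carrier R" "x \<in> carrier M"
  shows "(y [^]\<^bsub>R\<^esub> (k + l)) \<odot>\<^bsub>M\<^esub> x = (y [^]\<^bsub>R\<^esub> k) \<odot>\<^bsub>M\<^esub> ((y [^]\<^bsub>R\<^esub> l) \<odot>\<^bsub>M\<^esub> x)"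
    "(y [^]\<^bsub>R\<^esub> Suc k) \<odot>\<^bsub>M\<^esub> x = y \<odot>\<^bsub>M\<^esub> ((y [^]\<^bsub>R\<^esub> k) \<odot>\<^bsub>M\<^esub> x)"
    "(y [^]\<^bsub>R\<^esub> Suc k) \<odot>\<^bsub>M\<^esub> x = (y [^]\<^bsub>R\<^esub> k) \<odot>\<^bsub>M\<^esub> (y \<odot>\<^bsub>M\<^esub> x)"
proof -
  show "(y [^]\<^bsub>R\<^esub> (k + l)) \<odot>\<^bsub>M\<^esub> x = (y [^]\<^bsub>R\<^esub> k) \<odot>\<^bsub>M\<^esub> ((y [^]\<^bsub>R\<^esub> l) \<odot>\<^bsub>M\<^esub> x)"
    using assms by (simp add: R.nat_pow_mult[symmetric] smult_assoc1)
  show 1: "(y [^]\<^bsub>R\<^esub> Suc k) \<odot>\<^bsub>M\<^esub> x = (y [^]\<^bsub>R\<^esub> k) \<odot>\<^bsub>M\<^esub> (y \<odot>\<^bsub>M\<^esub> x)"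
    using assms by (simp add: smult_assoc1)
  show "(y [^]\<^bsub>R\<^esub> Suc k) \<odot>\<^bsub>M\<^esub> x = y \<odot>\<^bsub>M\<^esub> ((y [^]\<^bsub>R\<^esub> k) \<odot>\<^bsub>M\<^esub> x)"
    using assms by (subst 1, intro smult_smult_comm) auto
qed

lemma adm_pow_image: "y \<in> Y \<Longrightarrow> adm A \<Longrightarrow> adm ((\<lambda>x. (y [^]\<^bsub>R\<^esub> (k::nat)) \<odot>\<^bsub>M\<^esub> x) ` A)"
proof (induction k)
  case 0
  have "(\<lambda>x. (y [^]\<^bsub>R\<^esub> (0::nat)) \<odot>\<^bsub>M\<^esub> x) ` A = A"
    using sub_carrier[OF adm_subgroup[OF 0(2)]] by force
  then show ?case using 0 by simp
next
  case (Suc k)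
  have "(\<lambda>x. (y [^]\<^bsub>R\<^esub> Suc k) \<odot>\<^bsub>M\<^esub> x) ` A = (\<lambda>x. y \<odot>\<^bsub>M\<^esub> x) ` ((\<lambda>x. (y [^]\<^bsub>R\<^esub> k) \<odot>\<^bsub>M\<^esub> x) ` A)"
    using sub_carrier[OF adm_subgroup[OF Suc(3)]] Suc(2) Y smult_pow(2)[of y]
    by (auto simp del: R.nat_pow_Suc simp: image_image intro!: image_cong)
  then show ?case using Suc adm_image by simp
qed

lemma adm_pow_preimage: "y \<in> Y \<Longrightarrow> adm A \<Longrightarrow> adm {x \<in> carrier M. (y [^]\<^bsub>R\<^esub> (k::nat)) \<odot>\<^bsub>M\<^esub> x \<in> A}"
proof (induction k)
  case 0
  have "{x \<in> carrier M. (y [^]\<^bsub>R\<^esub> (0::nat)) \<odot>\<^bsub>M\<^esub> x \<in> A} = A"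
    using sub_carrier[OF adm_subgroup[OF 0(2)]] by force
  then show ?case using 0 by simp
next
  case (Suc k)
  have "{x \<in> carrier M. (y [^]\<^bsub>R\<^esub> Suc k) \<odot>\<^bsub>M\<^esub> x \<in> A} =
      {x \<in> carrier M. y \<odot>\<^bsub>M\<^esub> x \<in> {x \<in> carrier M. (y [^]\<^bsub>R\<^esub> k) \<odot>\<^bsub>M\<^esub> x \<in> A}}"
    using Suc(2) Y smult_pow(3)[of y] by (auto simp del: R.nat_pow_Suc)
  then show ?case using adm_preimage[OF Suc(2) Suc.IH[OF Suc(2,3)]] by simp
qed

text \<open>
  Induction on the number of operators. For the step, \<open>U\<close> is filtered by the images of the powers
  of the first operator \<open>y\<close>; the \<open>k\<close>-th initial module \<open>W k\<close> lives in \<open>E / (N + y E)\<close>, where the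
  induction hypothesis applies, and the ascending sequence \<open>W\<close> is stationary.
\<close>

theorem eventually_generated:
  assumes "set ys \<subseteq> Y"
    and "\<And>n. adm (N n)" "\<And>n. adm (U n)" "\<And>n. N n \<subseteq> U n" "\<And>n. U n \<subseteq> E n"
    and "\<And>n y x. y \<in> set ys \<Longrightarrow> x \<in> N n \<Longrightarrow> y \<odot>\<^bsub>M\<^esub> x \<in> N (Suc n)"
    and "\<And>n y x. y \<in> set ys \<Longrightarrow> x \<in> U n \<Longrightarrow> y \<odot>\<^bsub>M\<^esub> x \<in> U (Suc n)"
    and "\<And>n. n \<ge> n0 \<Longrightarrow> E (Suc n) \<subseteq> add_sets M (N (Suc n)) (lsum M ys (E n))"
  shows "\<exists>n1. \<forall>n\<ge>n1. U (Suc n) \<subseteq> add_sets M (N (Suc n)) (lsum M ys (U n))"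
  using assms
proof (induction ys arbitrary: N U n0)
  case Nil
  then show ?case by (metis lsum.simps(1) order_trans)
next
  case (Cons y ys)
  note [simp del] = R.nat_pow_Suc lsum.simps
  have yY: "y \<in> Y" and ysY: "set ys \<subseteq> Y" using Cons.prems(1) by auto
  have y [simp]: "y \<in> carrier R" using yY Y by blast
  define p where "p k x = (y [^]\<^bsub>R\<^esub> (k::nat)) \<odot>\<^bsub>M\<^esub> x" for k x
  have p_closed [simp]: "p k x \<in> carrier M" if "x \<in> carrier M" for k x
    using that unfolding p_def by simp
  have p_add: "p k (a \<oplus>\<^bsub>M\<^esub> b) = p k a \<oplus>\<^bsub>M\<^esub> p k b" if "a \<in> carrier M" "b \<in> carrier M" for k a b
    using that unfolding p_def by (simp add: smult_r_distr)
  have p_comm: "p k (r \<odot>\<^bsub>M\<^esub> a) = r \<odot>\<^bsub>M\<^esub> p k a" if "r \<in> carrier R" "a \<in> carrier M" for k a r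
    using that unfolding p_def by (simp add: smult_smult_comm)
  have p_plus: "p (k + l) x = p k (p l x)" if "x \<in> carrier M" for k l x
    using smult_pow(1) that unfolding p_def by simp
  have p_Suc: "p (Suc k) x = y \<odot>\<^bsub>M\<^esub> p k x" if "x \<in> carrier M" for k x
    using smult_pow(2) that unfolding p_def by simp
  have p_zero [simp]: "p k \<zero>\<^bsub>M\<^esub> = \<zero>\<^bsub>M\<^esub>" for k unfolding p_def by simp
  have p_0: "p 0 x = x" if "x \<in> carrier M" for x unfolding p_def using that by simp
  \<comment> \<open>The \<open>y\<close>-adic filtration \<open>y^k E (n - k)\<close> of
    \<open>E n\<close>. The value \<open>{0}\<close> for \<open>k > n\<close> replaces what
    truncated subtraction would give and makes the filtration of each \<open>E n\<close>
    finite.\<close>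
  define F where "F k n = (if k \<le> n then p k ` E (n - k) else {\<zero>\<^bsub>M\<^esub>})" for k n
  have p_mem: "p k x \<in> V (n + k)" if "x \<in> V n" "\<And>n. V n \<subseteq> carrier M"
    "\<And>n x. x \<in> V n \<Longrightarrow> y \<odot>\<^bsub>M\<^esub> x \<in> V (Suc n)" for k x V n
  proof (induction k)
    case 0
    have "x \<in> carrier M" using that(1,2) by blast
    then show ?case using that(1) p_0 by simp
  next
    case (Suc k)
    then have "y \<odot>\<^bsub>M\<^esub> p k x \<in> V (Suc (n + k))" using that(3) by blast
    moreover have "x \<in> carrier M" using that(1,2) by blast
    ultimately show ?case using p_Suc[of x k] by simp
  qed
  have E_sub: "E n \<subseteq> carrier M" for n using E_carrier by blast
  have U_sub: "U n \<subseteq> carrier M" and N_sub: "N n \<subseteq> carrier M" for n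
    using Cons.prems(4,5) E_sub by blast+
  have adm_F: "adm (F k n)" for k n
    unfolding F_def p_def using adm_pow_image[OF yY E(1)] adm_zero by simp
  have F_carrier: "F k n \<subseteq> carrier M" for k n using adm_subgroup[OF adm_F] sub_subset by blast
  have F_E: "F k n \<subseteq> E n" for k n
  proof (cases "k \<le> n")
    case True
    then show ?thesis
      using p_mem[of _ E "n - k" k] E_sub E(3)[OF yY] unfolding F_def by auto
  next
    case False
    then show ?thesis using sub_zero[OF adm_subgroup[OF E(1)]] unfolding F_def by simp
  qed
  have F_smult: "r \<odot>\<^bsub>M\<^esub> x \<in> F k (Suc n)" if r: "r \<in> Y" and x: "x \<in> F k n" for r x k n
  proof (cases "k \<le> n")
    case True
    then obtain e where e: "e \<in> E (n - k)" "x = p k e" using x unfolding F_def by auto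
    then have "r \<odot>\<^bsub>M\<^esub> x = p k (r \<odot>\<^bsub>M\<^esub> e)" using p_comm r Y E_carrier by auto
    moreover have "r \<odot>\<^bsub>M\<^esub> e \<in> E (Suc n - k)" using E(3)[OF r e(1)] True by (simp add: Suc_diff_le)
    ultimately show ?thesis using True unfolding F_def by auto
  next
    case False
    then have "x = \<zero>\<^bsub>M\<^esub>" using x unfolding F_def by simp
    then show ?thesis using sub_zero[OF adm_subgroup[OF adm_F]] r Y by auto
  qed
  have F_p: "p j x \<in> F (k + j) (n + j)" if "x \<in> F k n" for x k n j
  proof (cases "k \<le> n")
    case True
    then obtain e where e: "e \<in> E (n - k)" "x = p k e" using \<open>x \<in> F k n\<close> unfolding F_def by auto
    then have "p j x = p (k + j) e" using p_plus E_carrier by (metis add.commute)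
    then show ?thesis using e True unfolding F_def by auto
  next
    case False
    then show ?thesis using that unfolding F_def by auto
  qed
  \<comment> \<open>\<open>x\<close> belongs to \<open>W k n\<close> if \<open>y^k x\<close> agrees
    with an element of \<open>U\<close> up to the next filtration step, that is, if \<open>x\<close>
    is a leading coefficient at step \<open>k\<close>. Enlarging \<open>N\<close> to
    \<open>N'\<close> absorbs the image of \<open>y\<close>, so that the remaining operators
    \<open>ys\<close> generate \<open>E\<close> modulo \<open>N'\<close>.\<close>
  define W where "W k n = E n \<inter> {x \<in> carrier M. p k x \<in> add_sets M (U (n + k)) (F (Suc k) (n + k))}"
    for k n
  define N' where "N' n = add_sets M (N n) (F 1 n)" for n
  have adm_W: "adm (W k n)" for k n
    unfolding W_def p_def using adm_pow_preimage[OF yY adm_add[OF Cons.prems(3) adm_F]] E(1) adm_Int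
    by blast
  have adm_N': "adm (N' n)" for n unfolding N'_def using adm_add Cons.prems(2) adm_F by blast
  have W_E: "W k n \<subseteq> E n" for k n unfolding W_def by blast
  have W_I: "x \<in> W k n" if "x \<in> E n" "u \<in> U (n + k)" "z \<in> F (Suc k) (n + k)" "p k x =
    u \<oplus>\<^bsub>M\<^esub> z" for x k n u z
    using that E_carrier unfolding W_def by (auto intro: add_setsI)
  have W_D: "\<exists>u z. u \<in> U (n + k) \<and> z \<in> F (Suc k) (n + k) \<and> p k x = u \<oplus>\<^bsub>M\<^esub> z" if "x \<in> W k n" for x k n
    using that unfolding W_def add_sets_def by blast
  have N_E: "N n \<subseteq> E n" for n using Cons.prems(4,5) by blast
  have N'_W: "N' n \<subseteq> W k n" for k n
  proof
    fix x assume "x \<in> N' n"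
    then obtain v z where *: "v \<in> N n" "z \<in> F 1 n" "x = v \<oplus>\<^bsub>M\<^esub> z" unfolding N'_def add_sets_def by blast
    have "p k v \<in> N (n + k)" using p_mem[of v N n k] * N_sub Cons.prems(6) by simp
    moreover have "p k z \<in> F (Suc k) (n + k)" using F_p[OF *(2), of k] by simp
    moreover have "v \<in> carrier M" "z \<in> carrier M" using * N_sub F_carrier by blast+
    moreover have "x \<in> E n"
      using * N_E F_E sub_add[OF adm_subgroup[OF E(1)]] by blast
    ultimately show "x \<in> W k n"
      using W_I[of x n "p k v" k "p k z"] * p_add Cons.prems(4) by blast
  qed
  have W_chain: "W k n \<subseteq> W (Suc k) n" for k n
  proof
    fix x assume x: "x \<in> W k n"
    then obtain u z where *: "u \<in> U (n + k)" "z \<in> F (Suc k) (n + k)" "p k x = u \<oplus>\<^bsub>M\<^esub> z"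
      using W_D by blast
    have c: "x \<in> carrier M" "u \<in> carrier M" "z \<in> carrier M"
      using x * W_E E_carrier U_sub F_carrier by blast+
    have "p (Suc k) x = y \<odot>\<^bsub>M\<^esub> u \<oplus>\<^bsub>M\<^esub> y \<odot>\<^bsub>M\<^esub> z"
      using p_Suc *(3) c by (simp add: smult_r_distr)
    moreover have "y \<odot>\<^bsub>M\<^esub> u \<in> U (n + Suc k)" using Cons.prems(7) *(1) by simp
    moreover have "y \<odot>\<^bsub>M\<^esub> z \<in> F (Suc (Suc k)) (n + Suc k)"
      using F_p[OF *(2), of 1] p_Suc[of z 0] p_0 c by simp
    ultimately show "x \<in> W (Suc k) n" using x W_E W_I by blast
  qed
  have W_smult: "r \<odot>\<^bsub>M\<^esub> x \<in> W k (Suc n)" if r: "r \<in> set ys" and x: "x \<in> W k n" for r x k n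
  proof -
    obtain u z where *: "u \<in> U (n + k)" "z \<in> F (Suc k) (n + k)" "p k x = u \<oplus>\<^bsub>M\<^esub> z"
      using W_D x by blast
    have c: "x \<in> carrier M" "u \<in> carrier M" "z \<in> carrier M" "r \<in> carrier R"
      using x r ysY Y * W_E E_carrier U_sub F_carrier by blast+
    have "p k (r \<odot>\<^bsub>M\<^esub> x) = r \<odot>\<^bsub>M\<^esub> u \<oplus>\<^bsub>M\<^esub> r \<odot>\<^bsub>M\<^esub> z"
      using p_comm *(3) c by (simp add: smult_r_distr)
    moreover have "r \<odot>\<^bsub>M\<^esub> u \<in> U (Suc n + k)" using Cons.prems(7)[of r u] *(1) r by simp
    moreover have "r \<odot>\<^bsub>M\<^esub> z \<in> F (Suc k) (Suc n + k)" using F_smult[OF _ *(2)] r ysY by auto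
    moreover have "r \<odot>\<^bsub>M\<^esub> x \<in> E (Suc n)" using E(3) r ysY x W_E by blast
    ultimately show ?thesis using W_I by blast
  qed
  have N'_smult: "r \<odot>\<^bsub>M\<^esub> x \<in> N' (Suc n)" if r: "r \<in> set ys" and x: "x \<in> N' n" for r x n
  proof -
    obtain v z where *: "v \<in> N n" "z \<in> F 1 n" "x = v \<oplus>\<^bsub>M\<^esub> z"
      using x unfolding N'_def add_sets_def by blast
    have "v \<in> carrier M" "z \<in> carrier M" "r \<in> carrier R" using * N_sub F_carrier r ysY Y by blast+
    then have "r \<odot>\<^bsub>M\<^esub> x = r \<odot>\<^bsub>M\<^esub> v \<oplus>\<^bsub>M\<^esub> r \<odot>\<^bsub>M\<^esub> z" using * smult_r_distr by simp
    then show ?thesis unfolding N'_def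
      using * r ysY Cons.prems(6)[of r v n] F_smult[of r z 1 n] by (auto intro: add_setsI)
  qed
  have E_gen: "E (Suc n) \<subseteq> add_sets M (N' (Suc n)) (lsum M ys (E n))" if "n \<ge> n0" for n
  proof
    have L: "additive_subgroup (lsum M ys (E n)) M"
      using lsum_subgroup adm_subgroup[OF E(1)] ysY Y by blast
    fix x assume "x \<in> E (Suc n)"
    then have "x \<in> add_sets M (N (Suc n)) (lsum M (y # ys) (E n))"
      using Cons.prems(8)[OF that] by blast
    then obtain v e l where *: "v \<in> N (Suc n)" "e \<in> E n" "l \<in> lsum M ys (E n)"
      "x = v \<oplus>\<^bsub>M\<^esub> (y \<odot>\<^bsub>M\<^esub> e \<oplus>\<^bsub>M\<^esub> l)" unfolding add_sets_def lsum.simps by blast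
    have "v \<in> carrier M" "e \<in> carrier M" "l \<in> carrier M"
      using * N_sub E_sub sub_carrier[OF L] by blast+
    then have x: "x = (v \<oplus>\<^bsub>M\<^esub> p 1 e) \<oplus>\<^bsub>M\<^esub> l" using *(4) p_Suc[of e 0] p_0 by (simp add: M.a_assoc)
    have "p 1 e \<in> F 1 (Suc n)" using * unfolding F_def by auto
    then show "x \<in> add_sets M (N' (Suc n)) (lsum M ys (E n))"
      unfolding x N'_def using * by (intro add_setsI) auto
  qed
  have "\<exists>m. \<forall>n\<ge>m. W k (Suc n) \<subseteq> add_sets M (N' (Suc n)) (lsum M ys (W k n))" for k
    by (rule Cons.IH[of N' "W k" n0]) (use ysY adm_N' adm_W N'_W W_E N'_smult W_smult E_gen in auto)
  then obtain m where m: "\<And>k n. n \<ge> m k \<Longrightarrow> W k (Suc n) \<subseteq> add_sets M (N' (Suc n)) (lsum M ys (W k n))"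
    by metis
  have W_mono: "W k n \<subseteq> W l n" if "k \<le> l" for k l n
    using lift_Suc_mono_le[of "\<lambda>k. W k n" k l] W_chain that by blast
  \<comment> \<open>The chain condition gives, for each \<open>n\<close> separately, an index from
    which \<open>W k n\<close> is constant in \<open>k\<close>. Applying the induction hypothesis to
    the union over \<open>k\<close> as well makes this index uniform: beyond \<open>mi\<close> the
    union at \<open>Suc n\<close> is generated from the union at \<open>n\<close>, and only the
    finitely many \<open>n\<close> up to \<open>mi\<close> use the chain condition. This yields
    \<open>k1\<close>.\<close>
  have "\<exists>m. \<forall>n\<ge>m. (\<Union>k. W k (Suc n)) \<subseteq> add_sets M (N' (Suc n)) (lsum M ys (\<Union>k. W k n))"
  proof (rule Cons.IH[of N' "\<lambda>n. \<Union>k. W k n" n0])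
    show "adm (\<Union>k. W k n)" for n by (rule adm_Union) (use adm_W W_chain in auto)
    show "N' n \<subseteq> (\<Union>k. W k n)" "(\<Union>k. W k n) \<subseteq> E n" for n using N'_W W_E by blast+
    show "r \<odot>\<^bsub>M\<^esub> x \<in> (\<Union>k. W k (Suc n))" if "r \<in> set ys" "x \<in> (\<Union>k. W k n)" for r x n
      using that W_smult by blast
  qed (use ysY adm_N' N'_W W_E N'_smult W_smult E_gen in auto)
  then obtain mi where mi: "\<And>n. n \<ge> mi \<Longrightarrow>
      (\<Union>k. W k (Suc n)) \<subseteq> add_sets M (N' (Suc n)) (lsum M ys (\<Union>k. W k n))" by blast
  have "\<exists>k. \<forall>l\<ge>k. W l n = W k n" for n
    by (rule acc_onD[OF E(2)[of n]]) (intro adm_W W_chain W_E)+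
  then obtain g where g: "\<And>n l. l \<ge> g n \<Longrightarrow> W l n = W (g n) n" by metis
  define k1 where "k1 = Max (g ` {..mi})"
  have k1: "(\<Union>k. W k n) = W k1 n" for n
  proof (induction n)
    case 0
    have "g 0 \<le> k1" unfolding k1_def by (intro Max_ge) auto
    then have "W k 0 \<subseteq> W k1 0" for k
      using g[of 0 k] g[of 0 k1] W_mono[of k "max k k1" 0] g[of 0 "max k k1"] by fastforce
    then show ?case by blast
  next
    case (Suc n)
    show ?case
    proof (cases "Suc n \<le> mi")
      case True
      then have "g (Suc n) \<le> k1" unfolding k1_def by (intro Max_ge) auto
      then have "W k (Suc n) \<subseteq> W k1 (Suc n)" for k
        using g[of "Suc n" k1] W_mono[of k "max k k1" "Suc n"] g[of "Suc n" "max k k1"] by fastforce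
      then show ?thesis by blast
    next
      case False
      then have "(\<Union>k. W k (Suc n)) \<subseteq> add_sets M (N' (Suc n)) (lsum M ys (W k1 n))"
        using mi[of n] Suc by simp
      also have "\<dots> \<subseteq> W k1 (Suc n)"
        by (intro add_sets_least lsum_least adm_subgroup adm_W N'_W W_smult)
      finally show ?thesis by blast
    qed
  qed
  \<comment> \<open>A leading coefficient of step \<open>k\<close> of an element of index
    \<open>Suc n\<close> has index \<open>Suc n - k\<close>. The bound ensures
    \<open>n - k \<ge> m k\<close> for all \<open>k \<le> k1\<close>.\<close>
  define n1 where "n1 = k1 + Max (m ` {..k1})"
  have n1: "m k + k \<le> n1" if "k \<le> k1" for k
  proof -
    have "m k \<le> Max (m ` {..k1})" using that by (intro Max_ge) auto
    then show ?thesis using that unfolding n1_def by linarith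
  qed
  show ?case
  proof (intro exI[of _ n1] allI impI)
    fix n assume n: "n1 \<le> n"
    let ?T = "add_sets M (N (Suc n)) (lsum M (y # ys) (U n))"
    have yU: "set (y # ys) \<subseteq> carrier R" using Cons.prems(1) Y by blast
    have Us: "additive_subgroup (U n) M" for n using adm_subgroup Cons.prems(3) by blast
    have L: "additive_subgroup (lsum M (y # ys) (U n)) M" using lsum_subgroup[OF yU Us] .
    have Ns: "additive_subgroup (N (Suc n)) M" using adm_subgroup Cons.prems(2) by blast
    have T: "additive_subgroup ?T M" using M.add_sets_subgroup[OF Ns L] .
    note subT = M.subset_add_sets[OF Ns L]
    have TU: "?T \<subseteq> U (Suc n)"
      by (intro add_sets_least lsum_least Us Cons.prems(4,7))
    have T_smult: "r \<odot>\<^bsub>M\<^esub> u \<in> ?T" if "r \<in> set (y # ys)" "u \<in> U n" for r u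
      using lsumI[OF yU Us that] subT(2) by blast
    \<comment> \<open>Descending induction on the filtration step, from \<open>Suc (Suc n)\<close>,
      where \<open>F\<close> vanishes, down to 0, where \<open>F\<close> is all of
      \<open>E (Suc n)\<close>.\<close>
    have "U (Suc n) \<inter> F k (Suc n) \<subseteq> ?T" if "k \<le> Suc (Suc n)" for k
      using that
    proof (induction rule: inc_induct)
      case base
      have "F (Suc (Suc n)) (Suc n) = {\<zero>\<^bsub>M\<^esub>}" unfolding F_def by simp
      then show ?case using sub_zero[OF T] by auto
    next
      case (step k)
      let ?D = "add_sets M ?T (F (Suc k) (Suc n))"
      have Fs: "additive_subgroup (F (Suc k) (Suc n)) M" using adm_subgroup adm_F by blast
      have D: "additive_subgroup ?D M" using M.add_sets_subgroup[OF T Fs] .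
      note subD = M.subset_add_sets[OF T Fs]
      have kn: "k \<le> Suc n" using step by simp
      show ?case
      proof
        fix u assume u: "u \<in> U (Suc n) \<inter> F k (Suc n)"
        then obtain x where x: "x \<in> E (Suc n - k)" "u = p k x" using kn unfolding F_def by auto
        have "u \<oplus>\<^bsub>M\<^esub> \<zero>\<^bsub>M\<^esub> = u" using u U_sub by (intro M.r_zero) auto
        moreover have "\<zero>\<^bsub>M\<^esub> \<in> F (Suc k) (Suc n - k + k)" "u \<in> U (Suc n - k + k)"
          using kn sub_zero[OF Fs] u by auto
        ultimately have xW: "x \<in> W k (Suc n - k)"
          using W_I[OF x(1)] x(2) by metis
        have "u \<in> ?D"
        proof (cases "k \<le> k1")
          case True
          have "m k \<le> n - k" using n1[OF True] n by simp
          moreover have kn': "k \<le> n" "Suc n - k = Suc (n - k)" using n1[OF True] n by auto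
          ultimately have "x \<in> add_sets M (N' (Suc (n - k))) (lsum M ys (W k (n - k)))"
            using m[of k "n - k"] xW by auto
          moreover have pre: "additive_subgroup {x \<in> carrier M. p k x \<in> ?D} M"
            unfolding p_def by (intro smult_preimage_subgroup D) simp
          have "add_sets M (N' (Suc (n - k))) (lsum M ys (W k (n - k))) \<subseteq> {x \<in> carrier M. p k x \<in> ?D}"
          proof (intro add_sets_least lsum_least pre)
            show "N' (Suc (n - k)) \<subseteq> {x \<in> carrier M. p k x \<in> ?D}"
              unfolding N'_def
            proof (intro add_sets_least pre)
              show "N (Suc (n - k)) \<subseteq> {x \<in> carrier M. p k x \<in> ?D}"
              proof
                fix v assume v: "v \<in> N (Suc (n - k))"
                have "p k v \<in> N (Suc (n - k) + k)"
                  by (rule p_mem[of v N]) (use v N_sub Cons.prems(6) in auto)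
                then show "v \<in> {x \<in> carrier M. p k x \<in> ?D}" using v N_sub subT subD kn' by auto
              qed
              show "F 1 (Suc (n - k)) \<subseteq> {x \<in> carrier M. p k x \<in> ?D}"
                using F_p[of _ 1 "Suc (n - k)" k] F_carrier subD(2) kn' by auto
            qed
            show "r \<odot>\<^bsub>M\<^esub> w \<in> {x \<in> carrier M. p k x \<in> ?D}"
              if r: "r \<in> set ys" and w: "w \<in> W k (n - k)" for r w
            proof -
              obtain u' z where *: "u' \<in> U n" "z \<in> F (Suc k) n" "p k w = u' \<oplus>\<^bsub>M\<^esub> z"
                using W_D[OF w] kn' by auto
              have c: "w \<in> carrier M" "r \<in> carrier R" "u' \<in> carrier M" "z \<in> carrier M"
                using w W_E E_sub r ysY Y * U_sub F_carrier by blast+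
              have "p k (r \<odot>\<^bsub>M\<^esub> w) = r \<odot>\<^bsub>M\<^esub> u' \<oplus>\<^bsub>M\<^esub> r \<odot>\<^bsub>M\<^esub> z"
                using c * p_comm by (simp add: smult_r_distr)
              moreover have "r \<odot>\<^bsub>M\<^esub> u' \<oplus>\<^bsub>M\<^esub> r \<odot>\<^bsub>M\<^esub> z \<in> ?D"
                by (intro add_setsI[of _ ?T] T_smult F_smult *) (use r ysY in auto)
              ultimately show ?thesis using c by simp
            qed
          qed
          ultimately show ?thesis using x by auto
        next
          case False
          \<comment> \<open>Beyond step \<open>k1\<close> no new leading coefficient appears:
            \<open>x\<close> already comes from some \<open>u'\<close> at step \<open>k1\<close>,
            and \<open>y^(k - k1) u'\<close> has the same leading term as \<open>u\<close>. Since
            \<open>k > k1\<close>, one factor \<open>y\<close> can be split off, and what remains of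
            the product lies in \<open>U n\<close>.\<close>
          have "x \<in> W k1 (Suc n - k)" using xW k1 by blast
          then obtain u' z where *: "u' \<in> U (Suc n - k + k1)" "z \<in> F (Suc k1) (Suc n - k + k1)"
            "p k1 x = u' \<oplus>\<^bsub>M\<^esub> z" using W_D by blast
          have c: "x \<in> carrier M" "u' \<in> carrier M" "z \<in> carrier M"
            using * U_sub F_carrier x E_sub by blast+
          have "u = p (k - k1) (p k1 x)" using x c p_plus[of x "k - k1" k1] False by simp
          then have u1: "u = p (k - k1) u' \<oplus>\<^bsub>M\<^esub> p (k - k1) z" using * c p_add by simp
          have "p (k - k1 - 1) u' \<in> U (Suc n - k + k1 + (k - k1 - 1))"
            by (rule p_mem[of u' U]) (use * U_sub Cons.prems(7) in auto)
          then have "p (k - k1 - 1) u' \<in> U n" using False kn by simp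
          then have "y \<odot>\<^bsub>M\<^esub> p (k - k1 - 1) u' \<in> ?T" by (intro T_smult) auto
          moreover have "y \<odot>\<^bsub>M\<^esub> p (k - k1 - 1) u' = p (k - k1) u'"
            using p_Suc[of u' "k - k1 - 1"] c False by (simp add: Suc_diff_Suc)
          moreover have "p (k - k1) z \<in> F (Suc k) (Suc n)"
            using F_p[OF *(2), of "k - k1"] False kn by simp
          ultimately show ?thesis unfolding u1 by (metis add_setsI)
        qed
        \<comment> \<open>Subtracting \<open>t\<close> from \<open>u\<close> leaves
          \<open>v\<close>, an element of \<open>U (Suc n)\<close> one filtration step deeper, to
          which the induction hypothesis applies.\<close>
        then obtain t v where tv: "t \<in> ?T" "v \<in> F (Suc k) (Suc n)" "u = t \<oplus>\<^bsub>M\<^esub> v"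
          unfolding add_sets_def[of _ ?T] by blast
        have c: "t \<in> carrier M" "v \<in> carrier M"
          using tv F_carrier sub_carrier[OF T] by blast+
        have "\<ominus>\<^bsub>M\<^esub> t \<oplus>\<^bsub>M\<^esub> u \<in> U (Suc n)"
          using tv(1) TU u Us[of "Suc n"]
          by (intro sub_add sub_neg) auto
        moreover have "\<ominus>\<^bsub>M\<^esub> t \<oplus>\<^bsub>M\<^esub> u = v" using tv(3) c by (simp add: M.r_neg1)
        ultimately have "v \<in> ?T" using step.IH tv(2) by blast
        then show "u \<in> ?T" using tv sub_add[OF T] by blast
      qed
    qed
    from this[of 0] have "U (Suc n) \<inter> F 0 (Suc n) \<subseteq> ?T" by simp
    moreover have "U (Suc n) \<subseteq> F 0 (Suc n)"
    proof
      fix u assume "u \<in> U (Suc n)"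
      then have uE: "u \<in> E (Suc n)" using Cons.prems(5) by blast
      then have "u = p 0 u" using p_0 E_carrier by metis
      with uE show "u \<in> F 0 (Suc n)" unfolding F_def by auto
    qed
    ultimately show "U (Suc n) \<subseteq> ?T" by blast
  qed
qed

end

section \<open>Graded submodules of finitely generated graded modules are finitely generated\<close>

context graded_mod begin

definition base_sub :: "'b set \<Rightarrow> bool" where
  "base_sub A \<longleftrightarrow> additive_subgroup A M \<and> (\<forall>r \<in> rcomp R 0. \<forall>x \<in> A. r \<odot>\<^bsub>M\<^esub> x \<in> A)"

lemma base_carrier: "r \<in> rcomp R 0 \<Longrightarrow> r \<in> carrier R"
  using RG.comp_carrier .

lemma base_sub_zero: "base_sub {\<zero>\<^bsub>M\<^esub>}"
  unfolding base_sub_def using base_carrier by (auto intro: M.additive_subgroupI')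

lemma base_sub_Int:
  assumes "base_sub A" "base_sub B"
  shows "base_sub (A \<inter> B)"
proof -
  note A = assms[unfolded base_sub_def, THEN conjunct1]
  note [simp] = A[THEN sub_add] A[THEN sub_zero]
    A[THEN sub_neg] A[THEN sub_carrier]
  have "additive_subgroup (A \<inter> B) M" by (rule M.additive_subgroupI') auto
  then show ?thesis using assms unfolding base_sub_def by auto
qed

lemma base_sub_add:
  assumes "base_sub A" "base_sub B"
  shows "base_sub (add_sets M A B)"
proof -
  note A = assms[unfolded base_sub_def, THEN conjunct1]
  note c = A[THEN sub_carrier]
  have "r \<odot>\<^bsub>M\<^esub> x \<in> add_sets M A B" if r: "r \<in> rcomp R 0" and x: "x \<in> add_sets M A B" for r x
  proof -
    obtain a b where *: "a \<in> A" "b \<in> B" "x = a \<oplus>\<^bsub>M\<^esub> b" using x unfolding add_sets_def by blast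
    then have "r \<odot>\<^bsub>M\<^esub> x = r \<odot>\<^bsub>M\<^esub> a \<oplus>\<^bsub>M\<^esub> r \<odot>\<^bsub>M\<^esub> b"
      using c base_carrier[OF r] by (simp add: smult_r_distr)
    then show ?thesis using * assms r unfolding base_sub_def by (auto intro: add_setsI)
  qed
  then show ?thesis unfolding base_sub_def using M.add_sets_subgroup[OF A] by blast
qed

lemma base_sub_image:
  assumes "y \<in> carrier R" "base_sub A"
  shows "base_sub ((\<lambda>x. y \<odot>\<^bsub>M\<^esub> x) ` A)"
proof -
  note A = assms(2)[unfolded base_sub_def, THEN conjunct1]
  have "r \<odot>\<^bsub>M\<^esub> (y \<odot>\<^bsub>M\<^esub> a) \<in> (\<lambda>x. y \<odot>\<^bsub>M\<^esub> x) ` A" if "r \<in> rcomp R 0" "a \<in> A" for r a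
  proof -
    have "r \<odot>\<^bsub>M\<^esub> (y \<odot>\<^bsub>M\<^esub> a) = y \<odot>\<^bsub>M\<^esub> (r \<odot>\<^bsub>M\<^esub> a)"
      using that base_carrier assms(1) sub_carrier[OF A] smult_smult_comm by blast
    then show ?thesis using that assms(2) unfolding base_sub_def by auto
  qed
  then show ?thesis unfolding base_sub_def using smult_image_subgroup[OF A assms(1)] by auto
qed

lemma base_sub_preimage:
  assumes "y \<in> carrier R" "base_sub A"
  shows "base_sub {x \<in> carrier M. y \<odot>\<^bsub>M\<^esub> x \<in> A}"
proof -
  note A = assms(2)[unfolded base_sub_def, THEN conjunct1]
  have "y \<odot>\<^bsub>M\<^esub> (r \<odot>\<^bsub>M\<^esub> a) \<in> A" if "r \<in> rcomp R 0" "a \<in> carrier M" "y \<odot>\<^bsub>M\<^esub> a \<in> A" for r a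
    using that assms smult_smult_comm[of y r a] base_carrier unfolding base_sub_def by auto
  then show ?thesis unfolding base_sub_def
    using smult_preimage_subgroup[OF A assms(1)] base_carrier by auto
qed

lemma base_sub_Union:
  assumes "\<And>k::nat. base_sub (W k)" "\<And>k. W k \<subseteq> W (Suc k)"
  shows "base_sub (\<Union>k. W k)"
  using chain_Union_subgroup[of W] assms unfolding base_sub_def by blast

lemma base_sub_comp: "base_sub (mcomp M a)"
  unfolding base_sub_def using MG.comp_subgroup mdeg[of _ 0] by auto

lemma acc_zero: "acc_on base_sub {\<zero>\<^bsub>M\<^esub>}"
proof (unfold acc_on_def, intro allI impI)
  fix W :: "nat \<Rightarrow> _" assume W: "\<forall>k. base_sub (W k) \<and> W k \<subseteq> W (Suc k) \<and> W k \<subseteq> {\<zero>\<^bsub>M\<^esub>}"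
  have "\<zero>\<^bsub>M\<^esub> \<in> W k" for k
    using W sub_zero unfolding base_sub_def by blast
  then have "W k = {\<zero>\<^bsub>M\<^esub>}" for k using W by blast
  then show "\<exists>k. \<forall>l\<ge>k. W l = W k" by simp
qed

text \<open>Among nested submodules of \<open>A + B\<close>, the intersections
  \<open>W \<inter> A\<close> and \<open>(W + A) \<inter> B\<close> determine \<open>W\<close>: for
  \<open>x = a + b\<close> in the larger one, the second equality provides \<open>w\<close> in the
  smaller one with \<open>b - w\<close> in \<open>A\<close>, and then \<open>x - w\<close> lies in
  the larger one and in \<open>A\<close>.\<close>

lemma acc_add:
  assumes "base_sub A" "base_sub B" "acc_on base_sub A" "acc_on base_sub B"
  shows "acc_on base_sub (add_sets M A B)"
proof (unfold acc_on_def, intro allI impI)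
  fix W :: "nat \<Rightarrow> _"
  assume "\<forall>k. base_sub (W k) \<and> W k \<subseteq> W (Suc k) \<and> W k \<subseteq> add_sets M A B"
  then have W: "base_sub (W k)" "W k \<subseteq> W (Suc k)" "W k \<subseteq> add_sets M A B" for k by blast+
  have mono: "W k \<subseteq> W l" if "k \<le> l" for k l using lift_Suc_mono_le[of W] W(2) that by blast
  have sub: "add_sets M (W k) A \<subseteq> add_sets M (W (Suc k)) A" for k
    using W(2) unfolding add_sets_def by blast
  obtain k1 where k1: "\<And>l. l \<ge> k1 \<Longrightarrow> W l \<inter> A = W k1 \<inter> A"
    using acc_onD[OF assms(3), of "\<lambda>k. W k \<inter> A"] W base_sub_Int assms(1) by blast
  have "\<exists>k. \<forall>l\<ge>k. add_sets M (W l) A \<inter> B = add_sets M (W k) A \<inter> B"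
    by (rule acc_onD[OF assms(4)]) (use sub W assms base_sub_Int base_sub_add in auto)
  then obtain k2 where k2: "\<And>l. l \<ge> k2 \<Longrightarrow> add_sets M (W l) A \<inter> B = add_sets M (W k2) A \<inter> B"
    by blast
  have "W l \<subseteq> W (max k1 k2)" (is "_ \<subseteq> W ?k") if l: "l \<ge> max k1 k2" for l
  proof
    fix x assume x: "x \<in> W l"
    note sg = W(1)[unfolded base_sub_def, THEN conjunct1]
    have sA: "additive_subgroup A M" and sB: "additive_subgroup B M"
      using assms unfolding base_sub_def by auto
    obtain a b where ab: "a \<in> A" "b \<in> B" "x = a \<oplus>\<^bsub>M\<^esub> b"
      using x W(3) unfolding add_sets_def by blast
    have c: "x \<in> carrier M" "a \<in> carrier M" "b \<in> carrier M"
      using sub_carrier[OF sg x] sub_carrier[OF sA ab(1)]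
        sub_carrier[OF sB ab(2)] by auto
    have "x \<oplus>\<^bsub>M\<^esub> \<ominus>\<^bsub>M\<^esub> a = \<ominus>\<^bsub>M\<^esub> a \<oplus>\<^bsub>M\<^esub> x" using c by (intro M.a_comm) auto
    also have "\<dots> = b" unfolding ab(3) using c by (intro M.r_neg1)
    finally have "b = x \<oplus>\<^bsub>M\<^esub> \<ominus>\<^bsub>M\<^esub> a" by (rule sym)
    moreover have "\<ominus>\<^bsub>M\<^esub> a \<in> A" by (rule sub_neg[OF sA ab(1)])
    ultimately have "b \<in> add_sets M (W l) A" using x by (auto intro: add_setsI)
    then have "b \<in> add_sets M (W ?k) A" using k2[of l] k2[of ?k] l ab(2) by auto
    then obtain w a' where w: "w \<in> W ?k" "a' \<in> A" "b = w \<oplus>\<^bsub>M\<^esub> a'" unfolding add_sets_def by blast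
    have c': "w \<in> carrier M" "a' \<in> carrier M"
      using sub_carrier[OF sg w(1)] sub_carrier[OF sA w(2)] by auto
    have "x = w \<oplus>\<^bsub>M\<^esub> (a \<oplus>\<^bsub>M\<^esub> a')" using ab w c c' by (simp add: M.a_ac)
    moreover have "a \<oplus>\<^bsub>M\<^esub> a' = \<ominus>\<^bsub>M\<^esub> w \<oplus>\<^bsub>M\<^esub> x"
      using c c' \<open>x = w \<oplus>\<^bsub>M\<^esub> (a \<oplus>\<^bsub>M\<^esub> a')\<close> by (simp add: M.r_neg1)
    moreover have "w \<in> W l" using w(1) mono[OF l] by blast
    ultimately have "a \<oplus>\<^bsub>M\<^esub> a' \<in> W l"
      using sub_add[OF sg sub_neg[OF sg] x, of w] by simp
    moreover have "a \<oplus>\<^bsub>M\<^esub> a' \<in> A" using sub_add[OF sA ab(1) w(2)] .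
    ultimately have "a \<oplus>\<^bsub>M\<^esub> a' \<in> W ?k" using k1[of l] k1[of ?k] l by auto
    then show "x \<in> W ?k"
      using sub_add[OF sg w(1), of "a \<oplus>\<^bsub>M\<^esub> a'"] \<open>x = w \<oplus>\<^bsub>M\<^esub> (a \<oplus>\<^bsub>M\<^esub> a')\<close>
      by simp
  qed
  then show "\<exists>k. \<forall>l\<ge>k. W l = W k" using mono by blast
qed

lemma acc_image:
  assumes "y \<in> carrier R" "base_sub A" "acc_on base_sub A"
  shows "acc_on base_sub ((\<lambda>x. y \<odot>\<^bsub>M\<^esub> x) ` A)"
proof (unfold acc_on_def, intro allI impI)
  fix W :: "nat \<Rightarrow> _"
  assume W: "\<forall>k. base_sub (W k) \<and> W k \<subseteq> W (Suc k) \<and> W k \<subseteq> (\<lambda>x. y \<odot>\<^bsub>M\<^esub> x) ` A"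
  let ?V = "\<lambda>k. A \<inter> {x \<in> carrier M. y \<odot>\<^bsub>M\<^esub> x \<in> W k}"
  have "\<exists>k. \<forall>l\<ge>k. ?V l = ?V k"
    by (rule acc_onD[OF assms(3)]) (use W assms base_sub_Int base_sub_preimage in auto)
  then obtain k where k: "\<And>l. l \<ge> k \<Longrightarrow> ?V l = ?V k" by blast
  have Ac: "A \<subseteq> carrier M" using assms(2) sub_subset unfolding base_sub_def by blast
  have WV: "W l = (\<lambda>x. y \<odot>\<^bsub>M\<^esub> x) ` ?V l" for l
  proof
    show "W l \<subseteq> (\<lambda>x. y \<odot>\<^bsub>M\<^esub> x) ` ?V l" using W Ac by blast
  qed blast
  have "W l = W k" if "l \<ge> k" for l using WV[of l] WV[of k] k[OF that] by simp
  then show "\<exists>k. \<forall>l\<ge>k. W l = W k" by blast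
qed

lemma base_ideal:
  assumes "base_sub W" "b \<in> carrier M"
  shows "ideal {r \<in> rcomp R 0. r \<odot>\<^bsub>M\<^esub> b \<in> W} (base_ring R)" (is "ideal ?I _")
proof -
  have "ring (base_ring R)" using noeth noetherian_ring.axioms(1) by blast
  have sW: "additive_subgroup W M" using assms unfolding base_sub_def by auto
  have s0: "additive_subgroup (rcomp R 0) R" using RG.comp_subgroup .
  note [simp] = sub_add[OF sW] sub_zero[OF sW]
    sub_neg[OF sW] sub_add[OF s0]
    sub_zero[OF s0] sub_neg[OF s0] base_carrier
  have sI: "subgroup ?I (add_monoid R)"
    by (intro additive_subgroup.a_subgroup R.additive_subgroupI')
      (use assms(2) in \<open>auto simp: smult_l_distr smult_l_minus\<close>)
  have "subgroup (rcomp R 0) (add_monoid R)" using additive_subgroup.a_subgroup[OF s0] .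
  then have "subgroup ?I ((add_monoid R)\<lparr>carrier := rcomp R 0\<rparr>)"
    using sI R.add.subgroup_incl by blast
  then have sub: "subgroup ?I (add_monoid (base_ring R))" unfolding base_ring_def by simp
  show ?thesis
  proof (rule idealI[OF \<open>ring (base_ring R)\<close> sub])
    fix a x assume a: "a \<in> ?I" and x: "x \<in> carrier (base_ring R)"
    then have x0: "x \<in> rcomp R 0" and a0: "a \<in> rcomp R 0" unfolding base_ring_def by auto
    have "x \<otimes>\<^bsub>R\<^esub> a \<in> rcomp R 0" using rcomp_mult[OF x0 a0] by simp
    moreover have "(x \<otimes>\<^bsub>R\<^esub> a) \<odot>\<^bsub>M\<^esub> b \<in> W"
      using a x0 a0 assms unfolding base_sub_def by (auto simp: smult_assoc1)
    ultimately have "x \<otimes>\<^bsub>R\<^esub> a \<in> ?I" by blast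
    then show "x \<otimes>\<^bsub>base_ring R\<^esub> a \<in> ?I" "a \<otimes>\<^bsub>base_ring R\<^esub> x \<in> ?I"
      using x0 a0 R.m_comm[of a x] unfolding base_ring_def by auto
  qed
qed

text \<open>This is where the chain condition of the base ring enters. A submodule of the cyclic
  module generated by \<open>b\<close> is recovered from the ideal of those \<open>r\<close> with
  \<open>r b\<close> in it, and an ascending chain of these ideals contains its union.\<close>

lemma acc_cyclic:
  assumes "b \<in> carrier M"
  shows "acc_on base_sub ((\<lambda>r. r \<odot>\<^bsub>M\<^esub> b) ` rcomp R 0)"
proof (unfold acc_on_def, intro allI impI)
  fix W :: "nat \<Rightarrow> _"
  assume W: "\<forall>k. base_sub (W k) \<and> W k \<subseteq> W (Suc k) \<and> W k \<subseteq> (\<lambda>r. r \<odot>\<^bsub>M\<^esub> b) ` rcomp R 0"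
  let ?I = "\<lambda>k. {r \<in> rcomp R 0. r \<odot>\<^bsub>M\<^esub> b \<in> W k}"
  have Imono: "?I k \<subseteq> ?I l" if "k \<le> l" for k l
    using lift_Suc_mono_le[of ?I k l] W that by blast
  have "subset.chain {I. ideal I (base_ring R)} (range ?I)"
  proof (rule subset.chainI)
    show "range ?I \<subseteq> {I. ideal I (base_ring R)}" using W base_ideal assms by auto
    show "\<And>X Y. X \<in> range ?I \<Longrightarrow> Y \<in> range ?I \<Longrightarrow> (\<subset>)\<^sup>=\<^sup>= X Y \<or> (\<subset>)\<^sup>=\<^sup>= Y X"
      using Imono by (smt (verit) image_iff nle_le psubsetI sup2I1 sup2I2)
  qed
  then have "\<Union>(range ?I) \<in> range ?I"
    using noetherian_ring.ideal_chain_is_trivial[OF noeth] by blast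
  then obtain k where k: "\<Union>(range ?I) = ?I k" by blast
  then have I: "?I l = ?I k" if "l \<ge> k" for l using Imono[OF that] by blast
  have WI: "W l = (\<lambda>r. r \<odot>\<^bsub>M\<^esub> b) ` ?I l" for l using W by blast
  have "W l = W k" if "l \<ge> k" for l using WI[of l] WI[of k] I[OF that] by simp
  then show "\<exists>k. \<forall>l\<ge>k. W l = W k" by blast
qed

lemma base_sub_span:
  assumes "B \<subseteq> carrier M"
  shows "base_sub (set_smult M (rcomp R 0) B)" (is "base_sub ?V")
proof -
  have V: "additive_subgroup ?V M" using assms base_carrier by (intro set_smult_subgroup) auto
  moreover have "r \<odot>\<^bsub>M\<^esub> x \<in> ?V" if r: "r \<in> rcomp R 0" and x: "x \<in> ?V" for r x
  proof -
    have "?V \<subseteq> {x \<in> carrier M. r \<odot>\<^bsub>M\<^esub> x \<in> ?V}"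
    proof (intro set_smult_least smult_preimage_subgroup V base_carrier r)
      fix s b assume sb: "s \<in> rcomp R 0" "b \<in> B"
      have "r \<otimes>\<^bsub>R\<^esub> s \<in> rcomp R 0" using rcomp_mult[OF r sb(1)] by simp
      then have "(r \<otimes>\<^bsub>R\<^esub> s) \<odot>\<^bsub>M\<^esub> b \<in> ?V" using sb(2) by (rule set_smultI)
      then show "s \<odot>\<^bsub>M\<^esub> b \<in> {x \<in> carrier M. r \<odot>\<^bsub>M\<^esub> x \<in> ?V}"
        using sb r base_carrier assms by (auto simp: smult_assoc1)
    qed
    then show ?thesis using x by blast
  qed
  ultimately show ?thesis unfolding base_sub_def by blast
qed

lemma acc_span:
  assumes "finite B" "B \<subseteq> carrier M"
  shows "acc_on base_sub (set_smult M (rcomp R 0) B)"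
  using assms
proof (induction B)
  case empty
  have "set_smult M (rcomp R 0) {} \<subseteq> {\<zero>\<^bsub>M\<^esub>}"
    by (rule set_smult_least) (use base_sub_zero in \<open>auto simp: base_sub_def\<close>)
  then show ?case using acc_zero acc_on_mono by blast
next
  case (insert b B)
  have b: "base_sub ((\<lambda>r. r \<odot>\<^bsub>M\<^esub> b) ` rcomp R 0)" (is "base_sub ?C")
  proof -
    have "base_sub (set_smult M (rcomp R 0) {b})" using base_sub_span insert by simp
    moreover have "set_smult M (rcomp R 0) {b} = ?C"
    proof
      have s0: "additive_subgroup (rcomp R 0) R" using RG.comp_subgroup .
      have bc: "b \<in> carrier M" using insert by simp
      have "additive_subgroup ?C M"
      proof (rule M.additive_subgroupI')
        show "\<zero>\<^bsub>M\<^esub> \<in> ?C"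
          using sub_zero[OF s0] bc by (intro image_eqI[of _ _ "\<zero>\<^bsub>R\<^esub>"]) auto
        show "x \<oplus>\<^bsub>M\<^esub> y \<in> ?C" if "x \<in> ?C" "y \<in> ?C" for x y
          using that sub_add[OF s0] bc base_carrier
          by (auto simp: smult_l_distr[symmetric])
        show "\<ominus>\<^bsub>M\<^esub> x \<in> ?C" if "x \<in> ?C" for x
          using that sub_neg[OF s0] bc base_carrier
          by (auto simp: smult_l_minus[symmetric])
      qed (use bc base_carrier in auto)
      then show "set_smult M (rcomp R 0) {b} \<subseteq> ?C" by (rule set_smult_least) auto
      show "?C \<subseteq> set_smult M (rcomp R 0) {b}" using set_smultI by blast
    qed
    ultimately show ?thesis by simp
  qed
  have B: "base_sub (set_smult M (rcomp R 0) B)" using base_sub_span insert by simp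
  have "set_smult M (rcomp R 0) (insert b B) \<subseteq> add_sets M ?C (set_smult M (rcomp R 0) B)" (is "_ \<subseteq>
    ?D")
  proof (rule set_smult_least)
    show "additive_subgroup ?D M" using base_sub_add[OF b B] unfolding base_sub_def by blast
    have "?C \<subseteq> ?D" "set_smult M (rcomp R 0) B \<subseteq> ?D"
      using M.subset_add_sets b B unfolding base_sub_def by blast+
    then show "r \<odot>\<^bsub>M\<^esub> x \<in> ?D" if "r \<in> rcomp R 0" "x \<in> insert b B" for r x
      using that set_smultI[of r "rcomp R 0" x B] by blast
  qed
  moreover have "acc_on base_sub ?D"
    using acc_add[OF b B acc_cyclic] insert by simp
  ultimately show ?case using acc_on_mono by blast
qed

lemma base_sub_lsum: "set ys \<subseteq> carrier R \<Longrightarrow> base_sub U \<Longrightarrow> base_sub (lsum M ys U)"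
  by (induction ys) (auto simp: base_sub_zero lsum_Cons_add_sets simp del: lsum.simps(2)
      intro: base_sub_add base_sub_image)

lemma acc_lsum: "set ys \<subseteq> carrier R \<Longrightarrow> base_sub U \<Longrightarrow> acc_on base_sub U \<Longrightarrow> acc_on base_sub (lsum M ys U)"
  by (induction ys) (auto simp: acc_zero lsum_Cons_add_sets simp del: lsum.simps(2)
      intro!: acc_add acc_image base_sub_lsum base_sub_image)

end

section \<open>The ascending chain condition for graded submodules\<close>

context fg_graded_mod begin

text \<open>Induction on the degree, from below \<open>a0\<close> where components vanish: by
  \<open>component_generation\<close> each component lies in a finite span over the base ring plus
  finitely many images of the preceding component.\<close>

lemma acc_component: "acc_on base_sub (mcomp M a)"
proof -
  obtain a0 where a0: "\<And>a. a < a0 \<Longrightarrow> mcomp M a = {\<zero>\<^bsub>M\<^esub>}" using components_bounded_below by blast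
  obtain B where B: "finite B" "B \<subseteq> carrier M"
    "\<And>a. mcomp M a \<subseteq> add_sets M (set_smult M (rcomp R 0) (MG.hp a ` B)) (lsum M xs (mcomp M (a - 1)))"
    using component_generation by metis
  have "acc_on base_sub (mcomp M (a0 - 1 + int n))" for n
  proof (induction n)
    case 0
    then show ?case using a0[of "a0 - 1"] acc_zero by simp
  next
    case (Suc n)
    have hB: "MG.hp c ` B \<subseteq> carrier M" for c using B(2) by auto
    have "mcomp M (a0 - 1 + int (Suc n)) \<subseteq> add_sets M (set_smult M (rcomp R 0) (MG.hp (a0 - 1 + int
      (Suc n)) ` B))
       (lsum M xs (mcomp M (a0 - 1 + int n)))"
         using B(3)[of "a0 - 1 + int (Suc n)"] by (simp add: algebra_simps)
    moreover have "acc_on base_sub \<dots>"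
      by (intro acc_add base_sub_span base_sub_lsum acc_span acc_lsum xs_carrier base_sub_comp hB Suc)
        (use B(1) in auto)
    ultimately show ?case using acc_on_mono by blast
  qed
  from this[of "nat (a - a0 + 1)"] show ?thesis using a0[of a] acc_zero by (cases "a < a0") auto
qed

lemma gsub_eqI:
  assumes "graded_sub R M U" "additive_subgroup V M" "\<And>a. U \<inter> mcomp M a \<subseteq> V"
  shows "U \<subseteq> V"
proof
  fix x assume x: "x \<in> U"
  then have "MG.hp a x \<in> V" for a
    using assms(3)[of a] gsub_hp[OF assms(1) x, of a] MG.hpart_expansion(1)[OF gsub_carrier[OF
      assms(1) x]]
    by blast
  then show "x \<in> V" using MG.mem_of_hpart[OF assms(2) gsub_carrier[OF assms(1) x]] by blast
qed

text \<open>First use of \<open>eventually_generated\<close>: the index is the degree, the operators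
  are the elements \<open>xs\<close> of degree one, admissible sets are submodules over the base
  ring, and \<open>N = 0\<close>. Above the degrees that occur in a generating set of
  \<open>M\<close>, the components of \<open>M\<close> arise from the preceding ones by
  \<open>xs\<close> alone, as the theorem requires.\<close>

lemma gsub_eventually_generated:
  assumes U: "graded_sub R M U"
  shows "\<exists>a1. \<forall>a\<ge>a1. U \<inter> mcomp M (a + 1) \<subseteq> lsum M xs (U \<inter> mcomp M a)"
proof -
  obtain a0 where a0: "\<And>a. a < a0 \<Longrightarrow> mcomp M a = {\<zero>\<^bsub>M\<^esub>}" using components_bounded_below by blast
  obtain B where B: "finite B" "B \<subseteq> carrier M"
    "\<And>a. mcomp M a \<subseteq> add_sets M (set_smult M (rcomp R 0) (MG.hp a ` B)) (lsum M xs (mcomp M (a - 1)))"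
    using component_generation by metis
  interpret graded_operators R M base_sub "set xs" "\<lambda>n. mcomp M (a0 + int n)"
  proof (intro graded_operators.intro graded_operators_axioms.intro)
    show "module R M" by unfold_locales
    show "additive_subgroup A M" if "base_sub A" for A using that by (simp add: base_sub_def)
    show "set xs \<subseteq> carrier R" using xs_carrier .
    show "y \<odot>\<^bsub>M\<^esub> x \<in> mcomp M (a0 + int (Suc n))" if "y \<in> set xs" "x \<in> mcomp M (a0 + int n)" for y x n
      using mdeg[of y 1 x "a0 + int n"] that degree_one_gens(1) by (auto simp: algebra_simps)
  qed (use xs_carrier in \<open>auto intro: base_sub_zero base_sub_Int base_sub_add base_sub_image
      base_sub_preimage base_sub_Union base_sub_comp acc_component\<close>)
  let ?U = "\<lambda>n. U \<inter> mcomp M (a0 + int n)"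
  have bU: "base_sub U" using U gsub_subgroup gsub_smult base_carrier unfolding base_sub_def by blast
  have "finite (\<Union>b \<in> B. {a. MG.hp a b \<noteq> \<zero>\<^bsub>M\<^esub>})" using B MG.hpart_expansion(2) by blast
  then obtain c where c: "\<And>a. a \<in> (\<Union>b \<in> B. {a. MG.hp a b \<noteq> \<zero>\<^bsub>M\<^esub>}) \<Longrightarrow> a \<le> c"
    by (metis Max_ge)
  have Egen: "mcomp M (a0 + int (Suc n)) \<subseteq> add_sets M {\<zero>\<^bsub>M\<^esub>} (lsum M xs (mcomp M (a0 + int n)))"
    if n: "n \<ge> nat (c - a0)" for n
  proof -
    let ?a = "a0 + int (Suc n)"
    have "\<not> ?a \<le> c" using n by linarith
    then have "MG.hp ?a ` B \<subseteq> {\<zero>\<^bsub>M\<^esub>}" using c[of ?a] by blast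
    then have "set_smult M (rcomp R 0) (MG.hp ?a ` B) \<subseteq> {\<zero>\<^bsub>M\<^esub>}"
      using base_carrier base_sub_zero by (intro set_smult_least) (auto simp: base_sub_def)
    then have "add_sets M (set_smult M (rcomp R 0) (MG.hp ?a ` B)) X \<subseteq> add_sets M {\<zero>\<^bsub>M\<^esub>} X" for X
      unfolding add_sets_def by blast
    then show ?thesis using B(3)[of ?a] by fastforce
  qed
  have "\<exists>n1. \<forall>n\<ge>n1. ?U (Suc n) \<subseteq> add_sets M {\<zero>\<^bsub>M\<^esub>} (lsum M xs (?U n))"
  proof (rule eventually_generated[where N = "\<lambda>_. {\<zero>\<^bsub>M\<^esub>}" and U = ?U and ys =
    xs, OF _ _ _ _ _ _ _ Egen])
    show "base_sub (?U n)" for n using bU base_sub_comp base_sub_Int by blast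
    show "{\<zero>\<^bsub>M\<^esub>} \<subseteq> ?U n" for n
      using sub_zero bU base_sub_comp unfolding base_sub_def by blast
    show "y \<odot>\<^bsub>M\<^esub> x \<in> ?U (Suc n)" if "y \<in> set xs" "x \<in> ?U n" for y x n
      using that gsub_smult[OF U, of x y] xs_carrier E(3) by auto
  qed (use base_sub_zero xs_carrier in auto)
  then obtain n1 where n1: "\<And>n. n \<ge> n1 \<Longrightarrow> ?U (Suc n) \<subseteq> add_sets M {\<zero>\<^bsub>M\<^esub>} (lsum M xs (?U n))" by blast
  have "U \<inter> mcomp M (a + 1) \<subseteq> lsum M xs (U \<inter> mcomp M a)" if a: "a \<ge> a0 + int n1" for a
  proof -
    define n where "n = nat (a - a0)"
    have n: "n \<ge> n1" "a = a0 + int n" "a + 1 = a0 + int (Suc n)" using a unfolding n_def by auto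
    have "base_sub (lsum M xs (?U n))"
      using base_sub_lsum[OF xs_carrier base_sub_Int[OF bU base_sub_comp]] .
    then have "additive_subgroup (lsum M xs (?U n)) M" unfolding base_sub_def by blast
    then have "add_sets M {\<zero>\<^bsub>M\<^esub>} (lsum M xs (?U n)) \<subseteq> lsum M xs (?U n)"
      by (intro add_sets_least) (auto simp: sub_zero)
    then have "U \<inter> mcomp M (a0 + int (Suc n)) \<subseteq> lsum M xs (?U n)" using n1[OF n(1)] by blast
    then show ?thesis unfolding n(3) unfolding n(2) .
  qed
  then show ?thesis by blast
qed

text \<open>The union of the chain is a graded submodule, hence generated by \<open>xs\<close> from
  some degree \<open>a1\<close> on. It remains to make the chain stationary in the finitely many
  degrees from \<open>a0\<close> to \<open>a1\<close>, one component at a time.\<close>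

theorem gsub_acc: "acc_on (graded_sub R M) (carrier M)"
proof (unfold acc_on_def, intro allI impI)
  fix W :: "nat \<Rightarrow> _"
  assume "\<forall>k. graded_sub R M (W k) \<and> W k \<subseteq> W (Suc k) \<and> W k \<subseteq> carrier M"
  then have W: "graded_sub R M (W k)" "W k \<subseteq> W (Suc k)" for k by blast+
  have mono: "W k \<subseteq> W l" if "k \<le> l" for k l using lift_Suc_mono_le[of W] W(2) that by blast
  let ?U = "\<Union>k. W k"
  have U: "graded_sub R M ?U" using gsub_chain_Union[of W] W by blast
  obtain a1 where a1: "\<And>a. a \<ge> a1 \<Longrightarrow> ?U \<inter> mcomp M (a + 1) \<subseteq> lsum M xs (?U \<inter> mcomp M a)"
    using gsub_eventually_generated[OF U] by blast
  obtain a0 where a0: "\<And>a. a < a0 \<Longrightarrow> mcomp M a = {\<zero>\<^bsub>M\<^esub>}" using components_bounded_below by blast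
  have bW: "base_sub (W k)" for k
    using gsub_subgroup[OF W(1)] gsub_smult[OF W(1)] base_carrier unfolding base_sub_def by blast
  have "\<exists>k. \<forall>l\<ge>k. W l \<inter> mcomp M a = W k \<inter> mcomp M a" for a
    by (rule acc_onD[OF acc_component[of a]]) (use W(2) bW base_sub_Int base_sub_comp in auto)
  then obtain g where g: "\<And>a l. l \<ge> g a \<Longrightarrow> W l \<inter> mcomp M a = W (g a) \<inter> mcomp M a" by metis
  \<comment> \<open>The inserted 0 keeps the maximum meaningful when \<open>a1 < a0\<close> and no
    degree is left over.\<close>
  define k where "k = Max (insert 0 (g ` {a0..a1}))"
  have gk: "g a \<le> k" if "a0 \<le> a" "a \<le> a1" for a unfolding k_def using that by (intro Max_ge) auto
  have low: "?U \<inter> mcomp M a \<subseteq> W k" if "a \<le> a1" for a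
  proof (cases "a < a0")
    case True
    then show ?thesis using a0 sub_zero[OF gsub_subgroup[OF W(1)]] by auto
  next
    case False
    have "W l \<inter> mcomp M a \<subseteq> W k" for l
      using g[of a k] g[of a "max l k"] gk[of a] that False mono[of l "max l k"] by fastforce
    then show ?thesis by blast
  qed
  have "?U \<inter> mcomp M a \<subseteq> W k" for a
  proof (cases "a \<le> a1")
    case False
    then have "a1 \<le> a" by simp
    then show ?thesis
    proof (induction a rule: int_ge_induct)
      case base
      then show ?case using low by blast
    next
      case (step a)
      have "?U \<inter> mcomp M (a + 1) \<subseteq> lsum M xs (?U \<inter> mcomp M a)" using a1 step by blast
      also have "\<dots> \<subseteq> W k"
        using step.IH xs_carrier gsub_smult[OF W(1)]
          by (intro lsum_least gsub_subgroup[OF W(1)]) blast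
      finally show ?case .
    qed
  qed (use low in blast)
  then have "?U \<subseteq> W k" using gsub_eqI[OF U gsub_subgroup[OF W(1)]] by blast
  then show "\<exists>k. \<forall>l\<ge>k. W l = W k" using mono by blast
qed

text \<open>Otherwise every finite subset can be enlarged by an element outside its span, and
  iterating the choice \<open>h\<close> gives a strictly ascending chain. That \<open>X0\<close>
  stays inside \<open>X\<close> matters for \<open>generated_by_degrees\<close>, where
  \<open>X\<close> consists of elements of bounded degree.\<close>

lemma finite_generating_subset:
  assumes X: "\<And>x. x \<in> X \<Longrightarrow> \<exists>n. x \<in> mcomp M n"
  shows "\<exists>X0. finite X0 \<and> X0 \<subseteq> X \<and> set_smult M (carrier R) X0 = set_smult M (carrier R) X"
proof (rule ccontr)
  assume neg: "\<not> ?thesis"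
  let ?S = "\<lambda>X. set_smult M (carrier R) X"
  have S: "graded_sub R M (?S Y)" "Y \<subseteq> ?S Y" if "Y \<subseteq> X" for Y
    using gsub_span[of Y] X that by blast+
  have "\<exists>x \<in> X. x \<notin> ?S X0" if X0: "finite X0" "X0 \<subseteq> X" for X0
  proof (rule ccontr)
    assume "\<not> (\<exists>x \<in> X. x \<notin> ?S X0)"
    then have "X \<subseteq> ?S X0" by blast
    then have "?S X \<subseteq> ?S X0"
      using gsub_smult[OF S(1)[OF X0(2)]]
        by (intro set_smult_least gsub_subgroup[OF S(1)[OF X0(2)]]) blast
    then have "?S X0 = ?S X" using set_smult_mono[of "carrier R" "carrier R" X0 X] X0(2) by blast
    then show False using neg X0 by blast
  qed
  then obtain h where h: "\<And>X0. finite X0 \<Longrightarrow> X0 \<subseteq> X \<Longrightarrow> h X0 \<in> X \<and> h X0 \<notin> ?S X0" by metis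
  define Y where "Y k = ((\<lambda>Z. insert (h Z) Z) ^^ k) {}" for k :: nat
  have Y: "finite (Y k) \<and> Y k \<subseteq> X" for k
    unfolding Y_def by (induction k) (use h in auto)
  have Y_Suc: "Y (Suc k) = insert (h (Y k)) (Y k)" for k unfolding Y_def by simp
  have "\<exists>k. \<forall>l\<ge>k. ?S (Y l) = ?S (Y k)"
  proof (rule acc_onD[OF gsub_acc])
    show "graded_sub R M (?S (Y k))" "?S (Y k) \<subseteq> carrier M" for k
      using S(1)[of "Y k"] gsub_carrier Y by blast+
    show "?S (Y k) \<subseteq> ?S (Y (Suc k))" for k by (rule set_smult_mono) (auto simp: Y_Suc)
  qed
  then obtain k where k: "\<And>l. l \<ge> k \<Longrightarrow> ?S (Y l) = ?S (Y k)" by blast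
  have "h (Y k) \<in> ?S (Y (Suc k))" using S(2)[of "Y (Suc k)"] Y Y_Suc by blast
  then show False using k[of "Suc k"] h Y by auto
qed

theorem gsub_finitely_generated:
  assumes U: "graded_sub R M U"
  shows "\<exists>B \<subseteq> U. finite B \<and> U = set_smult M (carrier R) B"
proof -
  let ?X = "\<Union>a. U \<inter> mcomp M a"
  have X: "\<exists>n. x \<in> mcomp M n" if "x \<in> ?X" for x using that by blast
  obtain B where B: "finite B" "B \<subseteq> ?X" "set_smult M (carrier R) B = set_smult M (carrier R) ?X"
    using finite_generating_subset[OF X] by blast
  have "U \<subseteq> set_smult M (carrier R) ?X"
    using gsub_span[OF X] by (intro gsub_eqI[OF U] gsub_subgroup) blast+
  moreover have "set_smult M (carrier R) ?X \<subseteq> U"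
    using gsub_smult[OF U] by (intro set_smult_least gsub_subgroup[OF U]) auto
  ultimately show ?thesis using B by blast
qed

end

section \<open>Graded submodules, generating degrees and reductions\<close>

text \<open>The order on \<open>int\<close> is not well-founded; \<open>Dmax\<close>,
  \<open>dmin\<close> and \<open>rho\<close> have their intended meaning only with a bound, from
  which the search is moved to \<open>nat\<close>.\<close>

lemma int_least_ex:
  fixes P :: "int \<Rightarrow> bool"
  assumes "P n" "\<And>n. P n \<Longrightarrow> c \<le> n"
  shows "\<exists>m. P m \<and> (\<forall>n. P n \<longrightarrow> m \<le> n)"
proof -
  define k where "k = (LEAST k. P (c + int k))"
  have "P (c + int (nat (n - c)))" using assms by simp
  then have "P (c + int k)" unfolding k_def by (rule LeastI)
  moreover have "c + int k \<le> m" if "P m" for m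
  proof -
    have "P (c + int (nat (m - c)))" using that assms(2) by simp
    then have "k \<le> nat (m - c)" unfolding k_def by (rule Least_le)
    then show ?thesis using assms(2)[OF that] by linarith
  qed
  ultimately show ?thesis by blast
qed

lemma int_Least:
  fixes P :: "int \<Rightarrow> bool"
  assumes "P n" "\<And>n. P n \<Longrightarrow> c \<le> n"
  shows "P (Least P)" "P m \<Longrightarrow> Least P \<le> m"
  using int_least_ex[of P n c, OF assms] Least_equality[of P] by auto

lemma int_Greatest:
  fixes P :: "int \<Rightarrow> bool"
  assumes "P n" "\<And>n. P n \<Longrightarrow> n \<le> c"
  shows "P (Greatest P)" "P m \<Longrightarrow> m \<le> Greatest P"
proof -
  obtain k where k: "P (- k)" "\<And>n. P (- n) \<Longrightarrow> k \<le> n"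
    using int_least_ex[of "\<lambda>k. P (- k)" "- n" "- c"] assms by fastforce
  have "Greatest P = - k"
    by (rule Greatest_equality) (use k(1) k(2)[of "- y" for y] in fastforce)+
  then show "P (Greatest P)" "P m \<Longrightarrow> m \<le> Greatest P"
    using k(1) k(2)[of "- m"] by auto
qed

text \<open>\<open>N\<close> is only required to share operations with \<open>G\<close> and may be a
  different kind of record, so that one lemma covers \<open>graded_submodule\<close>,
  \<open>shift\<close>, \<open>ideal_module\<close> and plain updates of the carrier.\<close>

lemma (in abelian_group) abelian_group_sub:
  fixes N :: "('a, 'e) ring_scheme"
  assumes J: "additive_subgroup J G" and N: "carrier N = J" "add N = add G" "zero N = zero G"
  shows "abelian_group N"
    and "x \<in> J \<Longrightarrow> \<ominus>\<^bsub>N\<^esub> x = \<ominus> x"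
    and "additive_subgroup A N \<longleftrightarrow> additive_subgroup A G \<and> A \<subseteq> J"
proof -
  have Jc: "J \<subseteq> carrier G" using sub_subset[OF J] .
  show ag: "abelian_group N"
  proof (rule abelian_groupI; simp add: N)
    show "\<And>x y z. x \<in> J \<Longrightarrow> y \<in> J \<Longrightarrow> z \<in> J \<Longrightarrow> x \<oplus> y \<oplus> z = x \<oplus> (y \<oplus> z)"
      "\<And>x y. x \<in> J \<Longrightarrow> y \<in> J \<Longrightarrow> x \<oplus> y = y \<oplus> x"
      "\<And>x. x \<in> J \<Longrightarrow> \<zero> \<oplus> x = x"
      using Jc by (auto intro!: a_assoc a_comm)
    show "\<exists>y \<in> J. y \<oplus> x = \<zero>" if "x \<in> J" for x
      using that Jc l_neg sub_neg[OF J] by blast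
  qed (use sub_add[OF J] sub_zero[OF J] in auto)
  have inv: "\<ominus>\<^bsub>N\<^esub> x = \<ominus> x" if "x \<in> J" for x
    using that Jc sub_neg[OF J that] abelian_group.minus_equality[OF ag, of "\<ominus> x" x]
    by (auto simp: l_neg N)
  then show "x \<in> J \<Longrightarrow> \<ominus>\<^bsub>N\<^esub> x = \<ominus> x" .
  show "additive_subgroup A N \<longleftrightarrow> additive_subgroup A G \<and> A \<subseteq> J"
  proof
    assume A: "additive_subgroup A N"
    then have AJ: "A \<subseteq> J" using sub_subset N by blast
    moreover have "additive_subgroup A G"
    proof (rule additive_subgroupI')
      show "A \<subseteq> carrier G" using AJ Jc by blast
      show "\<zero> \<in> A" using sub_zero[OF A] N by simp
      show "x \<oplus> y \<in> A" if "x \<in> A" "y \<in> A" for x y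
        using sub_add[OF A that] N by simp
      show "\<ominus> x \<in> A" if "x \<in> A" for x
        using sub_neg[OF A that] inv[of x] that AJ by auto
    qed
    ultimately show "additive_subgroup A G \<and> A \<subseteq> J" by blast
  next
    assume A: "additive_subgroup A G \<and> A \<subseteq> J"
    then have A': "additive_subgroup A G" by blast
    show "additive_subgroup A N"
      using A sub_zero[OF A'] sub_add[OF A']
        sub_neg[OF A']
      by (intro abelian_group.additive_subgroupI'[OF ag]) (auto simp: N inv subset_iff)
  qed
qed

lemma (in graded_group) sub_decomposition:
  fixes N :: "('b, 'e) ring_scheme"
  assumes J: "additive_subgroup J G" and hpJ: "\<And>x i. x \<in> J \<Longrightarrow> hp i x \<in> J"
    and N: "carrier N = J" "add N = add G" "zero N = zero G"
  shows "direct_decomposition N (\<lambda>i. J \<inter> C i)"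
    and "x \<in> J \<Longrightarrow> hpart N (\<lambda>i. J \<inter> C i) i x = hp i x"
proof -
  note sub = abelian_group_sub[OF J N]
  interpret N: abelian_group N by (rule sub(1))
  have Jc: "J \<subseteq> carrier G" using sub_subset[OF J] .
  have C: "additive_subgroup (J \<inter> C i) N" for i
    using sub_add[OF comp_subgroup] sub_add[OF J]
      sub_zero[OF comp_subgroup] sub_zero[OF J]
      sub_neg[OF comp_subgroup] sub_neg[OF J]
    by (intro N.additive_subgroupI') (auto simp: sub(2) N)
  show dd: "direct_decomposition N (\<lambda>i. J \<inter> C i)"
  proof (rule N.direct_decompositionI[where p = hp, OF C]; simp add: N)
    show "hp i x \<in> J \<and> hp i x \<in> C i" if "x \<in> J" for i x
      using that hpJ hpart_expansion(1) Jc by blast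
    show "x = \<zero>" if "x \<in> J" "\<And>i. hp i x = \<zero>" for x
      using hpart_eq_zero that Jc by blast
    show "finite {i. hp i x \<noteq> \<zero>}" if "x \<in> J" for x
      using hpart_expansion(2) Jc that by blast
    show "\<And>i x y. x \<in> J \<Longrightarrow> y \<in> J \<Longrightarrow> hp i (x \<oplus> y) = hp i x \<oplus> hp i y"
      using hpart_add Jc by blast
  qed (auto simp: hpart_same hpart_other)
  interpret NG: graded_group N "\<lambda>i. J \<inter> C i" using dd by unfold_locales
  show "NG.hp i x = hp i x" if "x \<in> J"
  proof (rule NG.hpart_eqI)
    show "\<And>i x y. x \<in> carrier N \<Longrightarrow> y \<in> carrier N \<Longrightarrow> hp i (x \<oplus>\<^bsub>N\<^esub> y) = hp i x \<oplus>\<^bsub>N\<^esub> hp i y"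
      using hpart_add Jc by (auto simp: N)
  qed (use that in \<open>auto simp: hpart_same hpart_other N\<close>)
qed

context graded_mod begin

lemma hp_sub:
  assumes U: "graded_sub R M U"
  shows "graded_mod R (graded_submodule M U)"
    "x \<in> U \<Longrightarrow> hpart (graded_submodule M U) (mcomp (graded_submodule M U)) n x = MG.hp n x"
proof -
  let ?N = "graded_submodule M U"
  note sU = gsub_subgroup[OF U]
  have Uc: "U \<subseteq> carrier M" using sub_subset[OF sU] .
  have N: "carrier ?N = U" "add ?N = add M" "zero ?N = zero M" "smult ?N = smult M"
    "mcomp ?N = (\<lambda>n. U \<inter> mcomp M n)"
    unfolding graded_submodule_def by simp_all
  note sub = MG.sub_decomposition[OF sU gsub_hp[OF U] N(1-3)]
  have dd: "direct_decomposition ?N (mcomp ?N)" unfolding N using sub(1) .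
  have mod: "module R ?N"
    by (rule moduleI)
      (use Uc gsub_smult[OF U] M.abelian_group_sub(1)[OF sU N(1-3)] in
        \<open>auto simp: N smult_l_distr smult_r_distr smult_assoc1 subset_iff R.is_cring\<close>)
  show "graded_mod R ?N"
    by (intro graded_mod.intro graded_mod_axioms.intro mod dd R.std_graded_axioms)
      (use mdeg gsub_smult[OF U] RG.comp_carrier in \<open>auto simp: N\<close>)
  show "x \<in> U \<Longrightarrow> hpart ?N (mcomp ?N) n x = MG.hp n x" unfolding N by (rule sub(2))
qed

lemma set_smult_sub:
  assumes U: "graded_sub R M U" and "S \<subseteq> carrier R" "B \<subseteq> U"
  shows "set_smult (graded_submodule M U) S B = set_smult M S B"
proof -
  have "add_monoid (graded_submodule M U) = (add_monoid M)\<lparr>carrier := U\<rparr>"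
    unfolding graded_submodule_def by simp
  moreover have "{a \<odot>\<^bsub>M\<^esub> x | a x. a \<in> S \<and> x \<in> B} \<subseteq> U" using assms gsub_smult[OF U] by blast
  moreover have "smult (graded_submodule M U) = smult M" unfolding graded_submodule_def by simp
  ultimately show ?thesis unfolding set_smult_def
    using M.add.generate_consistent additive_subgroup.a_subgroup[OF gsub_subgroup[OF U]] by simp
qed

lemma subgroup_sub_iff:
  assumes U: "graded_sub R M U"
  shows "additive_subgroup V (graded_submodule M U) \<longleftrightarrow> additive_subgroup V M \<and> V \<subseteq> U"
  using M.abelian_group_sub(3)[OF gsub_subgroup[OF U], of "graded_submodule M U"]
  unfolding graded_submodule_def by simp

lemma gsub_sub_iff:
  assumes U: "graded_sub R M U"
  shows "graded_sub R (graded_submodule M U) V \<longleftrightarrow> graded_sub R M V \<and> V \<subseteq> U"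
proof -
  interpret N: graded_mod R "graded_submodule M U" using hp_sub(1)[OF U] .
  have "smult (graded_submodule M U) = smult M" unfolding graded_submodule_def by simp
  then show ?thesis
    unfolding graded_sub_def submodule_iff N.submodule_iff subgroup_sub_iff[OF U]
    using hp_sub(2)[OF U] by (auto simp: subset_iff)
qed

end

text \<open>This is what puts the modules \<open>I^n M\<close>, and later the cycles and chains of
  the Koszul complex, into the domain of a regularity function.\<close>

lemma (in fg_graded_mod) fg_graded_mod_sub:
  assumes U: "graded_sub R M U"
  shows "fg_graded_mod R (graded_submodule M U)"
proof -
  interpret N: graded_mod R "graded_submodule M U" using hp_sub(1)[OF U] .
  obtain B where B: "B \<subseteq> U" "finite B" "U = set_smult M (carrier R) B"
    using gsub_finitely_generated[OF U] by blast
  then have "U = set_smult (graded_submodule M U) (carrier R) B" using set_smult_sub[OF U] by blast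
  then show ?thesis using B
    by unfold_locales (auto simp: graded_submodule_def)
qed

section \<open>Generating degrees and the graded Nakayama lemma\<close>

abbreviation positive_part :: "'a graded_ring \<Rightarrow> ('a, 'b) graded_module \<Rightarrow> 'b set" where
  "positive_part R M \<equiv> set_smult M (irrelevant_ideal R) (carrier M)"

lemma (in std_graded) irrelevant_least:
  assumes "additive_subgroup A R" "\<And>i. i > 0 \<Longrightarrow> rcomp R i \<subseteq> A"
  shows "irrelevant_ideal R \<subseteq> A"
  unfolding irrelevant_ideal_def
  using assms additive_subgroup.a_subgroup by (intro add.generate_subgroup_incl) auto

lemma (in std_graded) irrelevant_incl: "i > 0 \<Longrightarrow> r \<in> rcomp R i \<Longrightarrow> r \<in> irrelevant_ideal R"
  unfolding irrelevant_ideal_def by (intro generate.incl) auto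

lemma (in std_graded) irrelevant_carrier: "irrelevant_ideal R \<subseteq> carrier R"
  by (rule irrelevant_least) (use RG.comp_carrier in \<open>auto intro: additive_subgroupI'\<close>)

context graded_mod begin

lemma positive_part_subgroup: "additive_subgroup (positive_part R M) M"
  using irrelevant_carrier by (intro set_smult_subgroup) auto

lemma positive_part_incl: "i > 0 \<Longrightarrow> r \<in> rcomp R i \<Longrightarrow> x \<in> carrier M \<Longrightarrow> r \<odot>\<^bsub>M\<^esub> x \<in> positive_part R M"
  by (intro set_smultI irrelevant_incl)

lemma positive_part_least:
  assumes A: "additive_subgroup A M"
    and "\<And>i r x. i > 0 \<Longrightarrow> r \<in> rcomp R i \<Longrightarrow> x \<in> carrier M \<Longrightarrow> r \<odot>\<^bsub>M\<^esub> x \<in> A"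
  shows "positive_part R M \<subseteq> A"
proof (rule set_smult_least[OF A])
  fix a x assume a: "a \<in> irrelevant_ideal R" and x: "x \<in> carrier M"
  have "irrelevant_ideal R \<subseteq> {a \<in> carrier R. a \<odot>\<^bsub>M\<^esub> x \<in> A}"
    using assms x RG.comp_carrier by (intro irrelevant_least scalar_preimage_subgroup) auto
  then show "a \<odot>\<^bsub>M\<^esub> x \<in> A" using a by blast
qed

lemma hp_preimage_subgroup:
  assumes "additive_subgroup A M"
  shows "additive_subgroup {x \<in> carrier M. MG.hp n x \<in> A} M"
  using sub_add[OF assms] sub_zero[OF assms]
    sub_neg[OF assms]
  by (intro M.additive_subgroupI') (auto simp: MG.hpart_add MG.hpart_minus)

text \<open>A coset is zero exactly if its representative lies in \<open>T\<close>. With this,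
  \<open>Dmax\<close> becomes a statement about containment of components in
  \<open>positive_part R M\<close>, and the quotient module disappears from the argument.\<close>

lemma quotient_comp_iff:
  assumes T: "additive_subgroup T M"
  shows "mcomp (quotient_module M T) n \<noteq> {\<zero>\<^bsub>quotient_module M T\<^esub>} \<longleftrightarrow> \<not> mcomp M n \<subseteq> T"
proof -
  note sT = additive_subgroup.a_subgroup[OF T]
  have "T +>\<^bsub>M\<^esub> x = T \<longleftrightarrow> x \<in> T" if "x \<in> carrier M" for x
    using that M.a_coset_join1[OF _ that sT] M.a_coset_join2[OF that sT] by blast
  then have "(\<forall>x \<in> mcomp M n. T +>\<^bsub>M\<^esub> x = T) \<longleftrightarrow> (\<forall>x \<in> mcomp M n. x \<in> T)"
    using MG.comp_carrier by (intro ball_cong) auto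
  moreover have "(\<lambda>x. T +>\<^bsub>M\<^esub> x) ` mcomp M n = {T} \<longleftrightarrow> (\<forall>x \<in> mcomp M n. T +>\<^bsub>M\<^esub> x = T)"
    using MG.comp_zero[of n] by (auto simp del: a_coset_join2)
  ultimately show ?thesis unfolding quotient_module_def by auto
qed

lemma Dmax_eq: "Dmax R M = (GREATEST n. \<not> mcomp M n \<subseteq> positive_part R M)"
  unfolding Dmax_def Let_def using quotient_comp_iff[OF positive_part_subgroup] by simp

end

context fg_graded_mod begin

text \<open>An element of \<open>positive_part R M\<close> of degree \<open>n\<close> is a sum of
  multiples of elements of degree less than \<open>n\<close>, and degrees are bounded below, so
  induction on the degree applies. The threshold \<open>c\<close> separates degrees in which
  generators may occur from those in which nothing new appears.\<close>

lemma graded_nakayama: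
  assumes V: "graded_sub R M V" and high: "\<And>n. n > c \<Longrightarrow> mcomp M n \<subseteq> positive_part R M"
    and low: "\<And>n. n \<le> c \<Longrightarrow> mcomp M n \<subseteq> V"
  shows "carrier M \<subseteq> V"
proof -
  obtain a0 where a0: "\<And>a. a < a0 \<Longrightarrow> mcomp M a = {\<zero>\<^bsub>M\<^esub>}" using components_bounded_below by blast
  note sV = gsub_subgroup[OF V]
  have "mcomp M n \<subseteq> V" for n
  \<comment> \<open>The measure is 0 exactly below \<open>a0\<close>, where the components vanish;
    from \<open>a0\<close> on, lowering the degree lowers the measure.\<close>
  proof (induction "nat (n - a0 + 1)" arbitrary: n rule: less_induct)
    case less
    consider "n < a0" | "n \<le> c" | "n \<ge> a0" "n > c" by linarith
    then show ?case
    proof cases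
      case 1
      then show ?thesis using a0 sub_zero[OF sV] by simp
    next
      case 2
      then show ?thesis by (rule low)
    next
      case 3
      have "positive_part R M \<subseteq> {x \<in> carrier M. MG.hp n x \<in> V}"
      proof (rule positive_part_least[OF hp_preimage_subgroup[OF sV]])
        fix i r x assume i: "i > (0::nat)" and r: "r \<in> rcomp R i" and x: "x \<in> carrier M"
        have "mcomp M (n - int i) \<subseteq> V" using less.hyps[of "n - int i"] i 3 by simp
        then have "MG.hp (n - int i) x \<in> V" using MG.hpart_expansion(1)[OF x] by blast
        then show "r \<odot>\<^bsub>M\<^esub> x \<in> {x \<in> carrier M. MG.hp n x \<in> V}"
          using hp_smult[OF r x, of n] gsub_smult[OF V] RG.comp_carrier[OF r] x by simp
      qed
      then show ?thesis using high[OF 3(2)] MG.hpart_same by fastforce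
    qed
  qed
  then show ?thesis using MG.carrier_subset_of_comp[OF sV] by blast
qed

lemma eventually_positive_part: "\<exists>c. \<forall>n>c. mcomp M n \<subseteq> positive_part R M"
proof -
  obtain B where B: "finite B" "B \<subseteq> carrier M"
    "\<And>a. mcomp M a \<subseteq> add_sets M (set_smult M (rcomp R 0) (MG.hp a ` B)) (lsum M xs (mcomp M (a - 1)))"
    using component_generation by metis
  have "finite (\<Union>b \<in> B. {a. MG.hp a b \<noteq> \<zero>\<^bsub>M\<^esub>})" using B MG.hpart_expansion(2) by blast
  then obtain c where c: "\<And>a. a \<in> (\<Union>b \<in> B. {a. MG.hp a b \<noteq> \<zero>\<^bsub>M\<^esub>}) \<Longrightarrow> a \<le> c"
    by (metis Max_ge)
  note sT = positive_part_subgroup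
  have "mcomp M a \<subseteq> positive_part R M" if a: "a > c" for a
  proof -
    have "MG.hp a ` B \<subseteq> {\<zero>\<^bsub>M\<^esub>}" using c[of a] a by fastforce
    then have "set_smult M (rcomp R 0) (MG.hp a ` B) \<subseteq> positive_part R M"
      using base_carrier sub_zero[OF sT] by (intro set_smult_least[OF sT]) auto
    moreover have "lsum M xs (mcomp M (a - 1)) \<subseteq> positive_part R M"
      using positive_part_incl[of 1] degree_one_gens(1) MG.comp_carrier
        by (intro lsum_least[OF sT]) auto
    ultimately show ?thesis using B(3)[of a] add_sets_least[OF sT] by blast
  qed
  then show ?thesis by blast
qed

context
  assumes nonzero: "carrier M \<noteq> {\<zero>\<^bsub>M\<^esub>}"
begin

text \<open>The maximum in \<open>Dmax\<close> exists: the degrees in question are bounded above by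
  \<open>eventually_positive_part\<close>, and there is one, since otherwise Nakayama's lemma with
  \<open>V = 0\<close> would give \<open>M = 0\<close>.\<close>

lemma Dmax_spec:
  shows "\<not> mcomp M (Dmax R M) \<subseteq> positive_part R M"
    and Dmax_above: "n > Dmax R M \<Longrightarrow> mcomp M n \<subseteq> positive_part R M"
proof -
  obtain c where c: "\<And>n. n > c \<Longrightarrow> mcomp M n \<subseteq> positive_part R M"
    using eventually_positive_part by blast
  obtain a0 where a0: "\<And>a. a < a0 \<Longrightarrow> mcomp M a = {\<zero>\<^bsub>M\<^esub>}" using components_bounded_below by blast
  have "\<exists>n. \<not> mcomp M n \<subseteq> positive_part R M"
  proof (rule ccontr)
    assume "\<not> (\<exists>n. \<not> mcomp M n \<subseteq> positive_part R M)"
    then have "carrier M \<subseteq> {\<zero>\<^bsub>M\<^esub>}"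
      using a0 by (intro graded_nakayama[where c = "a0 - 1"] gsub_zero) auto
    then show False using nonzero by blast
  qed
  then obtain m where m: "\<not> mcomp M m \<subseteq> positive_part R M" by blast
  note G = int_Greatest[of "\<lambda>n. \<not> mcomp M n \<subseteq> positive_part R M" m c, OF m]
  show "\<not> mcomp M (Dmax R M) \<subseteq> positive_part R M" "n > Dmax R M \<Longrightarrow> mcomp M n \<subseteq> positive_part R M"
    unfolding Dmax_eq using G(1) G(2)[of n] c by (meson not_le)+
qed

lemma Dmax_le: "(\<And>n. n > c \<Longrightarrow> mcomp M n \<subseteq> positive_part R M) \<Longrightarrow> Dmax R M \<le> c"
  using Dmax_spec(1) by (meson not_le)

lemma generated_below_Dmax:
  assumes "graded_sub R M V" "\<And>n. n \<le> Dmax R M \<Longrightarrow> mcomp M n \<subseteq> V"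
  shows "carrier M \<subseteq> V"
  using graded_nakayama[OF assms(1) Dmax_above assms(2)] by blast

end

lemma below_dmin:
  assumes "n < dmin M"
  shows "mcomp M n = {\<zero>\<^bsub>M\<^esub>}"
proof (rule ccontr)
  assume n: "mcomp M n \<noteq> {\<zero>\<^bsub>M\<^esub>}"
  obtain a0 where a0: "\<And>a. a < a0 \<Longrightarrow> mcomp M a = {\<zero>\<^bsub>M\<^esub>}" using components_bounded_below by blast
  then have "\<And>n. mcomp M n \<noteq> {\<zero>\<^bsub>M\<^esub>} \<Longrightarrow> a0 \<le> n" by (meson not_le)
  from int_Least(2)[of "\<lambda>n. mcomp M n \<noteq> {\<zero>\<^bsub>M\<^esub>}" n a0, OF n this n] assms
  show False unfolding dmin_def by simp
qed

end

section \<open>Homogeneous ideals as graded submodules of the ring\<close>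

definition homogeneous_ideal :: "'a graded_ring \<Rightarrow> 'a set \<Rightarrow> bool" where
  "homogeneous_ideal R J \<longleftrightarrow> ideal J R \<and> (\<forall>x \<in> J. \<forall>n. hpart R (rcomp R) n x \<in> J)"

context std_graded begin

lemma ideal_iff:
  "ideal J R \<longleftrightarrow> additive_subgroup J R \<and> (\<forall>a \<in> carrier R. \<forall>x \<in> J. a \<otimes> x \<in> J)"
proof
  assume J: "ideal J R"
  show "additive_subgroup J R \<and> (\<forall>a \<in> carrier R. \<forall>x \<in> J. a \<otimes> x \<in> J)"
    using ideal.axioms(1)[OF J] ideal.I_l_closed[OF J] by simp
next
  assume J: "additive_subgroup J R \<and> (\<forall>a \<in> carrier R. \<forall>x \<in> J. a \<otimes> x \<in> J)"
  then have sJ: "additive_subgroup J R" by simp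
  have Jc: "x \<in> J \<Longrightarrow> x \<in> carrier R" for x using sub_carrier[OF sJ] .
  show "ideal J R"
  proof (rule idealI[OF ring_axioms additive_subgroup.a_subgroup[OF sJ]])
    show "x \<otimes> a \<in> J" if "a \<in> J" "x \<in> carrier R" for a x using that J by blast
    then show "a \<otimes> x \<in> J" if "a \<in> J" "x \<in> carrier R" for a x using that Jc m_comm[of a x] by simp
  qed
qed

lemma graded_ideal_iff: "graded_ideal R J \<longleftrightarrow> homogeneous_ideal R J"
proof
  assume gi: "graded_ideal R J"
  then have J: "ideal J R" and dd: "direct_decomposition (R\<lparr>carrier := J\<rparr>) (\<lambda>n. J \<inter> rcomp R n)"
    unfolding graded_ideal_def by auto
  have sJ: "additive_subgroup J R" using J ideal_iff by blast
  have Jc: "J \<subseteq> carrier R" using sub_subset[OF sJ] .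
  let ?N = "R\<lparr>carrier := J\<rparr>"
  note sub = abelian_group_sub[OF sJ, of ?N, simplified]
  interpret N: abelian_group ?N by (rule sub(1))
  interpret NG: graded_group ?N "\<lambda>n. J \<inter> rcomp R n" using dd by unfold_locales
  let ?A = "{x \<in> J. \<forall>n. RG.hp n x \<in> J}"
  have "carrier ?N \<subseteq> ?A"
  proof (rule NG.carrier_subset_of_comp)
    show "additive_subgroup ?A ?N"
      using sub_add[OF sJ] sub_zero[OF sJ]
        sub_neg[OF sJ] Jc
      by (intro N.additive_subgroupI') (auto simp: sub(2) RG.hpart_add RG.hpart_minus subset_iff)
    show "J \<inter> rcomp R i \<subseteq> ?A" for i
    proof
      fix x assume x: "x \<in> J \<inter> rcomp R i"
      then have "RG.hp n x = (if n = i then x else \<zero>)" for n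
        using RG.hpart_same RG.hpart_other by auto
      then show "x \<in> ?A" using x sub_zero[OF sJ] by simp
    qed
  qed
  then show "homogeneous_ideal R J" using J unfolding homogeneous_ideal_def by auto
next
  assume gp: "homogeneous_ideal R J"
  then have J: "ideal J R" and hpJ: "\<And>x n. x \<in> J \<Longrightarrow> RG.hp n x \<in> J" unfolding homogeneous_ideal_def
    by auto
  have sJ: "additive_subgroup J R" using J ideal_iff by blast
  have "direct_decomposition (R\<lparr>carrier := J\<rparr>) (\<lambda>n. J \<inter> rcomp R n)"
    by (rule RG.sub_decomposition(1)[OF sJ hpJ]) auto
  then show "graded_ideal R J" unfolding graded_ideal_def using J by blast
qed

text \<open>The ring as a graded module over itself, zero in negative degrees. Through it the chain
  condition and Nakayama's lemma become available for homogeneous ideals.\<close>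

abbreviation RM where "RM \<equiv> ideal_module R (carrier R)"

lemma RM_simps [simp]: "carrier RM = carrier R" "add RM = add R" "zero RM = zero R"
  "smult RM = monoid.mult R"
  "mcomp RM n = (if n < 0 then {\<zero>} else rcomp R (nat n))"
  unfolding ideal_module_def using RG.comp_carrier by auto

lemma carrier_subgroup: "additive_subgroup (carrier R) R"
  by (rule additive_subgroupI') auto

lemma RM_abelian_group: "abelian_group RM"
  and RM_subgroup_iff: "additive_subgroup A RM \<longleftrightarrow> additive_subgroup A R"
  using abelian_group_sub[OF carrier_subgroup, of RM] sub_subset[of A R] by auto

lemma RM_graded_mod: "graded_mod R RM"
  and RM_hp: "x \<in> carrier R \<Longrightarrow> hpart RM (mcomp RM) n x = (if n < 0 then \<zero> else RG.hp (nat n) x)"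
proof -
  interpret N: abelian_group RM by (rule RM_abelian_group)
  let ?p = "\<lambda>n x. if n < 0 then \<zero> else RG.hp (nat n) x"
  have z: "additive_subgroup {\<zero>} R" by (rule additive_subgroupI') auto
  have zs: "{\<zero>} \<subseteq> rcomp R i" for i using RG.comp_zero by simp
  have C: "additive_subgroup (mcomp RM n) RM" for n :: int
    unfolding RM_subgroup_iff using z RG.comp_subgroup by simp
  have dd: "direct_decomposition RM (mcomp RM)"
  proof (rule N.direct_decompositionI[where p = ?p, OF C])
    show "finite {i. ?p i x \<noteq> \<zero>\<^bsub>RM\<^esub>}" if "x \<in> carrier RM" for x
    proof (rule finite_subset)
      show "{i. ?p i x \<noteq> \<zero>\<^bsub>RM\<^esub>} \<subseteq> int ` {i. RG.hp i x \<noteq> \<zero>}"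
        by (auto split: if_splits intro!: image_eqI[of _ int "nat _"])
      show "finite (int ` {i. RG.hp i x \<noteq> \<zero>})" using RG.hpart_expansion(2) that by simp
    qed
    show "x = \<zero>\<^bsub>RM\<^esub>" if "x \<in> carrier RM" "\<And>i. ?p i x = \<zero>\<^bsub>RM\<^esub>" for x
    proof -
      have "RG.hp i x = \<zero>" for i using that(2)[of "int i"] by simp
      then show ?thesis using RG.hpart_eq_zero that(1) by simp
    qed
  qed (auto simp: RG.hpart_add RG.hpart_expansion(1) RG.hpart_same RG.hpart_other nat_eq_iff
      split: if_splits intro!: RG.hpart_other)
  have mod: "module R RM"
    by (rule moduleI) (auto simp: is_cring N.abelian_group_axioms l_distr r_distr m_assoc)
  have deg: "r \<odot>\<^bsub>RM\<^esub> x \<in> mcomp RM (int i + n)" if "r \<in> rcomp R i" "x \<in> mcomp RM n" for r x i n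
  proof (cases "n < 0")
    case True
    then have "r \<odot>\<^bsub>RM\<^esub> x = \<zero>" using that RG.comp_carrier by simp
    then show ?thesis using RG.comp_zero by simp
  next
    case False
    then have "r \<otimes> x \<in> rcomp R (i + nat n)" using rcomp_mult that by simp
    moreover have "nat (int i + n) = i + nat n" using False by simp
    ultimately show ?thesis using False by simp
  qed
  show "graded_mod R RM"
    by (intro graded_mod.intro graded_mod_axioms.intro mod dd std_graded_axioms deg)
  interpret NG: graded_group RM "mcomp RM" using dd by unfold_locales
  show "NG.hp n x = ?p n x" if "x \<in> carrier R"
    by (rule NG.hpart_eqI)
      (use that in \<open>auto simp: RG.hpart_add RG.hpart_same nat_eq_iff split: if_splits intro!:
        RG.hpart_other\<close>)
qed

lemma RM_fg: "fg_graded_mod R RM"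
proof -
  interpret graded_mod R RM by (rule RM_graded_mod)
  have "carrier R \<subseteq> set_smult RM (carrier R) {\<one>}"
  proof
    fix x assume "x \<in> carrier R"
    then have "x \<odot>\<^bsub>RM\<^esub> \<one> \<in> set_smult RM (carrier R) {\<one>}" by (intro set_smultI) auto
    then show "x \<in> set_smult RM (carrier R) {\<one>}" using \<open>x \<in> carrier R\<close> by simp
  qed
  moreover have "set_smult RM (carrier R) {\<one>} \<subseteq> carrier R"
    using sub_subset[OF set_smult_subgroup[of "carrier R" "{\<one>}"]] by simp
  ultimately show ?thesis by unfold_locales (auto intro!: exI[of _ "{\<one>}"])
qed

lemma homogeneous_ideal_gsub: "homogeneous_ideal R J \<longleftrightarrow> graded_sub R RM J"
proof -
  interpret N: graded_mod R RM by (rule RM_graded_mod)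
  have "(\<forall>n. hpart RM (mcomp RM) n x \<in> J) \<longleftrightarrow> (\<forall>n. RG.hp n x \<in> J)"
    if sJ: "additive_subgroup J R" and x: "x \<in> J" for x
  proof
    assume *: "\<forall>n. hpart RM (mcomp RM) n x \<in> J"
    show "\<forall>n. RG.hp n x \<in> J"
    proof
      fix n show "RG.hp n x \<in> J"
        using *[rule_format, of "int n"] RM_hp[of x] sub_carrier[OF sJ x] by simp
    qed
  next
    assume "\<forall>n. RG.hp n x \<in> J"
    then show "\<forall>n. hpart RM (mcomp RM) n x \<in> J"
      using RM_hp[of x] sub_carrier[OF sJ x] sub_zero[OF sJ] by simp
  qed
  then show ?thesis
    unfolding homogeneous_ideal_def graded_sub_def N.submodule_iff RM_subgroup_iff ideal_iff by auto
qed

lemma ideal_module_sub: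
  assumes "homogeneous_ideal R J"
  shows "ideal_module R J = graded_submodule RM J"
proof -
  have J: "additive_subgroup J R" using assms ideal_iff unfolding homogeneous_ideal_def by blast
  have "(\<lambda>n::int. if n < 0 then {\<zero>} else J \<inter> rcomp R (nat n)) = (\<lambda>n. J \<inter> mcomp RM n)"
    using sub_zero[OF J] by (intro ext) auto
  then show ?thesis unfolding graded_submodule_def by (simp add: ideal_module_def)
qed

lemma ideal_fg: "homogeneous_ideal R J \<Longrightarrow> fg_graded_mod R (ideal_module R J)"
  using fg_graded_mod.fg_graded_mod_sub[OF RM_fg] ideal_module_sub homogeneous_ideal_gsub by simp

end

context std_graded begin

definition gens_below :: "'a set \<Rightarrow> int \<Rightarrow> 'a set" where
  "gens_below J c = {f. \<exists>i. f \<in> J \<inter> rcomp R i \<and> int i \<le> c}"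

text \<open>The bound is an integer so that it can be \<open>Dmax\<close> of an ideal module or
  \<open>rho R I M - 1\<close>. For negative \<open>c\<close> there are no generators and the span
  is the zero ideal.\<close>

definition span_below :: "'a set \<Rightarrow> int \<Rightarrow> 'a set" where
  "span_below J c = set_smult RM (carrier R) (gens_below J c)"

lemma homogeneous_idealD:
  assumes "homogeneous_ideal R J"
  shows "additive_subgroup J R" "J \<subseteq> carrier R" "a \<in> carrier R \<Longrightarrow> x \<in> J \<Longrightarrow> a \<otimes> x \<in> J"
    "x \<in> J \<Longrightarrow> RG.hp n x \<in> J"
  using assms sub_subset[of J R] unfolding homogeneous_ideal_def ideal_iff by auto

lemma gens_below_homogeneous: "f \<in> gens_below J c \<Longrightarrow> \<exists>n. f \<in> mcomp RM n"
  unfolding gens_below_def by (auto intro: exI[of _ "int _"])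

lemma span_below:
  assumes J: "homogeneous_ideal R J"
  shows "homogeneous_ideal R (span_below J c)" "span_below J c \<subseteq> J" "gens_below J c \<subseteq> span_below J c"
proof -
  interpret N: graded_mod R RM by (rule RM_graded_mod)
  show "homogeneous_ideal R (span_below J c)" "gens_below J c \<subseteq> span_below J c"
    unfolding span_below_def homogeneous_ideal_gsub
    using N.gsub_span[of "gens_below J c", OF gens_below_homogeneous] by simp_all
  show "span_below J c \<subseteq> J"
    unfolding span_below_def
    using homogeneous_idealD[OF J]
      by (intro N.set_smult_least) (auto simp: RM_subgroup_iff gens_below_def)
qed

text \<open>In degree \<open>n > c\<close> the part of \<open>a f\<close> with \<open>f\<close> a
  generator of degree at most \<open>c\<close> comes from a coefficient of positive degree, so it
  lies in the positive part of the ideal module.\<close>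

lemma Dmax_span_below:
  assumes J: "homogeneous_ideal R J" and nz: "span_below J c \<noteq> {\<zero>}"
  shows "Dmax R (ideal_module R (span_below J c)) \<le> c"
proof -
  let ?J = "span_below J c" and ?N = "ideal_module R (span_below J c)"
  have gp: "homogeneous_ideal R ?J" using span_below[OF J] by blast
  have gs: "graded_sub R RM ?J" using gp homogeneous_ideal_gsub by simp
  interpret RMM: graded_mod R RM by (rule RM_graded_mod)
  have Neq: "?N = graded_submodule RM ?J" by (rule ideal_module_sub[OF gp])
  interpret N: fg_graded_mod R ?N by (rule ideal_fg[OF gp])
  have [simp]: "carrier ?N = ?J" "smult ?N = (\<otimes>)" "zero ?N = \<zero>" unfolding ideal_module_def by auto
  show ?thesis
  proof (rule N.Dmax_le)
    show "carrier ?N \<noteq> {\<zero>\<^bsub>?N\<^esub>}" using nz by simp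
    fix n assume n: "n > c"
    let ?T = "positive_part R ?N"
    have sT: "additive_subgroup ?T R" "?T \<subseteq> ?J"
      using N.positive_part_subgroup RMM.subgroup_sub_iff[OF gs] RM_subgroup_iff unfolding Neq by auto
    have "set_smult RM (carrier R) (gens_below J c) \<subseteq> {x \<in> carrier RM. RMM.MG.hp n x \<in> ?T}"
    proof (rule RMM.set_smult_least)
      show "additive_subgroup {x \<in> carrier RM. RMM.MG.hp n x \<in> ?T} RM"
        using RMM.hp_preimage_subgroup sT(1) RM_subgroup_iff by blast
      fix a f assume a: "a \<in> carrier R" and f: "f \<in> gens_below J c"
      obtain d where d: "f \<in> rcomp R d" "int d \<le> c" using f unfolding gens_below_def by blast
      have fc: "f \<in> carrier R" using d RG.comp_carrier by blast
      have fJ: "f \<in> ?J" using span_below(3)[OF J] f by blast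
      have "carrier R \<subseteq> {a \<in> carrier R. a \<otimes> f \<in> {x \<in> carrier R. RMM.MG.hp n x \<in> ?T}}"
      proof (rule RG.carrier_subset_of_comp)
        have "additive_subgroup {a \<in> carrier R. a \<odot>\<^bsub>RM\<^esub> f \<in> {x \<in> carrier RM. RMM.MG.hp n x \<in> ?T}} R"
          using sT(1) fc RM_subgroup_iff
          by (intro RMM.scalar_preimage_subgroup RMM.hp_preimage_subgroup) auto
        then show "additive_subgroup {a \<in> carrier R. a \<otimes> f \<in> {x \<in> carrier R. RMM.MG.hp n x \<in> ?T}} R"
          by simp
        show "rcomp R i \<subseteq> {a \<in> carrier R. a \<otimes> f \<in> {x \<in> carrier R. RMM.MG.hp n x \<in> ?T}}" for i
        proof
          fix r assume r: "r \<in> rcomp R i"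
          have rc: "r \<in> carrier R" using r RG.comp_carrier by blast
          have rf: "r \<otimes> f \<in> mcomp RM (int (i + d))"
            using rcomp_mult[OF r d(1)] by (simp del: of_nat_add)
          have "RMM.MG.hp n (r \<otimes> f) \<in> ?T"
          proof (cases "n = int (i + d)")
            case True
            then have "i > 0" using n d(2) by simp
            then have "r \<odot>\<^bsub>?N\<^esub> f \<in> ?T" using r fJ by (intro N.positive_part_incl) auto
            then show ?thesis using RMM.MG.hpart_same[OF rf] True by simp
          next
            case False
            then show ?thesis
              using RMM.MG.hpart_other[OF rf, of n] sub_zero[OF sT(1)] by simp
          qed
          then show "r \<in> {a \<in> carrier R. a \<otimes> f \<in> {x \<in> carrier R. RMM.MG.hp n x \<in> ?T}}"
            using rc fc by simp
        qed
      qed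
      then show "a \<odot>\<^bsub>RM\<^esub> f \<in> {x \<in> carrier RM. RMM.MG.hp n x \<in> ?T}" using a by auto
    qed
    then have "?J \<subseteq> {x \<in> carrier RM. RMM.MG.hp n x \<in> ?T}" by (simp only: span_below_def)
    then show "mcomp ?N n \<subseteq> ?T"
      using RMM.MG.hpart_same[of _ n] unfolding Neq graded_submodule_def by fastforce
  qed
qed

text \<open>Links the number \<open>D(J)\<close> to actual generators: Nakayama's lemma gives the
  first claim, and a negative value would leave only the zero ideal. The finite list in the last
  claim supplies the elements of the Koszul complex.\<close>

lemma generated_by_degrees:
  assumes J: "homogeneous_ideal R J" and nz: "J \<noteq> {\<zero>}"
  shows "J = span_below J (Dmax R (ideal_module R J))"
    and "0 \<le> Dmax R (ideal_module R J)"
    and "\<exists>ys. J = set_smult RM (carrier R) (set ys) \<and>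
      (\<forall>y \<in> set ys. \<exists>i. y \<in> J \<inter> rcomp R i \<and> int i \<le> Dmax R (ideal_module R J))"
proof -
  let ?c = "Dmax R (ideal_module R J)" and ?N = "ideal_module R J"
  have gs: "graded_sub R RM J" using J homogeneous_ideal_gsub by simp
  interpret RMM: fg_graded_mod R RM by (rule RM_fg)
  have Neq: "?N = graded_submodule RM J" by (rule ideal_module_sub[OF J])
  interpret N: fg_graded_mod R ?N by (rule ideal_fg[OF J])
  have [simp]: "carrier ?N = J" "zero ?N = \<zero>" unfolding ideal_module_def by auto
  have nzN: "carrier ?N \<noteq> {\<zero>\<^bsub>?N\<^esub>}" using nz by simp
  have V: "graded_sub R ?N (span_below J ?c)"
    using span_below[OF J] homogeneous_ideal_gsub RMM.gsub_sub_iff[OF gs] unfolding Neq by blast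
  have "J \<subseteq> span_below J ?c"
  proof -
    have "mcomp ?N n \<subseteq> span_below J ?c" if n: "n \<le> ?c" for n
    proof (cases "n < 0")
      case True
      then show ?thesis unfolding ideal_module_def
        using homogeneous_idealD(1)[OF span_below(1)[OF J]] sub_zero by auto
    next
      case False
      then have "mcomp ?N n = J \<inter> rcomp R (nat n)" unfolding ideal_module_def by simp
      also have "\<dots> \<subseteq> gens_below J ?c" using n False unfolding gens_below_def by auto
      finally show ?thesis using span_below(3)[OF J] by blast
    qed
    then show ?thesis using N.generated_below_Dmax[OF nzN V] by simp
  qed
  then show Jeq: "J = span_below J ?c" using span_below(2)[OF J] by blast
  show "0 \<le> ?c"
  proof (rule ccontr)
    assume "\<not> 0 \<le> ?c"
    then have "gens_below J ?c = {}" unfolding gens_below_def by auto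
    then have "span_below J ?c \<subseteq> {\<zero>}" unfolding span_below_def
      by (intro RMM.set_smult_least) (use RMM.gsub_subgroup[OF RMM.gsub_zero] in auto)
    then show False using nz Jeq homogeneous_idealD(1)[OF J] sub_zero by blast
  qed
  obtain X where X: "finite X" "X \<subseteq> gens_below J ?c" "set_smult RM (carrier R) X = span_below J ?c"
    using RMM.finite_generating_subset[of "gens_below J ?c"] gens_below_homogeneous
    unfolding span_below_def by blast
  obtain ys where "set ys = X" using finite_list X(1) by blast
  then show "\<exists>ys. J = set_smult RM (carrier R) (set ys) \<and>
      (\<forall>y \<in> set ys. \<exists>i. y \<in> J \<inter> rcomp R i \<and> int i \<le> ?c)"
    using X Jeq unfolding gens_below_def by (intro exI[of _ ys]) auto
qed

end

section \<open>Products of ideals with modules, powers, and reductions\<close>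

context graded_mod begin

lemma gsub_ideal_smult:
  assumes J: "homogeneous_ideal R J" and V: "graded_sub R M V"
  shows "graded_sub R M (set_smult M J V)"
proof (rule gsub_set_smult)
  note gp = homogeneous_idealD[OF J]
  show "J \<subseteq> carrier R" "\<And>a s. a \<in> carrier R \<Longrightarrow> s \<in> J \<Longrightarrow> a \<otimes>\<^bsub>R\<^esub> s \<in> J" using gp by auto
  show "V \<subseteq> carrier M" using gsub_carrier[OF V] by blast
  fix s b n assume s: "s \<in> J" and b: "b \<in> V"
  have bc: "b \<in> carrier M" using gsub_carrier[OF V b] .
  let ?W = "set_smult M J V"
  have sW: "additive_subgroup ?W M" using gp gsub_carrier[OF V] by (intro set_smult_subgroup) auto
  have "s \<in> {a \<in> carrier R. a \<odot>\<^bsub>M\<^esub> b \<in> {x \<in> carrier M. MG.hp n x \<in> ?W}}"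
  proof (rule RG.mem_of_hpart)
    show "additive_subgroup {a \<in> carrier R. a \<odot>\<^bsub>M\<^esub> b \<in> {x \<in> carrier M. MG.hp n x \<in> ?W}} R"
      by (intro scalar_preimage_subgroup hp_preimage_subgroup sW bc)
    show sc: "s \<in> carrier R" using s gp by blast
    fix i
    have c: "RG.hp i s \<in> rcomp R i" using RG.hpart_expansion(1)[OF sc] .
    have "RG.hp i s \<odot>\<^bsub>M\<^esub> MG.hp (n - int i) b \<in> ?W"
      using gp(4)[OF s] gsub_hp[OF V b] by (intro set_smultI) auto
    then show "RG.hp i s \<in> {a \<in> carrier R. a \<odot>\<^bsub>M\<^esub> b \<in> {x \<in> carrier M. MG.hp n x \<in> ?W}}"
      using hp_smult[OF c bc, of n] sc bc by simp
  qed
  then show "MG.hp n (s \<odot>\<^bsub>M\<^esub> b) \<in> ?W" by blast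
qed

lemma set_smult_submodule_subset:
  assumes "graded_sub R M V" "J \<subseteq> carrier R"
  shows "set_smult M J V \<subseteq> V"
  using gsub_smult[OF assms(1)] assms(2) by (intro set_smult_least gsub_subgroup[OF assms(1)]) auto

lemma set_smult_assoc:
  assumes A: "A \<subseteq> carrier R" and B: "B \<subseteq> carrier R" and X: "X \<subseteq> carrier M"
  shows "set_smult M A (set_smult M B X) = set_smult M (ideal_prod R A B) X"
proof
  have AB: "ideal_prod R A B \<subseteq> carrier R"
  proof
    fix s assume "s \<in> ideal_prod R A B"
    then show "s \<in> carrier R" by induction (use A B in auto)
  qed
  have s1: "additive_subgroup (set_smult M B X) M" by (intro set_smult_subgroup B X)
  have c1: "set_smult M B X \<subseteq> carrier M" using sub_subset[OF s1] .
  have sL: "additive_subgroup (set_smult M A (set_smult M B X)) M"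
    by (intro set_smult_subgroup A c1)
  have sR: "additive_subgroup (set_smult M (ideal_prod R A B) X) M"
    by (intro set_smult_subgroup AB X)
  show "set_smult M A (set_smult M B X) \<subseteq> set_smult M (ideal_prod R A B) X"
  proof (rule set_smult_least[OF sR])
    fix a z assume a: "a \<in> A" and z: "z \<in> set_smult M B X"
    have "set_smult M B X \<subseteq> {z \<in> carrier M. a \<odot>\<^bsub>M\<^esub> z \<in> set_smult M (ideal_prod R A B) X}"
    proof (rule set_smult_least)
      show "additive_subgroup {z \<in> carrier M. a \<odot>\<^bsub>M\<^esub> z \<in> set_smult M (ideal_prod R A B) X} M"
        using smult_preimage_subgroup[OF sR] a A by blast
      fix b x assume b: "b \<in> B" and x: "x \<in> X"
      have "(a \<otimes>\<^bsub>R\<^esub> b) \<odot>\<^bsub>M\<^esub> x \<in> set_smult M (ideal_prod R A B) X"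
        using a b x by (intro set_smultI ideal_prod.prod)
      moreover have "a \<in> carrier R" "b \<in> carrier R" "x \<in> carrier M" using a b x A B X by auto
      ultimately show "b \<odot>\<^bsub>M\<^esub> x \<in> {z \<in> carrier M. a \<odot>\<^bsub>M\<^esub> z \<in> set_smult M (ideal_prod R A B) X}"
        by (auto simp: smult_assoc1)
    qed
    then show "a \<odot>\<^bsub>M\<^esub> z \<in> set_smult M (ideal_prod R A B) X" using z by blast
  qed
  show "set_smult M (ideal_prod R A B) X \<subseteq> set_smult M A (set_smult M B X)"
  proof (rule set_smult_least[OF sL])
    fix s x assume s: "s \<in> ideal_prod R A B" and x: "x \<in> X"
    have xc: "x \<in> carrier M" using x X by blast
    from s show "s \<odot>\<^bsub>M\<^esub> x \<in> set_smult M A (set_smult M B X)"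
    proof induction
      case (prod a b)
      then have "a \<odot>\<^bsub>M\<^esub> (b \<odot>\<^bsub>M\<^esub> x) \<in> set_smult M A (set_smult M B X)"
        using x by (intro set_smultI)
      moreover have "a \<in> carrier R" "b \<in> carrier R" using prod A B by auto
      ultimately show ?case using xc by (simp add: smult_assoc1)
    next
      case (sum s1 s2)
      then have "s1 \<in> carrier R" "s2 \<in> carrier R" using AB by auto
      then show ?case using sum.IH sub_add[OF sL] xc by (simp add: smult_l_distr)
    qed
  qed
qed

lemma power_smult_0: "power_smult R I 0 M = carrier M"
proof -
  have "carrier M \<subseteq> set_smult M (carrier R) (carrier M)"
  proof
    fix x assume x: "x \<in> carrier M"
    then have "\<one>\<^bsub>R\<^esub> \<odot>\<^bsub>M\<^esub> x \<in> set_smult M (carrier R) (carrier M)" by (intro set_smultI) auto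
    then show "x \<in> set_smult M (carrier R) (carrier M)" using x by simp
  qed
  moreover have "set_smult M (carrier R) (carrier M) \<subseteq> carrier M"
    using set_smult_submodule_subset[OF gsub_carrier_self] by blast
  ultimately show ?thesis unfolding power_smult_def by (simp add: nat_pow_def ideals_set_def)
qed

end

locale graded_powers = fg_graded_mod R M for R :: "'a graded_ring" (structure)
  and M :: "('a, 'b) graded_module" (structure) +
  fixes I :: "'a set"
  assumes I: "homogeneous_ideal R I"
begin

abbreviation P where "P n \<equiv> power_smult R I n M"

lemma I_sub: "I \<subseteq> carrier R" "ideal I R"
  using I homogeneous_idealD(2) unfolding homogeneous_ideal_def by auto

lemma ideal_pow: "ideal (I [^]\<^bsub>ideals_set R\<^esub> (n::nat)) R"
  by (induction n) (use I_sub R.oneideal R.ideal_prod_is_ideal in \<open>auto simp: nat_pow_def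
    ideals_set_def\<close>)

text \<open>Together with \<open>power_smult_0\<close> this replaces powers of ideals by repeated
  multiplication of submodules by \<open>I\<close>. The power of an ideal gains its new factor on
  the right, so commutativity is used to move it to the left.\<close>

lemma power_smult_Suc: "P (Suc n) = set_smult M I (P n)"
proof -
  let ?J = "I [^]\<^bsub>ideals_set R\<^esub> n"
  have "I [^]\<^bsub>ideals_set R\<^esub> Suc n = ideal_prod R ?J I" by (simp add: nat_pow_def ideals_set_def)
  also have "\<dots> = ideal_prod R I ?J" using R.ideal_prod_commute ideal_pow I_sub by blast
  finally show ?thesis
    using set_smult_assoc[OF I_sub(1), of ?J "carrier M"] sub_subset[OF ideal.axioms(1)[OF ideal_pow]]
    unfolding power_smult_def by auto
qed

lemma gsub_P: "graded_sub R M (P n)"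
  by (induction n) (simp_all add: power_smult_0 gsub_carrier_self power_smult_Suc gsub_ideal_smult I)

lemma P_mono: "P (Suc n) \<subseteq> P n"
  unfolding power_smult_Suc using set_smult_submodule_subset[OF gsub_P I_sub(1)] .

lemma P_carrier: "P n \<subseteq> carrier M"
  using gsub_carrier[OF gsub_P] by blast

lemma smult_commute:
  assumes "J \<subseteq> carrier R" "V \<subseteq> carrier M"
  shows "set_smult M J (set_smult M I V) = set_smult M I (set_smult M J V)"
proof -
  have "ideal_prod R J I = ideal_prod R I J"
  proof
    have *: "ideal_prod R A B \<subseteq> ideal_prod R B A" if "A \<subseteq> carrier R" "B \<subseteq> carrier R" for A B
    proof
      fix s assume "s \<in> ideal_prod R A B"
      then show "s \<in> ideal_prod R B A"
      proof induction
        case (prod i j)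
        then have "i \<otimes>\<^bsub>R\<^esub> j = j \<otimes>\<^bsub>R\<^esub> i" using that R.m_comm by blast
        then show ?case using ideal_prod.prod[OF prod(2,1), of R] by simp
      qed (rule ideal_prod.sum)
    qed
    show "ideal_prod R J I \<subseteq> ideal_prod R I J" "ideal_prod R I J \<subseteq> ideal_prod R J I"
      using * assms I_sub by blast+
  qed
  then show ?thesis using set_smult_assoc assms I_sub by metis
qed

text \<open>A single exponent suffices: multiplying the equality by \<open>I\<close> and moving
  \<open>I\<close> past \<open>J\<close> raises the exponent by one.\<close>

lemma reduction_eventually:
  assumes J: "is_reduction R M I J"
  shows "\<exists>n0. \<forall>n\<ge>n0. P (Suc n) = set_smult M J (P n)"
proof -
  obtain n0 where n0: "set_smult M J (P n0) = P (Suc n0)" and Jc: "J \<subseteq> carrier R"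
    using J I_sub unfolding is_reduction_def by auto
  have "P (Suc n) = set_smult M J (P n)" if "n \<ge> n0" for n
    using that
  proof (induction rule: dec_induct)
    case (step n)
    have "P (Suc (Suc n)) = set_smult M I (set_smult M J (P n))" using step power_smult_Suc by metis
    also have "\<dots> = set_smult M J (P (Suc n))"
      using smult_commute[OF Jc P_carrier] power_smult_Suc by simp
    finally show ?case .
  qed (use n0 in simp)
  then show ?thesis by blast
qed

lemma I_is_reduction: "is_reduction R M I I"
  unfolding is_reduction_def using graded_ideal_iff I power_smult_Suc by (auto intro!: exI[of _ 1])

text \<open>The truncation of \<open>M\<close> to degrees at least \<open>c\<close>.\<close>

definition tail :: "int \<Rightarrow> 'b set" where
  "tail c = {x \<in> carrier M. \<forall>a<c. MG.hp a x = \<zero>\<^bsub>M\<^esub>}"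

lemma tail_subgroup: "additive_subgroup (tail c) M"
  unfolding tail_def by (rule M.additive_subgroupI') (auto simp: MG.hpart_add MG.hpart_minus)

context
  assumes nonzero: "\<And>n. P n \<noteq> {\<zero>\<^bsub>M\<^esub>}"
begin

text \<open>If all \<open>P n\<close> are nonzero, the zero ideal cannot be a reduction. This
  guarantees that every value of \<open>Dmax\<close> compared in \<open>rho\<close> is
  meaningful.\<close>

lemma reduction_nonzero:
  assumes "is_reduction R M I J"
  shows "homogeneous_ideal R J" "J \<noteq> {\<zero>\<^bsub>R\<^esub>}"
proof -
  show "homogeneous_ideal R J" using assms graded_ideal_iff unfolding is_reduction_def by simp
  show "J \<noteq> {\<zero>\<^bsub>R\<^esub>}"
  proof
    assume J: "J = {\<zero>\<^bsub>R\<^esub>}"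
    obtain n where n: "set_smult M J (P n) = P (Suc n)" using assms unfolding is_reduction_def by auto
    have "set_smult M J (P n) \<subseteq> {\<zero>\<^bsub>M\<^esub>}"
      using P_carrier[of n] J by (intro set_smult_least gsub_subgroup[OF gsub_zero]) (auto simp:
        subset_iff)
    then show False
      using n nonzero[of "Suc n"] sub_zero[OF gsub_subgroup[OF gsub_P[of "Suc n"]]] by blast
  qed
qed

text \<open>The minimum is attained because \<open>I\<close> itself is a reduction and
  \<open>D(J) \<ge> 0\<close> for every nonzero \<open>J\<close>.\<close>

lemma rho_spec:
  shows "\<exists>J. is_reduction R M I J \<and> rho R I M = Dmax R (ideal_module R J)"
    and rho_le: "is_reduction R M I J \<Longrightarrow> rho R I M \<le> Dmax R (ideal_module R J)"
proof -
  let ?Q = "\<lambda>k. \<exists>J. is_reduction R M I J \<and> k = Dmax R (ideal_module R J)"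
  have "?Q (Dmax R (ideal_module R I))" using I_is_reduction by blast
  moreover have "0 \<le> k" if "?Q k" for k
    using that generated_by_degrees(2) reduction_nonzero by blast
  ultimately have "?Q (Least ?Q)" "\<And>m. ?Q m \<Longrightarrow> Least ?Q \<le> m"
    using int_Least[of ?Q _ 0] by blast+
  then show "\<exists>J. is_reduction R M I J \<and> rho R I M = Dmax R (ideal_module R J)"
    "is_reduction R M I J \<Longrightarrow> rho R I M \<le> Dmax R (ideal_module R J)"
    unfolding rho_def by blast+
qed

lemma smult_tail:
  assumes f: "f \<in> rcomp R i" and w: "w \<in> tail c" and "e \<le> c + int i"
  shows "f \<odot>\<^bsub>M\<^esub> w \<in> tail e"
proof -
  have wc: "w \<in> carrier M" using w unfolding tail_def by blast
  then have "MG.hp a (f \<odot>\<^bsub>M\<^esub> w) = \<zero>\<^bsub>M\<^esub>" if "a < e" for a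
    using hp_smult[OF f wc, of a] w that assms(3) RG.comp_carrier[OF f] unfolding tail_def by auto
  then show ?thesis using RG.comp_carrier[OF f] wc unfolding tail_def by auto
qed

text \<open>
  A product of \<open>n\<close> homogeneous elements of \<open>I\<close> of degree at least \<open>r\<close> and an element of \<open>M\<close> has
  degree at least \<open>r n + d(M)\<close>.
\<close>

lemma P_subset_tail:
  fixes r :: int
  defines "J \<equiv> span_below I (r - 1)"
  shows "P (Suc n) \<subseteq> add_sets M (set_smult M J (P n)) (tail (r * int (Suc n) + dmin M))"
proof -
  \<comment> \<open>\<open>V n\<close> receives the products that contain a factor of degree less
    than \<open>r\<close>; such a factor lies in \<open>J\<close>. With \<open>V 0 = 0\<close> the
    induction can start from the empty product, whereas the claim itself starts at exponent
    one.\<close>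
  define V where "V n = (case n of 0 \<Rightarrow> {\<zero>\<^bsub>M\<^esub>} | Suc m \<Rightarrow> set_smult M J (P m))" for n
  have Jg: "homogeneous_ideal R J" and gJ: "gens_below I (r - 1) \<subseteq> J"
    unfolding J_def using span_below[OF I] by auto
  have Jc: "J \<subseteq> carrier R" using homogeneous_idealD(2)[OF Jg] .
  have gV: "graded_sub R M (V n)" for n
    unfolding V_def using gsub_zero gsub_ideal_smult[OF Jg gsub_P] by (cases n) auto
  have "P n \<subseteq> add_sets M (V n) (tail (r * int n + dmin M))" for n
  proof (induction n)
    case 0
    have "x \<in> add_sets M (V 0) (tail (dmin M))" if x: "x \<in> carrier M" for x
    proof -
      have "MG.hp a x = \<zero>\<^bsub>M\<^esub>" if "a < dmin M" for a
        using below_dmin[OF that] MG.hpart_expansion(1)[OF x, of a] by blast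
      then have "\<zero>\<^bsub>M\<^esub> \<oplus>\<^bsub>M\<^esub> x \<in> add_sets M (V 0) (tail (dmin M))"
        unfolding V_def tail_def using x by (intro add_setsI) auto
      then show ?thesis using x by simp
    qed
    then show ?case by (auto simp: power_smult_0)
  next
    case (Suc n)
    let ?D = "add_sets M (V (Suc n)) (tail (r * int (Suc n) + dmin M))"
    have sV: "additive_subgroup (V (Suc n)) M" using gsub_subgroup[OF gV] .
    have D: "additive_subgroup ?D M" by (intro M.add_sets_subgroup sV tail_subgroup)
    have VS: "V (Suc n) = set_smult M J (P n)" unfolding V_def by simp
    show ?case unfolding power_smult_Suc
    proof (rule set_smult_least[OF D])
      fix f x assume f: "f \<in> I" and x: "x \<in> P n"
      have fc: "f \<in> carrier R" using f I_sub by blast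
      have xc: "x \<in> carrier M" using x P_carrier by blast
      have "f \<in> {a \<in> carrier R. a \<odot>\<^bsub>M\<^esub> x \<in> ?D}"
      proof (rule RG.mem_of_hpart[OF _ fc])
        show "additive_subgroup {a \<in> carrier R. a \<odot>\<^bsub>M\<^esub> x \<in> ?D} R"
          by (intro scalar_preimage_subgroup D xc)
        fix i
        let ?f = "RG.hp i f"
        have fi: "?f \<in> rcomp R i" "?f \<in> I" "?f \<in> carrier R"
          using RG.hpart_expansion(1)[OF fc] homogeneous_idealD(4)[OF I f] fc by auto
        have "?f \<odot>\<^bsub>M\<^esub> x \<in> ?D"
        proof (cases "int i \<le> r - 1")
          case True
          then have "?f \<in> J" using fi gJ unfolding gens_below_def by blast
          then have "?f \<odot>\<^bsub>M\<^esub> x \<in> V (Suc n)" unfolding VS using x by (intro set_smultI)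
          then show ?thesis using M.subset_add_sets(1)[OF sV tail_subgroup] by blast
        next
          case False
          obtain v w where vw: "v \<in> V n" "w \<in> tail (r * int n + dmin M)" "x = v \<oplus>\<^bsub>M\<^esub> w"
            using Suc x unfolding add_sets_def by blast
          have c: "v \<in> carrier M" "w \<in> carrier M"
            using vw gsub_carrier[OF gV] sub_carrier[OF tail_subgroup] by auto
          \<comment> \<open>A further factor from \<open>I\<close> keeps the first summand in
            \<open>V\<close>: multiplication by \<open>I\<close> commutes with that by
            \<open>J\<close> and raises the exponent in \<open>J P m\<close>.\<close>
          have "?f \<odot>\<^bsub>M\<^esub> v \<in> V (Suc n)"
          proof (cases n)
            case 0
            then show ?thesis using vw(1) fi sub_zero[OF sV] by (simp add: V_def)
          next
            case (Suc m)
            have "?f \<odot>\<^bsub>M\<^esub> v \<in> set_smult M I (set_smult M J (P m))"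
              using vw(1) fi Suc unfolding V_def by (intro set_smultI) auto
            then show ?thesis
              using smult_commute[OF Jc P_carrier] power_smult_Suc Suc unfolding V_def by simp
          qed
          moreover have "?f \<odot>\<^bsub>M\<^esub> w \<in> tail (r * int (Suc n) + dmin M)"
            by (rule smult_tail[OF fi(1) vw(2)]) (use False in \<open>simp add: algebra_simps\<close>)
          ultimately show ?thesis using vw(3) c fi by (simp add: smult_r_distr add_setsI)
        qed
        then show "?f \<in> {a \<in> carrier R. a \<odot>\<^bsub>M\<^esub> x \<in> ?D}" using fi by blast
      qed
      then show "f \<odot>\<^bsub>M\<^esub> x \<in> ?D" by blast
    qed
  qed
  from this[of "Suc n"] show ?thesis unfolding V_def by simp
qed

text \<open>Under the contrary assumption, an element of \<open>P (Suc n)\<close> of degree at most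
  \<open>D\<close> has no contribution from the tail in \<open>P_subset_tail\<close>, so it lies in
  \<open>J P n\<close> with \<open>J\<close> spanned by the elements of \<open>I\<close> of degree
  below \<open>rho\<close>. Nakayama's lemma extends this to all of \<open>P (Suc n)\<close>, and
  \<open>J\<close> is a reduction with \<open>D(J) < rho\<close>. The condition \<open>n > 0\<close>
  matches the positive exponent in \<open>is_reduction\<close>.\<close>

theorem Dmax_lower_bound:
  assumes n: "n > 0"
  shows "rho R I M * int (Suc n) + dmin M \<le> Dmax R (graded_submodule M (P (Suc n)))"
proof (rule ccontr)
  let ?r = "rho R I M" and ?N = "graded_submodule M (P (Suc n))"
  let ?J = "span_below I (?r - 1)"
  let ?V = "set_smult M ?J (P n)"
  assume "\<not> ?thesis"
  then have D: "Dmax R ?N < ?r * int (Suc n) + dmin M" by simp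
  have Jg: "homogeneous_ideal R ?J" and JI: "?J \<subseteq> I" using span_below[OF I] by auto
  interpret N: fg_graded_mod R ?N by (rule fg_graded_mod_sub[OF gsub_P])
  have [simp]: "carrier ?N = P (Suc n)" "zero ?N = \<zero>\<^bsub>M\<^esub>" unfolding graded_submodule_def by auto
  have nzN: "carrier ?N \<noteq> {\<zero>\<^bsub>?N\<^esub>}" using nonzero by simp
  have gV: "graded_sub R M ?V" by (rule gsub_ideal_smult[OF Jg gsub_P])
  have VP: "?V \<subseteq> P (Suc n)" unfolding power_smult_Suc using JI by (intro set_smult_mono) auto
  have gVN: "graded_sub R ?N ?V" using gsub_sub_iff[OF gsub_P] gV VP by blast
  have "P (Suc n) \<subseteq> ?V"
  proof -
    have "mcomp ?N a \<subseteq> ?V" if a: "a \<le> Dmax R ?N" for a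
    proof
      fix x assume "x \<in> mcomp ?N a"
      then have x: "x \<in> P (Suc n)" "x \<in> mcomp M a" unfolding graded_submodule_def by auto
      then obtain v w where vw: "v \<in> ?V" "w \<in> tail (?r * int (Suc n) + dmin M)" "x = v \<oplus>\<^bsub>M\<^esub> w"
        using P_subset_tail unfolding add_sets_def by blast
      have c: "v \<in> carrier M" "w \<in> carrier M"
        using vw gsub_carrier[OF gV] sub_carrier[OF tail_subgroup] by auto
      have "MG.hp a w = \<zero>\<^bsub>M\<^esub>" using vw(2) a D unfolding tail_def by auto
      then have "MG.hp a x = MG.hp a v" using vw(3) c by (simp add: MG.hpart_add)
      then show "x \<in> ?V" using MG.hpart_same[OF x(2)] gsub_hp[OF gV vw(1), of a] by simp
    qed
    then show ?thesis using N.generated_below_Dmax[OF nzN gVN] by simp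
  qed
  then have "?V = P (n + 1)" using VP by simp
  then have red: "is_reduction R M I ?J"
    unfolding is_reduction_def using n Jg JI graded_ideal_iff by blast
  have "Dmax R (ideal_module R ?J) \<le> ?r - 1"
    by (rule Dmax_span_below[OF I reduction_nonzero(2)[OF red]])
  then show False using rho_le[OF red] by simp
qed

end

end

section \<open>Modules of functions and the Koszul complex\<close>

text \<open>The direct sum of the shifted copies \<open>M(-d s)\<close> for \<open>s\<close> in
  \<open>T\<close>. Encoding its elements as functions that vanish outside \<open>T\<close> puts all
  chain modules of the Koszul complex into one ambient module on one type.\<close>

definition fun_module :: "('a, 'b) graded_module \<Rightarrow> 'i set \<Rightarrow> ('i \<Rightarrow> int) \<Rightarrow> ('a, 'i \<Rightarrow> 'b)
  graded_module" where
  "fun_module M T d =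
     \<lparr>carrier = {f. (\<forall>s. f s \<in> carrier M) \<and> (\<forall>s. s \<notin> T \<longrightarrow> f s = \<zero>\<^bsub>M\<^esub>)},
      monoid.mult = (\<lambda>_ _ _. \<zero>\<^bsub>M\<^esub>), one = (\<lambda>_. \<zero>\<^bsub>M\<^esub>), ring.zero = (\<lambda>_. \<zero>\<^bsub>M\<^esub>),
      add = (\<lambda>f g s. f s \<oplus>\<^bsub>M\<^esub> g s), smult = (\<lambda>r f s. r \<odot>\<^bsub>M\<^esub> f s),
      mcomp = (\<lambda>n. {f. (\<forall>s. f s \<in> mcomp M (n - d s)) \<and> (\<forall>s. s \<notin> T \<longrightarrow> f s = \<zero>\<^bsub>M\<^esub>)})\<rparr>"

text \<open>The direct sum of copies of \<open>N\<close> over the indices in \<open>T\<close>. The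
  index set may be smaller than that of the ambient module; the chains of a fixed homological degree
  are obtained in this way.\<close>

definition fun_sub :: "('a, 'b) graded_module \<Rightarrow> 'i set \<Rightarrow> 'b set \<Rightarrow> ('i \<Rightarrow> 'b) set" where
  "fun_sub M T N = {f. (\<forall>s \<in> T. f s \<in> N) \<and> (\<forall>s. s \<notin> T \<longrightarrow> f s = \<zero>\<^bsub>M\<^esub>)}"

lemma fun_module_simps [simp]:
  "carrier (fun_module M T d) = {f. (\<forall>s. f s \<in> carrier M) \<and> (\<forall>s. s \<notin> T \<longrightarrow> f s = \<zero>\<^bsub>M\<^esub>)}"
  "zero (fun_module M T d) = (\<lambda>_. \<zero>\<^bsub>M\<^esub>)"
  "add (fun_module M T d) = (\<lambda>f g s. f s \<oplus>\<^bsub>M\<^esub> g s)"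
  "smult (fun_module M T d) = (\<lambda>r f s. r \<odot>\<^bsub>M\<^esub> f s)"
  "mcomp (fun_module M T d) n = {f. (\<forall>s. f s \<in> mcomp M (n - d s)) \<and> (\<forall>s. s \<notin> T \<longrightarrow> f s = \<zero>\<^bsub>M\<^esub>)}"
  by (simp_all add: fun_module_def)

context graded_mod begin

lemma fun_module_abelian_group: "abelian_group (fun_module M T d)"
proof (rule abelian_groupI; simp)
  show "\<exists>g. (\<forall>s. g s \<in> carrier M) \<and> (\<forall>s. s \<notin> T \<longrightarrow> g s = \<zero>\<^bsub>M\<^esub>) \<and> (\<lambda>s. g s \<oplus>\<^bsub>M\<^esub> f s) = (\<lambda>_. \<zero>\<^bsub>M\<^esub>)"
    if "(\<forall>s. f s \<in> carrier M) \<and> (\<forall>s. s \<notin> T \<longrightarrow> f s = \<zero>\<^bsub>M\<^esub>)" for f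
    using that by (intro exI[of _ "\<lambda>s. \<ominus>\<^bsub>M\<^esub> f s"]) (auto simp: M.l_neg)
qed (auto intro!: ext M.a_assoc M.a_comm)

lemma fun_module_a_inv:
  assumes "f \<in> carrier (fun_module M T d)"
  shows "\<ominus>\<^bsub>fun_module M T d\<^esub> f = (\<lambda>s. \<ominus>\<^bsub>M\<^esub> f s)"
proof -
  interpret F: abelian_group "fun_module M T d" by (rule fun_module_abelian_group)
  show ?thesis
    by (rule F.minus_equality) (use assms in \<open>auto simp: M.l_neg\<close>)
qed

lemma fun_module_graded_mod:
  assumes T: "finite T"
  shows "graded_mod R (fun_module M T d)"
    and "f \<in> carrier (fun_module M T d) \<Longrightarrow>
      hpart (fun_module M T d) (mcomp (fun_module M T d)) n f = (\<lambda>s. MG.hp (n - d s) (f s))"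
proof -
  let ?F = "fun_module M T d"
  let ?p = "\<lambda>n f s. MG.hp (n - d s) (f s)"
  interpret F: abelian_group ?F by (rule fun_module_abelian_group)
  have C: "additive_subgroup (mcomp ?F n) ?F" for n
  proof (rule F.additive_subgroupI')
    show sub: "mcomp ?F n \<subseteq> carrier ?F" using MG.comp_carrier by auto
    show "\<ominus>\<^bsub>?F\<^esub> x \<in> mcomp ?F n" if "x \<in> mcomp ?F n" for x
      using that sub fun_module_a_inv[of x] sub_neg[OF MG.comp_subgroup] by auto
  qed (use MG.comp_zero sub_add[OF MG.comp_subgroup] in auto)
  have fin: "finite {n. ?p n f \<noteq> (\<lambda>_. \<zero>\<^bsub>M\<^esub>)}" if f: "f \<in> carrier ?F" for f
  proof (rule finite_subset)
    show "{n. ?p n f \<noteq> (\<lambda>_. \<zero>\<^bsub>M\<^esub>)} \<subseteq> (\<Union>s \<in> T. (\<lambda>m. m + d s) ` {m. MG.hp m (f s) \<noteq> \<zero>\<^bsub>M\<^esub>})"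
    proof
      fix n assume "n \<in> {n. ?p n f \<noteq> (\<lambda>_. \<zero>\<^bsub>M\<^esub>)}"
      then obtain s where s: "MG.hp (n - d s) (f s) \<noteq> \<zero>\<^bsub>M\<^esub>" by blast
      then have "s \<in> T" using f by (cases "s \<in> T") auto
      then show "n \<in> (\<Union>s \<in> T. (\<lambda>m. m + d s) ` {m. MG.hp m (f s) \<noteq> \<zero>\<^bsub>M\<^esub>})"
        using s by (auto intro!: bexI[of _ s] image_eqI[of _ _ "n - d s"])
    qed
    show "finite (\<Union>s \<in> T. (\<lambda>m. m + d s) ` {m. MG.hp m (f s) \<noteq> \<zero>\<^bsub>M\<^esub>})"
      using T f MG.hpart_expansion(2) by auto
  qed
  have inj: "f = (\<lambda>_. \<zero>\<^bsub>M\<^esub>)" if f: "f \<in> carrier ?F" and z: "\<And>n. ?p n f = (\<lambda>_. \<zero>\<^bsub>M\<^esub>)" for f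
  proof
    fix s
    have "MG.hp m (f s) = \<zero>\<^bsub>M\<^esub>" for m using fun_cong[OF z[of "m + d s"], of s] by simp
    then show "f s = \<zero>\<^bsub>M\<^esub>" using MG.hpart_eq_zero f by simp
  qed
  have add: "?p n (f \<oplus>\<^bsub>?F\<^esub> g) = ?p n f \<oplus>\<^bsub>?F\<^esub> ?p n g" if "f \<in> carrier ?F" "g \<in> carrier ?F" for n f g
    using that by (auto simp: MG.hpart_add)
  have same: "?p n f = f" if "f \<in> mcomp ?F n" for n f
    using that by (auto simp: MG.hpart_same)
  have other: "?p n f = (\<lambda>_. \<zero>\<^bsub>M\<^esub>)" if "f \<in> mcomp ?F m" "n \<noteq> m" for n m f
  proof
    fix s
    have "f s \<in> mcomp M (m - d s)" using that by simp
    then show "?p n f s = \<zero>\<^bsub>M\<^esub>" using that(2) MG.hpart_other by simp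
  qed
  have dd: "direct_decomposition ?F (mcomp ?F)"
  proof (rule F.direct_decompositionI[where p = ?p, OF C])
    show "?p n f \<in> mcomp ?F n" if "f \<in> carrier ?F" for n f
      using that MG.hpart_expansion(1) by auto
    show "f = \<zero>\<^bsub>?F\<^esub>" if "f \<in> carrier ?F" "\<And>n. ?p n f = \<zero>\<^bsub>?F\<^esub>" for f
      using inj[OF that(1)] that(2) by simp
  qed (use fin add same other in auto)
  have mod: "module R ?F"
    by (rule moduleI)
      (use fun_module_abelian_group in
        \<open>auto simp: R.is_cring smult_l_distr smult_r_distr smult_assoc1\<close>)
  show "graded_mod R ?F"
  proof (intro graded_mod.intro graded_mod_axioms.intro mod dd R.std_graded_axioms)
    fix r f i n assume r: "r \<in> rcomp R i" and f: "f \<in> mcomp ?F n"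
    have "r \<odot>\<^bsub>M\<^esub> f s \<in> mcomp M (int i + n - d s)" for s
      using mdeg[OF r, of "f s" "n - d s"] f by (simp add: add_diff_eq)
    then show "r \<odot>\<^bsub>?F\<^esub> f \<in> mcomp ?F (int i + n)" using f RG.comp_carrier[OF r] by simp
  qed
  interpret FG: graded_group ?F "mcomp ?F" using dd by unfold_locales
  show "FG.hp n f = ?p n f" if "f \<in> carrier ?F"
    by (rule FG.hpart_eqI[where p = ?p]) (use add same other that in auto)
qed

lemma fun_sub_gsub:
  assumes T: "finite T" and N: "graded_sub R M N" and S: "S \<subseteq> T"
  shows "graded_sub R (fun_module M T d) (fun_sub M S N)"
proof -
  let ?F = "fun_module M T d"
  interpret F: graded_mod R ?F by (rule fun_module_graded_mod(1)[OF T])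
  note sN = gsub_subgroup[OF N]
  have sub: "fun_sub M S N \<subseteq> carrier ?F"
    using S gsub_carrier[OF N] unfolding fun_sub_def by (fastforce simp: subset_iff)
  show ?thesis
  proof (rule F.gsubI)
    show "additive_subgroup (fun_sub M S N) ?F"
    proof (rule F.M.additive_subgroupI'[OF sub])
      show "\<ominus>\<^bsub>?F\<^esub> x \<in> fun_sub M S N" if "x \<in> fun_sub M S N" for x
        using that fun_module_a_inv[of x T d] sub sub_neg[OF sN]
        unfolding fun_sub_def by auto
    qed (use sub_zero[OF sN] sub_add[OF sN] in \<open>auto simp: fun_sub_def\<close>)
    show "a \<odot>\<^bsub>?F\<^esub> x \<in> fun_sub M S N" if "a \<in> carrier R" "x \<in> fun_sub M S N" for a x
      using that gsub_smult[OF N] unfolding fun_sub_def by auto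
    show "F.MG.hp n x \<in> fun_sub M S N" if "x \<in> fun_sub M S N" for n x
    proof -
      have "F.MG.hp n x = (\<lambda>s. MG.hp (n - d s) (x s))"
        by (rule fun_module_graded_mod(2)[OF T]) (use that sub in blast)
      then show ?thesis using that gsub_hp[OF N] unfolding fun_sub_def by auto
    qed
  qed
qed

lemma delta_hom_subgroup:
  assumes A: "additive_subgroup A (fun_module M T d)" and s: "s \<in> T"
  shows "additive_subgroup {x \<in> carrier M. (\<lambda>t. if t = s then x else \<zero>\<^bsub>M\<^esub>) \<in> A} M"
proof (rule M.additive_subgroupI')
  let ?F = "fun_module M T d" and ?\<delta> = "\<lambda>x t. if t = s then x else \<zero>\<^bsub>M\<^esub>"
  have c: "?\<delta> x \<in> carrier ?F" if "x \<in> carrier M" for x using that s by auto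
  have "?\<delta> (x \<oplus>\<^bsub>M\<^esub> y) = ?\<delta> x \<oplus>\<^bsub>?F\<^esub> ?\<delta> y" if "x \<in> carrier M" "y \<in> carrier M" for x y
    using that by auto
  then show "x \<oplus>\<^bsub>M\<^esub> y \<in> {x \<in> carrier M. ?\<delta> x \<in> A}"
    if "x \<in> {x \<in> carrier M. ?\<delta> x \<in> A}" "y \<in> {x \<in> carrier M. ?\<delta> x \<in> A}" for x y
    using that sub_add[OF A, of "?\<delta> x" "?\<delta> y"] by simp
  have mz: "\<ominus>\<^bsub>M\<^esub> \<zero>\<^bsub>M\<^esub> = \<zero>\<^bsub>M\<^esub>" by (rule M.minus_equality) auto
  have "?\<delta> (\<ominus>\<^bsub>M\<^esub> x) = \<ominus>\<^bsub>?F\<^esub> ?\<delta> x" if "x \<in> carrier M" for x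
    unfolding fun_module_a_inv[OF c[OF that]] by (simp add: fun_eq_iff mz)
  then show "\<ominus>\<^bsub>M\<^esub> x \<in> {x \<in> carrier M. ?\<delta> x \<in> A}" if "x \<in> {x \<in> carrier M. ?\<delta> x \<in> A}" for x
    using that sub_neg[OF A, of "?\<delta> x"] by simp
  show "\<zero>\<^bsub>M\<^esub> \<in> {x \<in> carrier M. ?\<delta> x \<in> A}" using sub_zero[OF A] by simp
qed auto

text \<open>Induction rule for direct sums: a function with finite support is a sum of functions
  supported at one point.\<close>

lemma fun_sub_induct:
  assumes A: "additive_subgroup A (fun_module M T d)" and T: "finite S" "S \<subseteq> T" and N:
    "additive_subgroup N M"
    and delta: "\<And>s x. s \<in> S \<Longrightarrow> x \<in> N \<Longrightarrow> (\<lambda>t. if t = s then x else \<zero>\<^bsub>M\<^esub>) \<in> A"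
  shows "fun_sub M S N \<subseteq> A"
  using T delta
proof (induction S)
  case empty
  then show ?case using sub_zero[OF A] unfolding fun_sub_def by (auto simp: fun_eq_iff[symmetric])
next
  case (insert s S)
  let ?F = "fun_module M T d"
  show ?case
  proof
    fix f assume f: "f \<in> fun_sub M (insert s S) N"
    have fN: "f t \<in> N" for t
      using f sub_zero[OF N] unfolding fun_sub_def by (cases "t \<in> insert s S") auto
    then have fc: "f t \<in> carrier M" for t using sub_carrier[OF N] by blast
    have "f(s := \<zero>\<^bsub>M\<^esub>) \<in> fun_sub M S N" using f insert(2) unfolding fun_sub_def by auto
    then have "f(s := \<zero>\<^bsub>M\<^esub>) \<in> A" using insert by auto
    moreover have "(\<lambda>t. if t = s then f s else \<zero>\<^bsub>M\<^esub>) \<in> A" using insert(5) fN by simp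
    ultimately have "(\<lambda>t. if t = s then f s else \<zero>\<^bsub>M\<^esub>) \<oplus>\<^bsub>?F\<^esub> f(s := \<zero>\<^bsub>M\<^esub>) \<in> A"
      using sub_add[OF A] by blast
    moreover have "(\<lambda>t. if t = s then f s else \<zero>\<^bsub>M\<^esub>) \<oplus>\<^bsub>?F\<^esub> f(s := \<zero>\<^bsub>M\<^esub>) = f" using fc by auto
    ultimately show "f \<in> A" by simp
  qed
qed

lemma carrier_fun_sub: "carrier (fun_module M T d) = fun_sub M T (carrier M)"
  unfolding fun_sub_def by auto

end

lemma (in fg_graded_mod) fun_module_fg:
  assumes T: "finite T"
  shows "fg_graded_mod R (fun_module M T d)"
proof -
  let ?F = "fun_module M T d" and ?\<delta> = "\<lambda>s x t. if t = s then x else \<zero>\<^bsub>M\<^esub>"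
  interpret F: graded_mod R ?F by (rule fun_module_graded_mod(1)[OF T])
  obtain B where B: "B \<subseteq> carrier M" "finite B" "carrier M = set_smult M (carrier R) B"
    using fg by blast
  let ?D = "(\<Union>s \<in> T. ?\<delta> s ` B)"
  have D: "?D \<subseteq> carrier ?F" using B(1) by auto
  let ?V = "set_smult ?F (carrier R) ?D"
  have V: "additive_subgroup ?V ?F" using F.set_smult_subgroup D by blast
  have "?\<delta> s x \<in> ?V" if s: "s \<in> T" and x: "x \<in> carrier M" for s x
  proof -
    have "set_smult M (carrier R) B \<subseteq> {x \<in> carrier M. ?\<delta> s x \<in> ?V}"
    proof (rule set_smult_least[OF delta_hom_subgroup[OF V s]])
      fix a b assume ab: "a \<in> carrier R" "b \<in> B"
      have "a \<odot>\<^bsub>?F\<^esub> ?\<delta> s b \<in> ?V" using ab s by (intro F.set_smultI) auto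
      moreover have "a \<odot>\<^bsub>?F\<^esub> ?\<delta> s b = ?\<delta> s (a \<odot>\<^bsub>M\<^esub> b)" using ab by auto
      ultimately show "a \<odot>\<^bsub>M\<^esub> b \<in> {x \<in> carrier M. ?\<delta> s x \<in> ?V}" using ab B(1) by auto
    qed
    then show ?thesis using x B(3) by blast
  qed
  then have "carrier ?F \<subseteq> ?V"
    unfolding carrier_fun_sub using gsub_subgroup[OF gsub_carrier_self]
    by (intro fun_sub_induct[OF V T]) auto
  moreover have "?V \<subseteq> carrier ?F" using sub_subset[OF V] .
  moreover have "finite ?D" using T B(2) by blast
  ultimately show ?thesis using D by unfold_locales blast
qed

section \<open>The Koszul complex of homogeneous elements on a graded module\<close>

definition pos_below :: "nat \<Rightarrow> nat set \<Rightarrow> nat" where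
  "pos_below j S = card {l \<in> S. l < j}"

lemma pos_below_insert:
  "finite S \<Longrightarrow> k \<notin> S \<Longrightarrow> pos_below j (insert k S) = pos_below j S + (if k < j then 1 else 0)"
proof -
  assume "finite S" "k \<notin> S"
  moreover have "{l \<in> insert k S. l < j} =
    (if k < j then insert k {l \<in> S. l < j} else {l \<in> S. l < j})" by auto
  ultimately show ?thesis unfolding pos_below_def by simp
qed

lemma pos_below_remove:
  assumes "finite S" "k \<in> S"
  shows "pos_below j S = pos_below j (S - {k}) + (if k < j then 1 else 0)"
  using pos_below_insert[of "S - {k}" k j] assms by (simp add: insert_absorb)

text \<open>
  A chain of degree \<open>i\<close> of the Koszul complex of \<open>y\<^sub>0, \<dots>, y\<^sub>v\<^sub>-\<^sub>1\<close> is a function on the subsets of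
  \<open>{..<v}\<close> supported on the subsets of size \<open>i\<close>. The differential is \<open>\<Sum>j. y\<^sub>j \<iota>\<^sub>j\<close>, where
  \<open>\<iota>\<^sub>j\<close> is the contraction with the \<open>j\<close>-th basis vector, and \<open>\<epsilon>\<^sub>j\<close> is exterior multiplication by it.
\<close>

locale koszul = fg_graded_mod R M for R :: "'a graded_ring" (structure) and M :: "('a, 'b)
  graded_module" (structure) +
  fixes v :: nat and y :: "nat \<Rightarrow> 'a" and dg :: "nat \<Rightarrow> nat"
  assumes y: "\<And>j. j < v \<Longrightarrow> y j \<in> rcomp R (dg j)"
begin

definition dS :: "nat set \<Rightarrow> int" where "dS S = int (\<Sum>j\<in>S. dg j)"

abbreviation F where "F \<equiv> fun_module M (Pow {..<v}) dS"

sublocale F: fg_graded_mod R F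
  by (rule fun_module_fg) simp

definition sg :: "nat \<Rightarrow> nat set \<Rightarrow> 'b \<Rightarrow> 'b" where
  "sg j S x = (if even (pos_below j S) then x else \<ominus>\<^bsub>M\<^esub> x)"

text \<open>Written on coefficients, contraction reads the function at the larger set: the
  coefficient at \<open>S\<close> comes from that at \<open>insert j S\<close>. The sign counts the
  elements of \<open>S\<close> that the \<open>j\<close>-th basis vector has to pass.\<close>

definition \<iota> :: "nat \<Rightarrow> (nat set \<Rightarrow> 'b) \<Rightarrow> nat set \<Rightarrow> 'b" where
  "\<iota> j f S = (if j \<in> S then \<zero>\<^bsub>M\<^esub> else sg j S (f (insert j S)))"

definition \<epsilon> :: "nat \<Rightarrow> (nat set \<Rightarrow> 'b) \<Rightarrow> nat set \<Rightarrow> 'b" where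
  "\<epsilon> j f S = (if j \<in> S then sg j (S - {j}) (f (S - {j})) else \<zero>\<^bsub>M\<^esub>)"

text \<open>The partial sum over \<open>j < k\<close>, so that identities for the differential
  \<open>bd v\<close> are proved by induction on \<open>k\<close>.\<close>

fun bd :: "nat \<Rightarrow> (nat set \<Rightarrow> 'b) \<Rightarrow> nat set \<Rightarrow> 'b" where
  "bd 0 f = \<zero>\<^bsub>F\<^esub>"
| "bd (Suc k) f = bd k f \<oplus>\<^bsub>F\<^esub> y k \<odot>\<^bsub>F\<^esub> \<iota> k f"

lemma M_minus_zero [simp]: "\<ominus>\<^bsub>M\<^esub> \<zero>\<^bsub>M\<^esub> = \<zero>\<^bsub>M\<^esub>"
  by (rule M.minus_equality) auto

lemma sg_closed [simp]: "x \<in> carrier M \<Longrightarrow> sg j S x \<in> carrier M"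
  and sg_zero [simp]: "sg j S \<zero>\<^bsub>M\<^esub> = \<zero>\<^bsub>M\<^esub>"
  and sg_add: "x \<in> carrier M \<Longrightarrow> z \<in> carrier M \<Longrightarrow> sg j S (x \<oplus>\<^bsub>M\<^esub> z) = sg j S x \<oplus>\<^bsub>M\<^esub> sg j S z"
  and sg_smult: "x \<in> carrier M \<Longrightarrow> r \<in> carrier R \<Longrightarrow> sg j S (r \<odot>\<^bsub>M\<^esub> x) = r \<odot>\<^bsub>M\<^esub> sg j S x"
  and sg_mem: "additive_subgroup N M \<Longrightarrow> x \<in> N \<Longrightarrow> sg j S x \<in> N"
  unfolding sg_def by (auto simp: M.minus_add smult_r_minus sub_neg)

lemma y_carrier: "j < v \<Longrightarrow> y j \<in> carrier R"
  using y RG.comp_carrier by blast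

lemma F_mem: "f \<in> carrier F \<longleftrightarrow> (\<forall>s. f s \<in> carrier M) \<and> (\<forall>s. \<not> s \<subseteq> {..<v} \<longrightarrow> f s = \<zero>\<^bsub>M\<^esub>)"
  by auto

lemma \<iota>_closed: "j < v \<Longrightarrow> f \<in> carrier F \<Longrightarrow> \<iota> j f \<in> carrier F"
  unfolding F_mem \<iota>_def by auto

lemma \<epsilon>_closed:
  assumes "j < v" "f \<in> carrier F"
  shows "\<epsilon> j f \<in> carrier F"
proof -
  have "\<not> S - {j} \<subseteq> {..<v}" if "\<not> S \<subseteq> {..<v}" for S using that assms(1) by auto
  then show ?thesis using assms(2) unfolding F_mem \<epsilon>_def by auto
qed

lemma \<iota>_add: "f \<in> carrier F \<Longrightarrow> g \<in> carrier F \<Longrightarrow> \<iota> j (f \<oplus>\<^bsub>F\<^esub> g) = \<iota> j f \<oplus>\<^bsub>F\<^esub> \<iota> j g"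
  and \<iota>_smult: "f \<in> carrier F \<Longrightarrow> r \<in> carrier R \<Longrightarrow> \<iota> j (r \<odot>\<^bsub>F\<^esub> f) = r \<odot>\<^bsub>F\<^esub> \<iota> j f"
  and \<epsilon>_add: "f \<in> carrier F \<Longrightarrow> g \<in> carrier F \<Longrightarrow> \<epsilon> j (f \<oplus>\<^bsub>F\<^esub> g) = \<epsilon> j f \<oplus>\<^bsub>F\<^esub> \<epsilon> j g"
  and \<epsilon>_smult: "f \<in> carrier F \<Longrightarrow> r \<in> carrier R \<Longrightarrow> \<epsilon> j (r \<odot>\<^bsub>F\<^esub> f) = r \<odot>\<^bsub>F\<^esub> \<epsilon> j f"
  unfolding F_mem \<iota>_def \<epsilon>_def by (auto simp: sg_add sg_smult)

lemma \<iota>_\<iota>: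
  assumes f: "f \<in> carrier F" and jk: "j < v" "k < v"
  shows "\<iota> j (\<iota> k f) \<oplus>\<^bsub>F\<^esub> \<iota> k (\<iota> j f) = \<zero>\<^bsub>F\<^esub>"
proof
  fix S
  have fc: "f s \<in> carrier M" and fz: "\<not> s \<subseteq> {..<v} \<Longrightarrow> f s = \<zero>\<^bsub>M\<^esub>" for s using f by simp_all
  show "(\<iota> j (\<iota> k f) \<oplus>\<^bsub>F\<^esub> \<iota> k (\<iota> j f)) S = \<zero>\<^bsub>F\<^esub> S"
  proof (cases "S \<subseteq> {..<v} \<and> j \<notin> S \<and> k \<notin> S \<and> j \<noteq> k")
    case True
    then have "finite S" using finite_subset by blast
    then show ?thesis
      using True fc[of "insert j (insert k S)"]
      by (auto simp: \<iota>_def sg_def pos_below_insert insert_commute[of j k] M.l_neg M.r_neg)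
  next
    case False
    show ?thesis
    proof (cases "S \<subseteq> {..<v}")
      case True
      with False show ?thesis by (auto simp: \<iota>_def)
    next
      case nS: False
      have "f (insert j (insert k S)) = \<zero>\<^bsub>M\<^esub>" "f (insert k (insert j S)) = \<zero>\<^bsub>M\<^esub>"
        by (rule fz, use nS in simp)+
      then show ?thesis by (simp add: \<iota>_def)
    qed
  qed
qed

lemma \<iota>_\<iota>_same: "\<iota> j (\<iota> j f) = \<zero>\<^bsub>F\<^esub>"
  by (auto simp: \<iota>_def)

text \<open>The anticommutation relation of contraction and exterior multiplication. For
  \<open>j \<noteq> k\<close> exactly one of the two counts in \<open>pos_below\<close> changes when
  the other index is inserted or removed, so the two terms have opposite signs.\<close>

lemma \<iota>_\<epsilon>:
  assumes f: "f \<in> carrier F" and jk: "j < v" "k < v"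
  shows "\<iota> j (\<epsilon> k f) \<oplus>\<^bsub>F\<^esub> \<epsilon> k (\<iota> j f) = (if j = k then f else \<zero>\<^bsub>F\<^esub>)"
proof
  fix S
  have fc: "f s \<in> carrier M" and fz: "\<not> s \<subseteq> {..<v} \<Longrightarrow> f s = \<zero>\<^bsub>M\<^esub>" for s using f by simp_all
  show "(\<iota> j (\<epsilon> k f) \<oplus>\<^bsub>F\<^esub> \<epsilon> k (\<iota> j f)) S = (if j = k then f else \<zero>\<^bsub>F\<^esub>) S"
  proof (cases "S \<subseteq> {..<v}")
    case True
    then have fin: "finite S" using finite_subset by blast
    show ?thesis
    proof (cases "j = k")
      case True
      then show ?thesis
        using fc[of S] by (auto simp: \<iota>_def \<epsilon>_def sg_def insert_absorb)
    next
      case False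
      show ?thesis
      proof (cases "k \<in> S \<and> j \<notin> S")
        case True
        have *: "insert j S - {k} = insert j (S - {k})" using True False by auto
        have "pos_below k (insert j (S - {k})) = pos_below k (S - {k}) + (if j < k then 1 else 0)"
          using fin True by (intro pos_below_insert) auto
        then show ?thesis
          using True False fc[of "insert j (S - {k})"] pos_below_remove[OF fin, of k j]
          by (auto simp: \<iota>_def \<epsilon>_def sg_def * M.l_neg M.r_neg)
      qed (use False in \<open>auto simp: \<iota>_def \<epsilon>_def\<close>)
    qed
  next
    case False
    have "\<not> insert j S - {k} \<subseteq> {..<v}" "\<not> insert j (S - {k}) \<subseteq> {..<v}" using False jk by auto
    then have "f S = \<zero>\<^bsub>M\<^esub>" "f (insert j S - {k}) = \<zero>\<^bsub>M\<^esub>" "f (insert j (S - {k})) = \<zero>\<^bsub>M\<^esub>"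
      using False by (simp_all add: fz)
    then show ?thesis by (auto simp: \<iota>_def \<epsilon>_def)
  qed
qed

lemma bd_closed: "k \<le> v \<Longrightarrow> f \<in> carrier F \<Longrightarrow> bd k f \<in> carrier F"
proof (induction k)
  case (Suc k)
  then show ?case using F.smult_closed[OF y_carrier \<iota>_closed, of k k f] F.M.a_closed[of "bd k f"]
    by (simp only: bd.simps)
qed (use F.M.zero_closed in \<open>simp only: bd.simps\<close>)

lemmas F_ops [simp del] = fun_module_simps

lemma F_add4:
  "a \<in> carrier F \<Longrightarrow> b \<in> carrier F \<Longrightarrow> c \<in> carrier F \<Longrightarrow> e \<in> carrier F \<Longrightarrow>
    (a \<oplus>\<^bsub>F\<^esub> b) \<oplus>\<^bsub>F\<^esub> (c \<oplus>\<^bsub>F\<^esub> e) = (a \<oplus>\<^bsub>F\<^esub> c) \<oplus>\<^bsub>F\<^esub> (b \<oplus>\<^bsub>F\<^esub> e)"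
  by (simp add: F.M.a_ac)

lemma bd_add:
  "k \<le> v \<Longrightarrow> f \<in> carrier F \<Longrightarrow> g \<in> carrier F \<Longrightarrow> bd k (f \<oplus>\<^bsub>F\<^esub> g) = bd k f \<oplus>\<^bsub>F\<^esub> bd k g"
proof (induction k)
  case (Suc k)
  note [simp] = bd_closed \<iota>_closed y_carrier
  show ?case using Suc by (simp add: \<iota>_add F.smult_r_distr F_add4)
qed simp

lemma bd_smult:
  "k \<le> v \<Longrightarrow> f \<in> carrier F \<Longrightarrow> r \<in> carrier R \<Longrightarrow> bd k (r \<odot>\<^bsub>F\<^esub> f) = r \<odot>\<^bsub>F\<^esub> bd k f"
proof (induction k)
  case (Suc k)
  note [simp] = bd_closed \<iota>_closed y_carrier
  show ?case using Suc by (simp add: \<iota>_smult F.smult_r_distr F.smult_smult_comm)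
qed simp

lemma F_zero_op:
  assumes add: "\<And>f g. f \<in> carrier F \<Longrightarrow> g \<in> carrier F \<Longrightarrow> h (f \<oplus>\<^bsub>F\<^esub> g) = h f \<oplus>\<^bsub>F\<^esub> h g"
    and c: "\<And>f. f \<in> carrier F \<Longrightarrow> h f \<in> carrier F"
  shows "h \<zero>\<^bsub>F\<^esub> = \<zero>\<^bsub>F\<^esub>"
proof -
  have "h \<zero>\<^bsub>F\<^esub> \<oplus>\<^bsub>F\<^esub> h \<zero>\<^bsub>F\<^esub> = h \<zero>\<^bsub>F\<^esub>" using add[of "\<zero>\<^bsub>F\<^esub>" "\<zero>\<^bsub>F\<^esub>"] by simp
  then show ?thesis using c[of "\<zero>\<^bsub>F\<^esub>"] by simp
qed

lemma \<iota>_zero: "j < v \<Longrightarrow> \<iota> j \<zero>\<^bsub>F\<^esub> = \<zero>\<^bsub>F\<^esub>"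
  by (rule F_zero_op[OF \<iota>_add \<iota>_closed])

lemma \<epsilon>_zero: "j < v \<Longrightarrow> \<epsilon> j \<zero>\<^bsub>F\<^esub> = \<zero>\<^bsub>F\<^esub>"
  by (rule F_zero_op[OF \<epsilon>_add \<epsilon>_closed])

lemma bd_zero: "k \<le> v \<Longrightarrow> bd k \<zero>\<^bsub>F\<^esub> = \<zero>\<^bsub>F\<^esub>"
  by (rule F_zero_op[OF bd_add bd_closed])

lemma bd_\<iota>:
  "k \<le> v \<Longrightarrow> j < v \<Longrightarrow> f \<in> carrier F \<Longrightarrow> bd k (\<iota> j f) \<oplus>\<^bsub>F\<^esub> \<iota> j (bd k f) = \<zero>\<^bsub>F\<^esub>"
proof (induction k)
  case 0
  then show ?case by (simp add: \<iota>_zero)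
next
  case (Suc k)
  note [simp] = bd_closed \<iota>_closed y_carrier
  have kv: "k < v" "k \<le> v" using Suc by auto
  have "bd (Suc k) (\<iota> j f) \<oplus>\<^bsub>F\<^esub> \<iota> j (bd (Suc k) f) =
      (bd k (\<iota> j f) \<oplus>\<^bsub>F\<^esub> \<iota> j (bd k f)) \<oplus>\<^bsub>F\<^esub> y k \<odot>\<^bsub>F\<^esub> (\<iota> k (\<iota> j f) \<oplus>\<^bsub>F\<^esub> \<iota> j (\<iota> k f))"
    using Suc.prems kv by (simp add: \<iota>_add \<iota>_smult F.smult_r_distr F_add4)
  then show ?case using Suc kv \<iota>_\<iota>[of f k j] by simp
qed

text \<open>Expanding the square of \<open>bd (Suc k)\<close> leaves the square of
  \<open>bd k\<close>, the anticommutator of \<open>bd k\<close> with \<open>\<iota> k\<close>, and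
  the square of \<open>\<iota> k\<close>; each of them vanishes.\<close>

lemma bd_bd: "k \<le> v \<Longrightarrow> f \<in> carrier F \<Longrightarrow> bd k (bd k f) = \<zero>\<^bsub>F\<^esub>"
proof (induction k)
  case (Suc k)
  note [simp] = bd_closed \<iota>_closed y_carrier
  have kv: "k < v" "k \<le> v" using Suc by auto
  have "bd (Suc k) (bd (Suc k) f) = bd k (bd k f) \<oplus>\<^bsub>F\<^esub>
      (y k \<odot>\<^bsub>F\<^esub> (bd k (\<iota> k f) \<oplus>\<^bsub>F\<^esub> \<iota> k (bd k f)) \<oplus>\<^bsub>F\<^esub> y k \<odot>\<^bsub>F\<^esub> (y k \<odot>\<^bsub>F\<^esub> \<iota> k (\<iota> k f)))"
    (is "_ = _ \<oplus>\<^bsub>F\<^esub> (?c \<oplus>\<^bsub>F\<^esub> ?e)")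
  proof -
    let ?g = "bd k f" and ?h = "\<iota> k f"
    have c: "f \<in> carrier F" "?g \<in> carrier F" "?h \<in> carrier F" "y k \<in> carrier R"
      using Suc.prems kv by simp_all
    have "bd (Suc k) (bd (Suc k) f) = (bd k ?g \<oplus>\<^bsub>F\<^esub> y k \<odot>\<^bsub>F\<^esub> bd k ?h) \<oplus>\<^bsub>F\<^esub>
        (y k \<odot>\<^bsub>F\<^esub> \<iota> k ?g \<oplus>\<^bsub>F\<^esub> y k \<odot>\<^bsub>F\<^esub> (y k \<odot>\<^bsub>F\<^esub> \<iota> k ?h))"
      using c kv by (simp add: \<iota>_add \<iota>_smult bd_add bd_smult F.smult_r_distr)
    then show ?thesis using c kv by (simp add: F.M.a_assoc F.smult_r_distr)
  qed
  then show ?case using Suc kv bd_\<iota>[of k k f] \<iota>_\<iota>_same[of k f] by simp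
qed simp

text \<open>Exterior multiplication by the \<open>j\<close>-th basis vector is a homotopy from
  multiplication by \<open>y j\<close> to zero, which is why \<open>y j\<close> kills homology. Only
  the summand of the differential with index \<open>j\<close> contributes.\<close>

lemma bd_\<epsilon>:
  "k \<le> v \<Longrightarrow> j < v \<Longrightarrow> f \<in> carrier F \<Longrightarrow>
     bd k (\<epsilon> j f) \<oplus>\<^bsub>F\<^esub> \<epsilon> j (bd k f) = (if j < k then y j \<odot>\<^bsub>F\<^esub> f else \<zero>\<^bsub>F\<^esub>)"
proof (induction k)
  case 0
  then show ?case by (simp add: \<epsilon>_zero)
next
  case (Suc k)
  note [simp] = bd_closed \<iota>_closed \<epsilon>_closed y_carrier
  have kv: "k < v" "k \<le> v" using Suc by auto
  have "bd (Suc k) (\<epsilon> j f) \<oplus>\<^bsub>F\<^esub> \<epsilon> j (bd (Suc k) f) =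
      (bd k (\<epsilon> j f) \<oplus>\<^bsub>F\<^esub> \<epsilon> j (bd k f)) \<oplus>\<^bsub>F\<^esub> y k \<odot>\<^bsub>F\<^esub> (\<iota> k (\<epsilon> j f) \<oplus>\<^bsub>F\<^esub> \<epsilon> j (\<iota> k f))"
    using Suc.prems kv by (simp add: \<epsilon>_add \<epsilon>_smult F.smult_r_distr F_add4)
  then show ?case using Suc kv \<iota>_\<epsilon>[of f k j] by (auto simp: less_Suc_eq)
qed

end

section \<open>Additive and graded homomorphisms, and their kernels\<close>

lemma graded_submodule_simps [simp]:
  "carrier (graded_submodule M U) = U" "add (graded_submodule M U) = add M"
  "zero (graded_submodule M U) = zero M" "smult (graded_submodule M U) = smult M"
  "mcomp (graded_submodule M U) n = U \<inter> mcomp M n"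
  unfolding graded_submodule_def by simp_all

lemma additive_hom_preimage:
  assumes "abelian_group M" "abelian_group N"
    and h: "h \<in> carrier M \<rightarrow> carrier N"
    and add: "\<And>x y. x \<in> carrier M \<Longrightarrow> y \<in> carrier M \<Longrightarrow> h (x \<oplus>\<^bsub>M\<^esub> y) = h x \<oplus>\<^bsub>N\<^esub> h y"
  shows "h \<zero>\<^bsub>M\<^esub> = \<zero>\<^bsub>N\<^esub>" "x \<in> carrier M \<Longrightarrow> h (\<ominus>\<^bsub>M\<^esub> x) = \<ominus>\<^bsub>N\<^esub> h x"
    and "additive_subgroup A N \<Longrightarrow> additive_subgroup {x \<in> carrier M. h x \<in> A} M"
    and "additive_subgroup B M \<Longrightarrow> additive_subgroup (h ` B) N"
proof -
  interpret M: abelian_group M by fact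
  interpret N: abelian_group N by fact
  have c: "h x \<in> carrier N" if "x \<in> carrier M" for x using h that by blast
  have "h \<zero>\<^bsub>M\<^esub> \<oplus>\<^bsub>N\<^esub> h \<zero>\<^bsub>M\<^esub> = h \<zero>\<^bsub>M\<^esub>" using add[of "\<zero>\<^bsub>M\<^esub>" "\<zero>\<^bsub>M\<^esub>"] by simp
  then show z: "h \<zero>\<^bsub>M\<^esub> = \<zero>\<^bsub>N\<^esub>" using c[of "\<zero>\<^bsub>M\<^esub>"] by simp
  show m: "h (\<ominus>\<^bsub>M\<^esub> x) = \<ominus>\<^bsub>N\<^esub> h x" if "x \<in> carrier M" for x
    using add[of "\<ominus>\<^bsub>M\<^esub> x" x] that z c N.minus_equality[of "h (\<ominus>\<^bsub>M\<^esub> x)" "h x"] by (simp add: M.l_neg)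
  show "additive_subgroup {x \<in> carrier M. h x \<in> A} M" if A: "additive_subgroup A N"
    using sub_add[OF A] sub_zero[OF A] sub_neg[OF A]
    by (intro M.additive_subgroupI') (auto simp: add z m)
  show "additive_subgroup (h ` B) N" if B: "additive_subgroup B M"
  proof (rule N.additive_subgroupI')
    note Bc = sub_carrier[OF B]
    show "h ` B \<subseteq> carrier N" using c Bc by blast
    show "\<zero>\<^bsub>N\<^esub> \<in> h ` B" using z sub_zero[OF B] by (intro image_eqI[of _ _ "\<zero>\<^bsub>M\<^esub>"]) auto
    show "x \<oplus>\<^bsub>N\<^esub> y \<in> h ` B" if "x \<in> h ` B" "y \<in> h ` B" for x y
      using that add Bc sub_add[OF B] by (auto simp flip: add)
    show "\<ominus>\<^bsub>N\<^esub> x \<in> h ` B" if "x \<in> h ` B" for x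
      using that Bc sub_neg[OF B] by (auto simp flip: m)
  qed
qed

lemma graded_hom_hpart:
  assumes "graded_mod R M" "graded_mod R N" and h: "graded_hom R M N h" and x: "x \<in> carrier M"
  shows "h (hpart M (mcomp M) n x) = hpart N (mcomp N) n (h x)"
proof -
  interpret M: graded_mod R M by fact
  interpret N: graded_mod R N by fact
  have hc: "h \<in> carrier M \<rightarrow> carrier N"
    and add: "\<And>x y. x \<in> carrier M \<Longrightarrow> y \<in> carrier M \<Longrightarrow> h (x \<oplus>\<^bsub>M\<^esub> y) = h x \<oplus>\<^bsub>N\<^esub> h y"
    and deg: "\<And>n. h ` mcomp M n \<subseteq> mcomp N n"
    using h unfolding graded_hom_def by auto
  note hom = additive_hom_preimage[OF M.M.abelian_group_axioms N.M.abelian_group_axioms hc add]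
  let ?A = "{x \<in> carrier M. h (M.MG.hp n x) = N.MG.hp n (h x)}"
  have c: "h x \<in> carrier N" if "x \<in> carrier M" for x using hc that by blast
  have "carrier M \<subseteq> ?A"
  proof (rule M.MG.carrier_subset_of_comp)
    show "additive_subgroup ?A M"
      by (rule M.M.additive_subgroupI')
        (auto simp: hom(1,2) add c M.MG.hpart_add N.MG.hpart_add M.MG.hpart_minus N.MG.hpart_minus)
    show "mcomp M i \<subseteq> ?A" for i
    proof
      fix x assume x: "x \<in> mcomp M i"
      then have "h x \<in> mcomp N i" using deg by blast
      then show "x \<in> ?A" using x M.MG.comp_carrier[OF x]
        by (cases "n = i") (auto simp: M.MG.hpart_same N.MG.hpart_same M.MG.hpart_other
          N.MG.hpart_other hom(1))
    qed
  qed
  then show ?thesis using x by blast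
qed

lemma (in graded_mod) gsub_Int:
  assumes U: "graded_sub R M U" and V: "graded_sub R M V"
  shows "graded_sub R M (U \<inter> V)"
proof (rule gsubI)
  note [simp] = sub_zero[OF gsub_subgroup] sub_add[OF gsub_subgroup]
    sub_neg[OF gsub_subgroup]
  show "additive_subgroup (U \<inter> V) M"
    using U V gsub_carrier[OF U] by (intro M.additive_subgroupI') auto
qed (use gsub_smult[OF U] gsub_smult[OF V] gsub_hp[OF U] gsub_hp[OF V] in auto)

lemma (in graded_mod) gsub_kernel:
  assumes "graded_mod R N" and h: "graded_hom R M N h" and U: "graded_sub R M U"
  shows "graded_sub R M {x \<in> U. h x = \<zero>\<^bsub>N\<^esub>}"
proof (rule gsubI)
  interpret N: graded_mod R N by fact
  have hc: "h \<in> carrier M \<rightarrow> carrier N"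
    and add: "\<And>x y. x \<in> carrier M \<Longrightarrow> y \<in> carrier M \<Longrightarrow> h (x \<oplus>\<^bsub>M\<^esub> y) = h x \<oplus>\<^bsub>N\<^esub> h y"
    and sm: "\<And>a x. a \<in> carrier R \<Longrightarrow> x \<in> carrier M \<Longrightarrow> h (a \<odot>\<^bsub>M\<^esub> x) = a \<odot>\<^bsub>N\<^esub> h x"
    using h unfolding graded_hom_def by auto
  note hom = additive_hom_preimage[OF M.abelian_group_axioms N.M.abelian_group_axioms hc add]
  note sU = gsub_subgroup[OF U]
  note [simp] = gsub_carrier[OF U]
  show "additive_subgroup {x \<in> U. h x = \<zero>\<^bsub>N\<^esub>} M"
    using sub_zero[OF sU] sub_add[OF sU] sub_neg[OF sU]
    by (intro M.additive_subgroupI') (auto simp: hom(1,2) add)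
  show "a \<odot>\<^bsub>M\<^esub> x \<in> {x \<in> U. h x = \<zero>\<^bsub>N\<^esub>}" if "a \<in> carrier R" "x \<in> {x \<in> U. h x = \<zero>\<^bsub>N\<^esub>}" for a x
    using that gsub_smult[OF U] sm by simp
  show "MG.hp n x \<in> {x \<in> U. h x = \<zero>\<^bsub>N\<^esub>}" if "x \<in> {x \<in> U. h x = \<zero>\<^bsub>N\<^esub>}" for n x
    using that gsub_hp[OF U] graded_hom_hpart[OF graded_mod_axioms assms(1) h, of x n] by simp
qed

text \<open>These three properties are all that exactness requires of the submodules
  \<open>I^n M\<close>; the last one expresses that the \<open>y j\<close> generate a
  reduction.\<close>

locale koszul_filtration = koszul +
  fixes P :: "nat \<Rightarrow> 'b set" and n0 :: nat
  assumes gP: "graded_sub R M (P n)"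
    and yP: "j < v \<Longrightarrow> x \<in> P n \<Longrightarrow> y j \<odot>\<^bsub>M\<^esub> x \<in> P (Suc n)"
    and gen: "n \<ge> n0 \<Longrightarrow> P (Suc n) \<subseteq> lsum M (map y [0..<v]) (P n)"
begin

definition T :: "nat \<Rightarrow> nat set set" where "T i = {S. S \<subseteq> {..<v} \<and> card S = i}"

text \<open>The differential lowers \<open>i\<close> and raises \<open>n\<close>, so
  \<open>i + n\<close> is constant along the complex: the complex that ends in \<open>P m\<close>
  consists of the modules \<open>Kc i (m - i)\<close>.\<close>

definition Kc :: "nat \<Rightarrow> nat \<Rightarrow> (nat set \<Rightarrow> 'b) set" where "Kc i n = fun_sub M (T i) (P n)"

definition Z :: "nat \<Rightarrow> nat \<Rightarrow> (nat set \<Rightarrow> 'b) set" where "Z i n = {f \<in> Kc i n. bd v f = \<zero>\<^bsub>F\<^esub>}"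

lemma T_sub: "T i \<subseteq> Pow {..<v}" "finite (T i)"
  unfolding T_def by auto

lemma Kc_gsub: "graded_sub R F (Kc i n)"
  unfolding Kc_def using T_sub gP by (intro fun_sub_gsub) auto

lemma Kc_F: "f \<in> Kc i n \<Longrightarrow> f \<in> carrier F"
  using F.gsub_carrier[OF Kc_gsub] .

lemma insert_T: "j < v \<Longrightarrow> j \<notin> S \<Longrightarrow> insert j S \<in> T (Suc i) \<longleftrightarrow> S \<in> T i"
proof -
  assume j: "j < v" "j \<notin> S"
  have "card (insert j S) = Suc (card S)" if "S \<subseteq> {..<v}"
    using j that finite_subset[of S] by (intro card_insert_disjoint) auto
  then show ?thesis using j unfolding T_def by auto
qed

lemma \<iota>_Kc:
  assumes j: "j < v" and f: "f \<in> Kc (Suc i) n"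
  shows "\<iota> j f \<in> Kc i n"
  using f insert_T[OF j, of _ i] gP[of n, THEN gsub_subgroup]
  unfolding Kc_def fun_sub_def by (auto simp: \<iota>_def sg_mem sub_zero)

lemma \<iota>_Kc_0:
  assumes j: "j < v" and f: "f \<in> Kc 0 n"
  shows "\<iota> j f = \<zero>\<^bsub>F\<^esub>"
proof
  fix S
  have "insert j S \<notin> T 0" unfolding T_def by (auto simp: card_eq_0_iff dest: finite_subset)
  then show "\<iota> j f S = \<zero>\<^bsub>F\<^esub> S"
    using f unfolding Kc_def fun_sub_def \<iota>_def by (simp add: fun_module_simps)
qed

lemma \<epsilon>_Kc:
  assumes j: "j < v" and f: "f \<in> Kc i n"
  shows "\<epsilon> j f \<in> Kc (Suc i) n"
proof -
  have "S - {j} \<in> T i \<longleftrightarrow> S \<in> T (Suc i)" if "j \<in> S" for S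
    using insert_T[OF j, of "S - {j}" i] that by (simp add: insert_absorb)
  then show ?thesis
    using f gP[of n, THEN gsub_subgroup]
    unfolding Kc_def fun_sub_def by (auto simp: \<epsilon>_def sg_mem sub_zero)
qed

lemma y_Kc: "j < v \<Longrightarrow> f \<in> Kc i n \<Longrightarrow> y j \<odot>\<^bsub>F\<^esub> f \<in> Kc i (Suc n)"
  using yP y_carrier unfolding Kc_def fun_sub_def by (auto simp: fun_module_simps)

lemma bd_Kc: "k \<le> v \<Longrightarrow> f \<in> Kc (Suc i) n \<Longrightarrow> bd k f \<in> Kc i (Suc n)"
proof (induction k)
  case 0
  then show ?case using sub_zero[OF F.gsub_subgroup[OF Kc_gsub]] by simp
next
  case (Suc k)
  then show ?case
    using sub_add[OF F.gsub_subgroup[OF Kc_gsub]] y_Kc[OF _ \<iota>_Kc, of k k f i n] by simp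
qed

lemma bd_Kc_0: "k \<le> v \<Longrightarrow> f \<in> Kc 0 n \<Longrightarrow> bd k f = \<zero>\<^bsub>F\<^esub>"
  by (induction k) (use \<iota>_Kc_0 y_carrier in auto)

text \<open>The shifts \<open>dS\<close> are made for this. The value at \<open>S\<close> comes from
  \<open>insert k S\<close>, whose shift is larger by \<open>dg k\<close>, and multiplication by
  \<open>y k\<close> makes up for the difference.\<close>

lemma bd_hom: "graded_hom R F F (bd v)"
proof -
  have "bd k f \<in> mcomp F a" if "k \<le> v" "f \<in> mcomp F a" for k f a
    using that
  proof (induction k)
    case 0
    then show ?case using F.MG.comp_zero by simp
  next
    case (Suc k)
    have k: "k < v" using Suc by simp
    have f: "\<And>S. f S \<in> mcomp M (a - dS S)" "\<And>S. \<not> S \<subseteq> {..<v} \<Longrightarrow> f S = \<zero>\<^bsub>M\<^esub>"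
      using Suc.prems(2) by (auto simp: fun_module_simps)
    have "y k \<odot>\<^bsub>M\<^esub> \<iota> k f S \<in> mcomp M (a - dS S) \<and> (\<not> S \<subseteq> {..<v} \<longrightarrow> \<iota> k f S = \<zero>\<^bsub>M\<^esub>)" for S
    proof (cases "S \<subseteq> {..<v} \<and> k \<notin> S")
      case True
      then have "dS (insert k S) = dS S + int (dg k)"
        using finite_subset[of S] unfolding dS_def by auto
      moreover have "sg k S (f (insert k S)) \<in> mcomp M (a - dS (insert k S))"
        using f(1) MG.comp_subgroup by (rule sg_mem[rotated])
      ultimately show ?thesis using mdeg[OF y[OF k], of "\<iota> k f S" "a - dS (insert k S)"] True
        by (simp add: \<iota>_def)
    next
      case False
      have "\<iota> k f S = \<zero>\<^bsub>M\<^esub>"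
      proof (cases "k \<in> S")
        case False
        with \<open>\<not> (S \<subseteq> {..<v} \<and> k \<notin> S)\<close> have "\<not> insert k S \<subseteq> {..<v}" by simp
        then show ?thesis using f(2) False by (simp add: \<iota>_def)
      qed (simp add: \<iota>_def)
      then show ?thesis using y_carrier[OF k] MG.comp_zero by simp
    qed
    then have "y k \<odot>\<^bsub>F\<^esub> \<iota> k f \<in> mcomp F a" using y_carrier[OF k] by (auto simp: fun_module_simps)
    then show ?case using Suc sub_add[OF F.MG.comp_subgroup] by simp
  qed
  then show ?thesis unfolding graded_hom_def
    using bd_closed bd_add bd_smult by auto
qed

lemma Z_gsub: "graded_sub R F (Z i n)"
  unfolding Z_def using F.gsub_kernel[OF F.graded_mod_axioms bd_hom Kc_gsub] .

lemma Kc_generated: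
  assumes "n \<ge> n0"
  shows "Kc i (Suc n) \<subseteq> lsum F (map y [0..<v]) (Kc i n)"
proof -
  let ?ys = "map y [0..<v]"
  have ys: "set ?ys \<subseteq> carrier R" using y_carrier by auto
  have A: "additive_subgroup (lsum F ?ys (Kc i n)) F"
    using F.lsum_subgroup[OF ys F.gsub_subgroup[OF Kc_gsub]] .
  show ?thesis unfolding Kc_def[of i "Suc n"]
  proof (rule fun_sub_induct[OF A T_sub(2,1) gsub_subgroup[OF gP]])
    fix S x assume S: "S \<in> T i" and x: "x \<in> P (Suc n)"
    let ?\<delta> = "\<lambda>x t. if t = S then x else \<zero>\<^bsub>M\<^esub>"
    have "lsum M ?ys (P n) \<subseteq> {x \<in> carrier M. ?\<delta> x \<in> lsum F ?ys (Kc i n)}"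
    proof (rule lsum_least)
      show "additive_subgroup {x \<in> carrier M. ?\<delta> x \<in> lsum F ?ys (Kc i n)} M"
        using delta_hom_subgroup[OF A] S T_sub(1) by blast
      fix r u assume r: "r \<in> set ?ys" and u: "u \<in> P n"
      have c: "r \<in> carrier R" "u \<in> carrier M" using r ys u gsub_carrier[OF gP] by auto
      have "?\<delta> u \<in> Kc i n" unfolding Kc_def fun_sub_def
        using u S sub_zero[OF gsub_subgroup[OF gP]] by auto
      then have "r \<odot>\<^bsub>F\<^esub> ?\<delta> u \<in> lsum F ?ys (Kc i n)"
        using F.lsumI[OF ys F.gsub_subgroup[OF Kc_gsub] r] by blast
      moreover have "r \<odot>\<^bsub>F\<^esub> ?\<delta> u = ?\<delta> (r \<odot>\<^bsub>M\<^esub> u)" using c by (auto simp: fun_module_simps)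
      ultimately show "r \<odot>\<^bsub>M\<^esub> u \<in> {x \<in> carrier M. ?\<delta> x \<in> lsum F ?ys (Kc i n)}" using c by simp
    qed
    then show "?\<delta> x \<in> lsum F ?ys (Kc i n)" using x gen[OF assms] by blast
  qed
qed

text \<open>Second use of \<open>eventually_generated\<close>: the index is now the exponent, the
  operators are the \<open>y j\<close>, admissible sets are graded submodules of \<open>F\<close>,
  and \<open>N = 0\<close>. The chain condition comes from \<open>gsub_acc\<close> for
  \<open>F\<close>, and the ambient family \<open>Kc i\<close> is generated by the
  \<open>y j\<close> from \<open>n0\<close> on.\<close>

lemma Z_eventually_generated: "\<exists>n1. \<forall>n\<ge>n1. Z i (Suc n) \<subseteq> lsum F (map y [0..<v]) (Z i n)"
proof -
  let ?ys = "map y [0..<v]"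
  have ys: "set ?ys \<subseteq> carrier R" using y_carrier by auto
  have hom: "\<exists>d. r \<in> rcomp R d" if r: "r \<in> set ?ys" for r
  proof -
    obtain j where "j < v" "r = y j" using r by auto
    then show ?thesis using y by blast
  qed
  interpret GO: graded_operators R F "graded_sub R F" "set ?ys" "\<lambda>n. Kc i (n0 + n)"
  proof (intro graded_operators.intro graded_operators_axioms.intro)
    show "module R F" by unfold_locales
    show "set ?ys \<subseteq> carrier R" by (rule ys)
    show "additive_subgroup A F" if "graded_sub R F A" for A using F.gsub_subgroup[OF that] .
    show "graded_sub R F ((\<lambda>x. r \<odot>\<^bsub>F\<^esub> x) ` A)" if "r \<in> set ?ys" "graded_sub R F A" for r A
      using hom[OF that(1)] F.gsub_image[OF that(2)] by blast
    show "graded_sub R F {x \<in> carrier F. r \<odot>\<^bsub>F\<^esub> x \<in> A}" if "r \<in> set ?ys" "graded_sub R F A" for r A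
      using hom[OF that(1)] F.gsub_preimage[OF F.gsub_carrier_self that(2)] by blast
    show "r \<odot>\<^bsub>F\<^esub> x \<in> Kc i (n0 + Suc n)" if "r \<in> set ?ys" "x \<in> Kc i (n0 + n)" for r x n
      using that y_Kc by auto
    show "acc_on (graded_sub R F) (Kc i (n0 + n))" for n
      using F.gsub_acc acc_on_mono Kc_F by (metis subsetI)
  qed (rule F.gsub_zero F.gsub_Int F.gsub_add_sets F.gsub_chain_Union Kc_gsub; assumption)+
  have z: "{\<zero>\<^bsub>F\<^esub>} \<subseteq> Z i n" for n using sub_zero[OF F.gsub_subgroup[OF Z_gsub]] by simp
  have drop: "add_sets F {\<zero>\<^bsub>F\<^esub>} A = A" if "additive_subgroup A F" for A
  proof
    show "add_sets F {\<zero>\<^bsub>F\<^esub>} A \<subseteq> A"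
      using that sub_zero[OF that] by (intro add_sets_least) auto
    show "A \<subseteq> add_sets F {\<zero>\<^bsub>F\<^esub>} A"
      using F.M.subset_add_sets(2)[OF F.gsub_subgroup[OF F.gsub_zero] that] .
  qed
  have L: "additive_subgroup (lsum F ?ys (Kc i n)) F" "additive_subgroup (lsum F ?ys (Z i n)) F" for n
    using F.lsum_subgroup[OF ys F.gsub_subgroup] Kc_gsub Z_gsub by blast+
  have yZ: "r \<odot>\<^bsub>F\<^esub> f \<in> Z i (Suc n)" if "r \<in> set ?ys" "f \<in> Z i n" for r f n
    using that y_Kc y_carrier bd_smult[of v f r] Kc_F unfolding Z_def by auto
  have "\<exists>n1. \<forall>n\<ge>n1. Z i (n0 + Suc n) \<subseteq> add_sets F {\<zero>\<^bsub>F\<^esub>} (lsum F ?ys (Z i (n0 + n)))"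
  proof (rule GO.eventually_generated[where N = "\<lambda>_. {\<zero>\<^bsub>F\<^esub>}" and ?n0.0 = 0])
    show "Kc i (n0 + Suc n) \<subseteq> add_sets F {\<zero>\<^bsub>F\<^esub>} (lsum F ?ys (Kc i (n0 + n)))" for n
      using Kc_generated[of "n0 + n" i] drop[OF L(1)] by simp
    show "Z i (n0 + n) \<subseteq> Kc i (n0 + n)" for n unfolding Z_def by blast
    show "r \<odot>\<^bsub>F\<^esub> x \<in> {\<zero>\<^bsub>F\<^esub>}" if "r \<in> set ?ys" "x \<in> {\<zero>\<^bsub>F\<^esub>}" for r x
      using that ys by auto
  qed (use z yZ Z_gsub F.gsub_zero in auto)
  then obtain n1 where n1: "\<And>n. n \<ge> n1 \<Longrightarrow> Z i (n0 + Suc n) \<subseteq> lsum F ?ys (Z i (n0 + n))"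
    unfolding drop[OF L(2)] by blast
  have "Z i (Suc n) \<subseteq> lsum F ?ys (Z i n)" if "n \<ge> n0 + n1" for n
    using n1[of "n - n0"] that by simp
  then show ?thesis by blast
qed

text \<open>For large \<open>n\<close> a cycle at index \<open>Suc n\<close> is a sum of elements
  \<open>y j f\<close> with cycles \<open>f\<close> at index \<open>n\<close>, and
  \<open>y j f = bd v (\<epsilon> j f)\<close> by \<open>bd_\<epsilon>\<close>. Since
  \<open>i\<close> is at most \<open>v\<close>, finitely many thresholds have a common
  maximum.\<close>

theorem koszul_exact: "\<exists>n1. \<forall>n\<ge>n1. \<forall>i\<le>v. Z i (Suc n) = bd v ` Kc (Suc i) n"
proof -
  have "\<exists>n1. \<forall>n\<ge>n1. Z i (Suc n) = bd v ` Kc (Suc i) n" for i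
  proof -
    obtain n1 where n1: "\<And>n. n \<ge> n1 \<Longrightarrow> Z i (Suc n) \<subseteq> lsum F (map y [0..<v]) (Z i n)"
      using Z_eventually_generated by blast
    have "Z i (Suc n) = bd v ` Kc (Suc i) n" if "n \<ge> n1" for n
    proof
      have B: "additive_subgroup (bd v ` Kc (Suc i) n) F"
        using additive_hom_preimage(4)[OF F.M.abelian_group_axioms F.M.abelian_group_axioms _ _
            F.gsub_subgroup[OF Kc_gsub], of "bd v"] bd_closed bd_add by blast
      have "lsum F (map y [0..<v]) (Z i n) \<subseteq> bd v ` Kc (Suc i) n"
      proof (rule F.lsum_least[OF B])
        fix r f assume r: "r \<in> set (map y [0..<v])" and f: "f \<in> Z i n"
        obtain j where j: "j < v" "r = y j" using r by auto
        have fK: "f \<in> Kc i n" "bd v f = \<zero>\<^bsub>F\<^esub>" using f unfolding Z_def by auto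
        have "bd v (\<epsilon> j f) = y j \<odot>\<^bsub>F\<^esub> f"
          using bd_\<epsilon>[of v j f] j Kc_F[OF fK(1)] fK(2) \<epsilon>_zero[OF j(1)] bd_closed[OF le_refl \<epsilon>_closed]
            by simp
        then show "r \<odot>\<^bsub>F\<^esub> f \<in> bd v ` Kc (Suc i) n" using \<epsilon>_Kc[OF j(1) fK(1)] j by (metis image_eqI)
      qed
      then show "Z i (Suc n) \<subseteq> bd v ` Kc (Suc i) n" using n1[OF that] by blast
      show "bd v ` Kc (Suc i) n \<subseteq> Z i (Suc n)"
        unfolding Z_def using bd_Kc bd_bd Kc_F by auto
    qed
    then show ?thesis by blast
  qed
  then obtain g where g: "\<And>i n. n \<ge> g i \<Longrightarrow> Z i (Suc n) = bd v ` Kc (Suc i) n" by metis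
  show ?thesis
  proof (intro exI[of _ "Max (g ` {..v})"] allI impI)
    fix n i assume "Max (g ` {..v}) \<le> n" "i \<le> v"
    then have "g i \<le> n" by (meson Max_ge finite_atMost finite_imageI imageI atMost_iff order_trans)
    then show "Z i (Suc n) = bd v ` Kc (Suc i) n" by (rule g)
  qed
qed

lemma Z_0: "Z 0 n = Kc 0 n"
  unfolding Z_def using bd_Kc_0 by auto

lemma Kc_top: "Kc (Suc v) n = {\<zero>\<^bsub>F\<^esub>}"
proof -
  have "card S \<noteq> Suc v" if "S \<subseteq> {..<v}" for S using card_mono[OF _ that] by simp
  then have "T (Suc v) = {}" unfolding T_def by auto
  then show ?thesis unfolding Kc_def fun_sub_def by (auto simp: fun_module_simps)
qed

lemma koszul_short_exact:
  assumes "Z i (Suc n) = bd v ` Kc (Suc i) n"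
  shows "short_exact R (graded_submodule F (Z (Suc i) n)) (graded_submodule F (Kc (Suc i) n))
    (graded_submodule F (Z i (Suc n))) (\<lambda>x. x) (bd v)"
proof -
  have "graded_hom R (graded_submodule F (Kc (Suc i) n)) (graded_submodule F (Z i (Suc n))) (bd v)"
  proof -
    have "bd v ` mcomp F a \<subseteq> mcomp F a" for a using bd_hom unfolding graded_hom_def by blast
    then show ?thesis
      using assms bd_add bd_smult Kc_F[of _ "Suc i" n] unfolding graded_hom_def
        by (simp add: Pi_iff) blast
  qed
  moreover have "graded_hom R (graded_submodule F (Z (Suc i) n)) (graded_submodule F (Kc (Suc i) n))
    (\<lambda>x. x)"
    unfolding graded_hom_def Z_def by auto
  ultimately show ?thesis unfolding short_exact_def using assms by (auto simp: Z_def)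
qed

end

section \<open>Regularity functions on arbitrary types\<close>

text \<open>A copy of a module on another type. It is a module as soon as \<open>\<phi>\<close> is
  injective on the carrier, since \<open>inv_into\<close> then undoes \<open>\<phi>\<close>
  there.\<close>

definition transport :: "('b \<Rightarrow> 'c) \<Rightarrow> ('a, 'b) graded_module \<Rightarrow> ('a, 'c) graded_module" where
  "transport \<phi> N = (let \<psi> = inv_into (carrier N) \<phi> in
     \<lparr>carrier = \<phi> ` carrier N, monoid.mult = (\<lambda>_ _. \<phi> \<zero>\<^bsub>N\<^esub>), one = \<phi> \<zero>\<^bsub>N\<^esub>, ring.zero = \<phi> \<zero>\<^bsub>N\<^esub>,
      add = (\<lambda>x y. \<phi> (\<psi> x \<oplus>\<^bsub>N\<^esub> \<psi> y)), smult = (\<lambda>r x. \<phi> (r \<odot>\<^bsub>N\<^esub> \<psi> x)),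
      mcomp = (\<lambda>n. \<phi> ` mcomp N n)\<rparr>)"

lemma transport_simps:
  "carrier (transport \<phi> N) = \<phi> ` carrier N" "zero (transport \<phi> N) = \<phi> \<zero>\<^bsub>N\<^esub>"
  "x \<oplus>\<^bsub>transport \<phi> N\<^esub> y = \<phi> (inv_into (carrier N) \<phi> x \<oplus>\<^bsub>N\<^esub> inv_into (carrier N) \<phi> y)"
  "r \<odot>\<^bsub>transport \<phi> N\<^esub> x = \<phi> (r \<odot>\<^bsub>N\<^esub> inv_into (carrier N) \<phi> x)"
  "mcomp (transport \<phi> N) n = \<phi> ` mcomp N n"
  by (simp_all add: transport_def Let_def)

lemma (in fg_graded_mod) transport_fg:
  assumes inj: "inj_on \<phi> (carrier M)"
  shows "fg_graded_mod R (transport \<phi> M)" and "graded_hom R M (transport \<phi> M) \<phi>"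
proof -
  let ?N = "transport \<phi> M" and ?\<psi> = "inv_into (carrier M) \<phi>"
  note [simp] = transport_simps
  have \<psi> [simp]: "?\<psi> (\<phi> x) = x" if "x \<in> carrier M" for x using inj that by simp
  have cc [simp]: "mcomp M n \<subseteq> carrier M" for n using MG.comp_carrier by blast
  have eq [simp]: "\<phi> x = \<phi> y \<longleftrightarrow> x = y" if "x \<in> carrier M" "y \<in> carrier M" for x y
    using inj that by (simp add: inj_on_eq_iff)
  interpret N: abelian_group ?N
  proof (rule abelian_groupI)
    show "\<exists>y \<in> carrier ?N. y \<oplus>\<^bsub>?N\<^esub> x = \<zero>\<^bsub>?N\<^esub>" if "x \<in> carrier ?N" for x
    proof -
      obtain u where u: "u \<in> carrier M" "x = \<phi> u" using \<open>x \<in> carrier ?N\<close> by auto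
      then show ?thesis by (intro bexI[of _ "\<phi> (\<ominus>\<^bsub>M\<^esub> u)"]) (auto simp: M.l_neg)
    qed
  qed (auto simp: M.a_ac)
  have hom: "\<phi> \<in> carrier M \<rightarrow> carrier ?N" "\<And>x y. x \<in> carrier M \<Longrightarrow> y \<in> carrier M \<Longrightarrow>
    \<phi> (x \<oplus>\<^bsub>M\<^esub> y) = \<phi> x \<oplus>\<^bsub>?N\<^esub> \<phi> y"
    by auto
  have ah3: "additive_subgroup A ?N \<Longrightarrow> additive_subgroup {x \<in> carrier M. \<phi> x \<in> A} M"
    and ah4: "additive_subgroup B M \<Longrightarrow> additive_subgroup (\<phi> ` B) ?N" for A B
    by (rule additive_hom_preimage(3,4)[OF M.abelian_group_axioms N.abelian_group_axioms hom]; simp)+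
  let ?p = "\<lambda>n x. \<phi> (MG.hp n (?\<psi> x))"
  have dd: "direct_decomposition ?N (mcomp ?N)"
  proof (rule N.direct_decompositionI[where p = ?p])
    show "additive_subgroup (mcomp ?N n) ?N" for n using ah4[OF MG.comp_subgroup] by simp
    show "?p n x \<in> mcomp ?N n" if "x \<in> carrier ?N" for n x using that MG.hpart_expansion(1) by auto
    show "?p n (x \<oplus>\<^bsub>?N\<^esub> y) = ?p n x \<oplus>\<^bsub>?N\<^esub> ?p n y" if "x \<in> carrier ?N" "y \<in> carrier ?N" for n x y
      using that by (auto simp: MG.hpart_add)
    show "?p n x = x" if "x \<in> mcomp ?N n" for n x
      using that MG.comp_carrier by (auto simp: MG.hpart_same)
    show "?p n x = \<zero>\<^bsub>?N\<^esub>" if "x \<in> mcomp ?N m" "n \<noteq> m" for n m x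
    proof -
      obtain u where "u \<in> mcomp M m" "x = \<phi> u" using \<open>x \<in> mcomp ?N m\<close> by auto
      then show ?thesis using MG.hpart_other[OF _ \<open>n \<noteq> m\<close>] MG.comp_carrier by simp
    qed
    show "finite {n. ?p n x \<noteq> \<zero>\<^bsub>?N\<^esub>}" if "x \<in> carrier ?N" for x
      using that MG.hpart_expansion(2) by auto
    show "x = \<zero>\<^bsub>?N\<^esub>" if "x \<in> carrier ?N" "\<And>n. ?p n x = \<zero>\<^bsub>?N\<^esub>" for x
    proof -
      obtain u where u: "u \<in> carrier M" "x = \<phi> u" using \<open>x \<in> carrier ?N\<close> by auto
      then have "MG.hp n u = \<zero>\<^bsub>M\<^esub>" for n using that(2)[of n] by simp
      then show ?thesis using MG.hpart_eq_zero u by simp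
    qed
  qed
  have mod: "module R ?N"
    by (rule moduleI)
      (auto simp: R.is_cring N.abelian_group_axioms smult_l_distr smult_r_distr smult_assoc1)
  have deg: "r \<odot>\<^bsub>?N\<^esub> x \<in> mcomp ?N (int i + n)" if r: "r \<in> rcomp R i" and x: "x \<in> mcomp ?N n" for r x i n
  proof -
    obtain u where "u \<in> mcomp M n" "x = \<phi> u" using x by auto
    then show ?thesis using mdeg[OF r] MG.comp_carrier by auto
  qed
  have g: "graded_mod R ?N"
    by (intro graded_mod.intro graded_mod_axioms.intro mod dd R.std_graded_axioms deg)
  interpret N: graded_mod R ?N by (rule g)
  obtain B where B: "B \<subseteq> carrier M" "finite B" "carrier M = set_smult M (carrier R) B"
    using fg by blast
  have BN: "\<phi> ` B \<subseteq> carrier ?N" using B(1) by auto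
  let ?V = "set_smult ?N (carrier R) (\<phi> ` B)"
  have V: "additive_subgroup ?V ?N" using N.set_smult_subgroup BN by blast
  have "set_smult M (carrier R) B \<subseteq> {x \<in> carrier M. \<phi> x \<in> ?V}"
  proof (rule set_smult_least[OF ah3[OF V]])
    fix a b assume ab: "a \<in> carrier R" "b \<in> B"
    then have "a \<odot>\<^bsub>?N\<^esub> \<phi> b \<in> ?V" by (intro N.set_smultI) auto
    then show "a \<odot>\<^bsub>M\<^esub> b \<in> {x \<in> carrier M. \<phi> x \<in> ?V}" using ab B(1) by (auto simp: subset_iff)
  qed
  then have "carrier ?N \<subseteq> ?V" using B(3) by auto
  moreover have "?V \<subseteq> carrier ?N" using sub_subset[OF V] .
  ultimately show "fg_graded_mod R ?N" using B(2) BN by unfold_locales blast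
  show "graded_hom R M ?N \<phi>" unfolding graded_hom_def by auto
qed

section \<open>Isomorphic copies in the type on which the regularity function is defined\<close>

fun lincomb :: "('a, 'b, 'd) module_scheme \<Rightarrow> 'b list \<Rightarrow> (nat \<Rightarrow> 'a) \<Rightarrow> 'b" where
  "lincomb M [] c = \<zero>\<^bsub>M\<^esub>"
| "lincomb M (b # bs) c = c 0 \<odot>\<^bsub>M\<^esub> b \<oplus>\<^bsub>M\<^esub> lincomb M bs (\<lambda>i. c (Suc i))"

text \<open>Only the size of \<open>M\<close> is at stake: every element is a linear combination of
  a fixed list of generators, so it is determined by a sequence of coefficients.\<close>

lemma (in fg_graded_mod) surjection_from_coefficients: "\<exists>h :: (nat \<Rightarrow> 'a) \<Rightarrow> 'b. carrier M \<subseteq> range h"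
proof -
  let ?S = "\<lambda>bs. {lincomb M bs c | c. \<forall>i. c i \<in> carrier R}"
  obtain B where B: "B \<subseteq> carrier M" "finite B" "carrier M = set_smult M (carrier R) B"
    using fg by blast
  obtain bs where bs: "set bs = B" using finite_list B(2) by blast
  have "additive_subgroup (?S bs) M \<and> (\<forall>b \<in> set bs. \<forall>r \<in> carrier R. r \<odot>\<^bsub>M\<^esub> b \<in> ?S bs)"
    if "set bs \<subseteq> carrier M" for bs
    using that
  proof (induction bs)
    case Nil
    have "?S [] = {\<zero>\<^bsub>M\<^esub>}" by auto
    then show ?case using gsub_subgroup[OF gsub_zero] by simp
  next
    case (Cons b bs)
    let ?C = "(\<lambda>r. r \<odot>\<^bsub>M\<^esub> b) ` carrier R"
    have b: "b \<in> carrier M" using Cons by simp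
    have IH: "additive_subgroup (?S bs) M" "\<forall>b \<in> set bs. \<forall>r \<in> carrier R. r \<odot>\<^bsub>M\<^esub> b \<in> ?S bs"
      using Cons by auto
    have C: "additive_subgroup ?C M"
      by (rule additive_hom_preimage(4)[OF R.abelian_group_axioms M.abelian_group_axioms])
        (use b R.carrier_subgroup in \<open>auto simp: smult_l_distr\<close>)
    have S: "?S (b # bs) = add_sets M ?C (?S bs)"
    proof
      show "?S (b # bs) \<subseteq> add_sets M ?C (?S bs)" unfolding add_sets_def by fastforce
      show "add_sets M ?C (?S bs) \<subseteq> ?S (b # bs)"
      proof
        fix x assume "x \<in> add_sets M ?C (?S bs)"
        then obtain r c where rc: "r \<in> carrier R" "\<forall>i. c i \<in> carrier R" "x = r \<odot>\<^bsub>M\<^esub> b \<oplus>\<^bsub>M\<^esub> lincomb M bs c"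
          unfolding add_sets_def by blast
        then show "x \<in> ?S (b # bs)"
          by (intro CollectI exI[of _ "case_nat r c"]) (auto split: nat.split)
      qed
    qed
    have "additive_subgroup (?S (b # bs)) M" unfolding S using M.add_sets_subgroup[OF C IH(1)] .
    moreover have "\<forall>b' \<in> set (b # bs). \<forall>r \<in> carrier R. r \<odot>\<^bsub>M\<^esub> b' \<in> ?S (b # bs)"
      unfolding S using M.subset_add_sets[OF C IH(1)] IH(2) by auto
    ultimately show ?case by blast
  qed
  from this[of bs] have "set_smult M (carrier R) B \<subseteq> ?S bs"
    using B bs by (intro set_smult_least) auto
  then show ?thesis using B(3) by (intro exI[of _ "lincomb M bs"]) auto
qed

text \<open>Each element is represented by its fibre under the surjection from coefficient
  sequences. Distinct elements have disjoint nonempty fibres, and \<open>emb\<close> carries sets of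
  sequences into the target type.\<close>

lemma (in fg_graded_mod) embedding_exists:
  fixes emb :: "(nat \<Rightarrow> 'a) set \<Rightarrow> 'm"
  assumes emb: "inj emb"
  shows "\<exists>\<phi> :: 'b \<Rightarrow> 'm. inj_on \<phi> (carrier M)"
proof -
  obtain h :: "(nat \<Rightarrow> 'a) \<Rightarrow> 'b" where h: "carrier M \<subseteq> range h"
    using surjection_from_coefficients by blast
  have "inj_on (\<lambda>x. emb {c. h c = x}) (carrier M)"
  proof (rule inj_onI)
    fix x y assume x: "x \<in> carrier M" and e: "emb {c. h c = x} = emb {c. h c = y}"
    have "{c. h c = x} = {c. h c = y}" using injD[OF emb e] .
    moreover obtain c where "h c = x" using h x by blast
    ultimately show "x = y" by blast
  qed
  then show ?thesis by blast
qed

lemma graded_iso_refl: "graded_iso R M M"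
  unfolding graded_iso_def graded_hom_def by (intro exI[of _ "\<lambda>x. x"]) (auto simp: bij_betw_def)

lemma graded_hom_comp:
  assumes "graded_hom R M N f" "graded_hom R N P g"
  shows "graded_hom R M P (g \<circ> f)"
  using assms unfolding graded_hom_def by (simp add: Pi_iff image_subset_iff)

lemma graded_iso_trans:
  assumes "graded_iso R M N" "graded_iso R N P"
  shows "graded_iso R M P"
proof -
  obtain f g where "graded_hom R M N f" "bij_betw f (carrier M) (carrier N)"
    "graded_hom R N P g" "bij_betw g (carrier N) (carrier P)"
    using assms unfolding graded_iso_def by blast
  then show ?thesis unfolding graded_iso_def
    using graded_hom_comp bij_betw_trans by blast
qed

text \<open>The inverse respects degrees because \<open>h\<close> commutes with components: for
  \<open>y\<close> of degree \<open>n\<close>, the component of degree \<open>n\<close> of the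
  preimage is again mapped to \<open>y\<close>, hence equals the preimage.\<close>

lemma graded_hom_inverse:
  assumes "graded_mod R M" "graded_mod R N" and h: "graded_hom R M N h" and bij: "bij_betw h
    (carrier M) (carrier N)"
  shows "graded_hom R N M (inv_into (carrier M) h)"
proof -
  interpret M: graded_mod R M by fact
  interpret N: graded_mod R N by fact
  let ?g = "inv_into (carrier M) h"
  have g: "?g y \<in> carrier M" "h (?g y) = y" if "y \<in> carrier N" for y
    using bij that by (auto simp: bij_betw_def inv_into_into f_inv_into_f)
  have gh: "?g (h x) = x" if "x \<in> carrier M" for x using bij that by (simp add: bij_betw_def)
  have inj: "x = y" if "x \<in> carrier M" "y \<in> carrier M" "h x = h y" for x y
    using bij that unfolding bij_betw_def inj_on_def by blast
  have hc: "h \<in> carrier M \<rightarrow> carrier N"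
    and add: "\<And>x y. x \<in> carrier M \<Longrightarrow> y \<in> carrier M \<Longrightarrow> h (x \<oplus>\<^bsub>M\<^esub> y) = h x \<oplus>\<^bsub>N\<^esub> h y"
    and sm: "\<And>a x. a \<in> carrier R \<Longrightarrow> x \<in> carrier M \<Longrightarrow> h (a \<odot>\<^bsub>M\<^esub> x) = a \<odot>\<^bsub>N\<^esub> h x"
    using h unfolding graded_hom_def by auto
  note hom = additive_hom_preimage[OF M.M.abelian_group_axioms N.M.abelian_group_axioms hc add]
  have "?g y \<in> mcomp M n" if y: "y \<in> mcomp N n" for y n
  proof -
    have yc: "y \<in> carrier N" using N.MG.comp_carrier[OF y] .
    have "h (M.MG.hp n (?g y)) = y"
      using graded_hom_hpart[OF assms(1-3) g(1)[OF yc], of n] g(2)[OF yc] N.MG.hpart_same[OF y]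
        by simp
    then have "M.MG.hp n (?g y) = ?g y" using gh[of "M.MG.hp n (?g y)"] g(1)[OF yc] by simp
    then show ?thesis using M.MG.hpart_expansion(1)[OF g(1)[OF yc], of n] by simp
  qed
  moreover have "?g (x \<oplus>\<^bsub>N\<^esub> y) = ?g x \<oplus>\<^bsub>M\<^esub> ?g y" if "x \<in> carrier N" "y \<in> carrier N" for x y
    by (rule inj) (use that g add in auto)
  moreover have "?g (r \<odot>\<^bsub>N\<^esub> x) = r \<odot>\<^bsub>M\<^esub> ?g x" if "r \<in> carrier R" "x \<in> carrier N" for r x
    by (rule inj) (use that g sm in auto)
  ultimately show ?thesis unfolding graded_hom_def using g(1) by auto
qed

lemma graded_iso_sym:
  assumes "graded_mod R M" "graded_mod R N" "graded_iso R M N"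
  shows "graded_iso R N M"
  using assms graded_hom_inverse bij_betw_inv_into unfolding graded_iso_def by blast

lemma graded_iso_nonzero:
  assumes "graded_mod R M" "graded_mod R N" "graded_iso R M N" "nonzero_module M"
  shows "nonzero_module N"
proof -
  interpret M: graded_mod R M by fact
  interpret N: graded_mod R N by fact
  obtain h where h: "graded_hom R M N h" "bij_betw h (carrier M) (carrier N)"
    using assms(3) unfolding graded_iso_def by blast
  obtain x where x: "x \<in> carrier M" "x \<noteq> \<zero>\<^bsub>M\<^esub>"
    using assms(4) M.M.zero_closed unfolding nonzero_module_def by blast
  have "h \<zero>\<^bsub>M\<^esub> = \<zero>\<^bsub>N\<^esub>"
    using h(1) additive_hom_preimage(1)[OF M.M.abelian_group_axioms N.M.abelian_group_axioms, of h]
    unfolding graded_hom_def by blast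
  then have "h x \<noteq> \<zero>\<^bsub>N\<^esub>" "h x \<in> carrier N"
    using h(2) x M.M.zero_closed unfolding bij_betw_def inj_on_def by (metis, blast)
  then show ?thesis unfolding nonzero_module_def by blast
qed

lemma shift_simps [simp]:
  "carrier (shift p M) = carrier M" "add (shift p M) = add M" "zero (shift p M) = zero M"
  "smult (shift p M) = smult M" "mcomp (shift p M) n = mcomp M (n - p)"
  unfolding shift_def by simp_all

lemma (in fg_graded_mod) shift_fg: "fg_graded_mod R (shift p M)"
proof -
  let ?N = "shift p M"
  have cM: "additive_subgroup (carrier M) M" by (rule M.additive_subgroupI') auto
  note sub = M.abelian_group_sub[OF cM, of ?N, simplified]
  interpret N: abelian_group ?N by (rule sub(1))
  have dd: "direct_decomposition ?N (mcomp ?N)"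
  proof (rule N.direct_decompositionI[where p = "\<lambda>n. MG.hp (n - p)"])
    show "additive_subgroup (mcomp ?N n) ?N" for n
      using sub(3) MG.comp_subgroup MG.comp_carrier by auto
    show "finite {n. MG.hp (n - p) x \<noteq> \<zero>\<^bsub>?N\<^esub>}" if "x \<in> carrier ?N" for x
    proof (rule finite_subset)
      show "{n. MG.hp (n - p) x \<noteq> \<zero>\<^bsub>?N\<^esub>} \<subseteq> (\<lambda>m. m + p) ` {m. MG.hp m x \<noteq> \<zero>\<^bsub>M\<^esub>}"
      proof
        fix n assume "n \<in> {n. MG.hp (n - p) x \<noteq> \<zero>\<^bsub>?N\<^esub>}"
        then show "n \<in> (\<lambda>m. m + p) ` {m. MG.hp m x \<noteq> \<zero>\<^bsub>M\<^esub>}" by (intro image_eqI[of _ _ "n - p"]) auto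
      qed
      show "finite ((\<lambda>m. m + p) ` {m. MG.hp m x \<noteq> \<zero>\<^bsub>M\<^esub>})" using that MG.hpart_expansion(2) by simp
    qed
    show "x = \<zero>\<^bsub>?N\<^esub>" if "x \<in> carrier ?N" "\<And>n. MG.hp (n - p) x = \<zero>\<^bsub>?N\<^esub>" for x
    proof -
      have "MG.hp m x = \<zero>\<^bsub>M\<^esub>" for m using that(2)[of "m + p"] by simp
      then show ?thesis using MG.hpart_eq_zero that(1) by simp
    qed
  qed (auto simp: MG.hpart_add MG.hpart_expansion(1) MG.hpart_same MG.hpart_other)
  have mod: "module R ?N"
    by (rule moduleI)
      (auto simp: R.is_cring N.abelian_group_axioms smult_l_distr smult_r_distr smult_assoc1)
  have deg: "r \<odot>\<^bsub>?N\<^esub> x \<in> mcomp ?N (int i + n)" if "r \<in> rcomp R i" "x \<in> mcomp ?N n" for r x i n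
    using mdeg[OF that(1), of x "n - p"] that(2) by (simp add: add_diff_eq)
  have g: "graded_mod R ?N"
    by (intro graded_mod.intro graded_mod_axioms.intro mod dd R.std_graded_axioms deg)
  have "set_smult ?N S B = set_smult M S B" for S B unfolding set_smult_def by simp
  then show ?thesis using fg by (intro fg_graded_mod.intro g fg_graded_mod_axioms.intro) simp
qed

lemma short_exact_iso:
  assumes A: "graded_mod R A" "graded_mod R A'" and B: "graded_mod R B" "graded_mod R B'" and C:
    "graded_mod R C" "graded_mod R C'"
    and iA: "graded_iso R A A'" and iB: "graded_iso R B B'" and iC: "graded_iso R C C'"
    and ex: "short_exact R A B C f g"
  shows "\<exists>f' g'. short_exact R A' B' C' f' g'"
proof -
  interpret C: graded_mod R C by fact
  interpret C': graded_mod R C' by fact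
  obtain \<alpha> where \<alpha>: "graded_hom R A' A \<alpha>" "bij_betw \<alpha> (carrier A') (carrier A)"
    using graded_iso_sym[OF A iA] unfolding graded_iso_def by blast
  obtain \<beta> where \<beta>: "graded_hom R B B' \<beta>" "bij_betw \<beta> (carrier B) (carrier B')"
    using iB unfolding graded_iso_def by blast
  obtain \<gamma> where \<gamma>: "graded_hom R C C' \<gamma>" "bij_betw \<gamma> (carrier C) (carrier C')"
    using iC unfolding graded_iso_def by blast
  let ?\<beta> = "inv_into (carrier B) \<beta>"
  have \<beta>': "graded_hom R B' B ?\<beta>" using graded_hom_inverse[OF B \<beta>] .
  have b: "?\<beta> (\<beta> x) = x" if "x \<in> carrier B" for x using \<beta>(2) that by (simp add: bij_betw_def)
  have b': "?\<beta> z \<in> carrier B" "\<beta> (?\<beta> z) = z" if "z \<in> carrier B'" for z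
    using \<beta>(2) that by (auto simp: bij_betw_def inv_into_into f_inv_into_f)
  have bc: "\<beta> x \<in> carrier B'" if "x \<in> carrier B" for x using \<beta>(2) that unfolding bij_betw_def by blast
  have f: "graded_hom R A B f" "inj_on f (carrier A)" "f ` carrier A = {x \<in> carrier B. g x = \<zero>\<^bsub>C\<^esub>}"
    and g: "graded_hom R B C g" "g ` carrier B = carrier C"
    using ex unfolding short_exact_def by auto
  have g0: "\<gamma> \<zero>\<^bsub>C\<^esub> = \<zero>\<^bsub>C'\<^esub>"
    using \<gamma>(1) additive_hom_preimage(1)[OF C.M.abelian_group_axioms C'.M.abelian_group_axioms, of \<gamma>]
    unfolding graded_hom_def by blast
  have gz: "\<gamma> x = \<zero>\<^bsub>C'\<^esub> \<longleftrightarrow> x = \<zero>\<^bsub>C\<^esub>" if "x \<in> carrier C" for x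
    using that g0 \<gamma>(2) C.M.zero_closed unfolding bij_betw_def inj_on_def by metis
  have gC: "g x \<in> carrier C" if "x \<in> carrier B" for x using g that by blast
  have "short_exact R A' B' C' (\<beta> \<circ> (f \<circ> \<alpha>)) (\<gamma> \<circ> (g \<circ> ?\<beta>))"
    unfolding short_exact_def
  proof (intro conjI)
    show "graded_hom R A' B' (\<beta> \<circ> (f \<circ> \<alpha>))" "graded_hom R B' C' (\<gamma> \<circ> (g \<circ> ?\<beta>))"
      by (rule graded_hom_comp[OF graded_hom_comp[OF \<alpha>(1) f(1)] \<beta>(1)],
          rule graded_hom_comp[OF graded_hom_comp[OF \<beta>' g(1)] \<gamma>(1)])
    have fa: "(f \<circ> \<alpha>) ` carrier A' = {x \<in> carrier B. g x = \<zero>\<^bsub>C\<^esub>}"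
      using \<alpha>(2) f(3) unfolding bij_betw_def image_comp[symmetric] by simp
    have "inj_on (f \<circ> \<alpha>) (carrier A')"
      using \<alpha>(2) f(2) unfolding bij_betw_def by (intro comp_inj_on) auto
    moreover have "inj_on \<beta> ((f \<circ> \<alpha>) ` carrier A')"
      unfolding fa using \<beta>(2) unfolding bij_betw_def by (auto intro: inj_on_subset)
    ultimately show "inj_on (\<beta> \<circ> (f \<circ> \<alpha>)) (carrier A')" by (rule comp_inj_on)
    have "(\<beta> \<circ> (f \<circ> \<alpha>)) ` carrier A' = \<beta> ` {x \<in> carrier B. g x = \<zero>\<^bsub>C\<^esub>}"
      using fa unfolding image_comp[symmetric] by simp
    also have "\<dots> = {z \<in> carrier B'. (\<gamma> \<circ> (g \<circ> ?\<beta>)) z = \<zero>\<^bsub>C'\<^esub>}"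
    proof
      show "\<beta> ` {x \<in> carrier B. g x = \<zero>\<^bsub>C\<^esub>} \<subseteq> {z \<in> carrier B'. (\<gamma> \<circ> (g \<circ> ?\<beta>)) z = \<zero>\<^bsub>C'\<^esub>}"
        using b bc g0 by auto
      show "{z \<in> carrier B'. (\<gamma> \<circ> (g \<circ> ?\<beta>)) z = \<zero>\<^bsub>C'\<^esub>} \<subseteq> \<beta> ` {x \<in> carrier B. g x = \<zero>\<^bsub>C\<^esub>}"
      proof
        fix z assume "z \<in> {z \<in> carrier B'. (\<gamma> \<circ> (g \<circ> ?\<beta>)) z = \<zero>\<^bsub>C'\<^esub>}"
        then show "z \<in> \<beta> ` {x \<in> carrier B. g x = \<zero>\<^bsub>C\<^esub>}"
          using b' gz gC by (intro image_eqI[of _ _ "?\<beta> z"]) auto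
      qed
    qed
    finally show "(\<beta> \<circ> (f \<circ> \<alpha>)) ` carrier A' = {z \<in> carrier B'. (\<gamma> \<circ> (g \<circ> ?\<beta>)) z = \<zero>\<^bsub>C'\<^esub>}" .
    have "?\<beta> ` carrier B' = carrier B" using \<beta>(2) bij_betw_inv_into unfolding bij_betw_def by blast
    then show "(\<gamma> \<circ> (g \<circ> ?\<beta>)) ` carrier B' = carrier C'"
      using g(2) \<gamma>(2) unfolding bij_betw_def image_comp[symmetric] by simp
  qed
  then show ?thesis by blast
qed

lemma direct_sum_iso:
  assumes "graded_iso R A A'" "graded_iso R B B'"
  shows "graded_iso R (direct_sum_module A B) (direct_sum_module A' B')"
proof -
  obtain f g where f: "graded_hom R A A' f" "bij_betw f (carrier A) (carrier A')"
    and g: "graded_hom R B B' g" "bij_betw g (carrier B) (carrier B')"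
    using assms unfolding graded_iso_def by blast
  have "graded_hom R (direct_sum_module A B) (direct_sum_module A' B') (map_prod f g)"
    using f(1) g(1) unfolding graded_hom_def direct_sum_module_def by (fastforce simp: Pi_iff)
  moreover have "bij_betw (map_prod f g) (carrier A \<times> carrier B) (carrier A' \<times> carrier B')"
    using f(2) g(2) by (rule bij_betw_map_prod)
  ultimately show ?thesis unfolding graded_iso_def
    by (intro exI[of _ "map_prod f g"]) (simp add: direct_sum_module_def)
qed

section \<open>The regularity function extended to modules on arbitrary types\<close>

locale regularity = std_graded R + generalized_regularity_function R \<Gamma>
  for R :: "'a graded_ring" (structure) and \<Gamma> :: "('a, 'm) graded_module \<Rightarrow> int" +
  fixes emb :: "(nat \<Rightarrow> 'a) set \<Rightarrow> 'm"
  assumes emb: "inj emb"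
begin

text \<open>The Koszul modules have functions on sets of numbers as elements, so
  \<open>\<Gamma>\<close> cannot be applied to them directly. The value at any isomorphic copy
  serves; by \<open>reg_eq\<close> the choice of the copy does not affect it.\<close>

definition reg :: "('a, 'n) graded_module \<Rightarrow> int" where
  "reg N = \<Gamma> (SOME N'. fg_graded_mod R N' \<and> nonzero_module N' \<and> graded_iso R N N')"

lemma fgI: "fg_graded_mod R M \<Longrightarrow> fg_graded_module R M"
  using fg_graded_mod_iff[OF std noeth] by blast

lemma copy_exists:
  assumes N: "fg_graded_mod R N" "nonzero_module N"
  obtains N' :: "('a, 'm) graded_module"
    where "fg_graded_mod R N'" "nonzero_module N'" "graded_iso R N N'"
proof -
  interpret N: fg_graded_mod R N by fact
  obtain \<phi> :: "_ \<Rightarrow> 'm" where \<phi>: "inj_on \<phi> (carrier N)" using N.embedding_exists[OF emb] by blast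
  note t = N.transport_fg[OF \<phi>]
  have iso: "graded_iso R N (transport \<phi> N)"
    unfolding graded_iso_def using t(2) \<phi> by (auto simp: bij_betw_def transport_simps)
  have "graded_mod R (transport \<phi> N)" using t(1) unfolding fg_graded_mod_def by blast
  then show ?thesis using that t(1) iso graded_iso_nonzero[OF N.graded_mod_axioms _ iso N(2)] by blast
qed

lemma reg_eq:
  assumes N: "fg_graded_mod R N" and N': "fg_graded_mod R N'" "nonzero_module N'" "graded_iso R N N'"
  shows "reg N = \<Gamma> N'"
proof -
  let ?N = "SOME N' :: ('a, 'm) graded_module. fg_graded_mod R N' \<and> nonzero_module N' \<and>
    graded_iso R N N'"
  have *: "fg_graded_mod R ?N \<and> nonzero_module ?N \<and> graded_iso R N ?N"
    by (rule someI[of "\<lambda>N'. fg_graded_mod R N' \<and> nonzero_module N' \<and>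
      graded_iso R N N'" N']) (use N' in blast)
  then have "graded_mod R N" "graded_mod R ?N" using N unfolding fg_graded_mod_def by auto
  then have "graded_iso R ?N N'" using * N'(3) graded_iso_sym graded_iso_trans by blast
  then show ?thesis unfolding reg_def using iso[of ?N N'] * N' fgI by blast
qed

lemma reg_\<Gamma>: "fg_graded_mod R N \<Longrightarrow> nonzero_module N \<Longrightarrow> reg N = \<Gamma> N"
  using reg_eq graded_iso_refl by blast

lemma reg_iso:
  assumes "fg_graded_mod R N" "nonzero_module N" "fg_graded_mod R P" "graded_iso R N P"
  shows "reg N = reg P"
proof -
  have g: "graded_mod R N" "graded_mod R P" using assms unfolding fg_graded_mod_def by auto
  have "nonzero_module P" using graded_iso_nonzero g assms by blast
  then obtain P' :: "('a, 'm) graded_module"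
    where P': "fg_graded_mod R P'" "nonzero_module P'" "graded_iso R P P'"
    using copy_exists assms(3) by blast
  then show ?thesis using reg_eq[OF assms(1) P'(1,2)] reg_eq[OF assms(3) P'] graded_iso_trans
    assms(4) by metis
qed

lemma reg_shift:
  assumes N: "fg_graded_mod R N" "nonzero_module N"
  shows "reg (shift p N) = reg N + p"
proof -
  obtain N' :: "('a, 'm) graded_module"
    where N': "fg_graded_mod R N'" "nonzero_module N'" "graded_iso R N N'"
    using copy_exists[OF N] by blast
  obtain f where "graded_hom R N N' f" "bij_betw f (carrier N) (carrier N')"
    using N'(3) unfolding graded_iso_def by blast
  then have "graded_iso R (shift p N) (shift p N')"
    unfolding graded_iso_def graded_hom_def by (intro exI[of _ f]) simp
  moreover have "nonzero_module (shift p N')" using N'(2) unfolding nonzero_module_def by simp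
  ultimately have "reg (shift p N) = \<Gamma> (shift p N')"
    using reg_eq[OF fg_graded_mod.shift_fg[OF N(1)] fg_graded_mod.shift_fg[OF N'(1)]] by blast
  then show ?thesis using shift[OF fgI[OF N'(1)] N'(2), of p] reg_eq[OF N(1) N'] by simp
qed

lemma reg_direct_sum:
  assumes A: "fg_graded_mod R A" "nonzero_module A" and B: "fg_graded_mod R B" "nonzero_module B"
    and S: "fg_graded_mod R S" "nonzero_module S" and iso: "graded_iso R S (direct_sum_module A B)"
  shows "reg S = max (reg A) (reg B)"
proof -
  obtain A' :: "('a, 'm) graded_module"
    where A': "fg_graded_mod R A'" "nonzero_module A'" "graded_iso R A A'"
    using copy_exists[OF A] by blast
  obtain B' :: "('a, 'm) graded_module"
    where B': "fg_graded_mod R B'" "nonzero_module B'" "graded_iso R B B'"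
    using copy_exists[OF B] by blast
  obtain S' :: "('a, 'm) graded_module"
    where S': "fg_graded_mod R S'" "nonzero_module S'" "graded_iso R S S'"
    using copy_exists[OF S] by blast
  have g: "graded_mod R S" "graded_mod R S'" using S S' unfolding fg_graded_mod_def by auto
  have "graded_iso R S' (direct_sum_module A' B')"
    by (rule graded_iso_trans[OF graded_iso_trans[OF graded_iso_sym[OF g S'(3)] iso]
      direct_sum_iso[OF A'(3) B'(3)]])
  then have "\<Gamma> S' = max (\<Gamma> A') (\<Gamma> B')"
    by (rule direct_sum[OF fgI[OF A'(1)] A'(2) fgI[OF B'(1)] B'(2) fgI[OF S'(1)]])
  then show ?thesis using reg_eq[OF A(1) A'] reg_eq[OF B(1) B'] reg_eq[OF S(1) S'] by simp
qed

lemma reg_exact: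
  assumes A: "fg_graded_mod R A" "nonzero_module A" and B: "fg_graded_mod R B" "nonzero_module B"
    and C: "fg_graded_mod R C" "nonzero_module C" and ex: "short_exact R A B C f g"
  shows "reg C \<le> max (reg B) (reg A - 1)"
proof -
  obtain A' :: "('a, 'm) graded_module"
    where A': "fg_graded_mod R A'" "nonzero_module A'" "graded_iso R A A'"
    using copy_exists[OF A] by blast
  obtain B' :: "('a, 'm) graded_module"
    where B': "fg_graded_mod R B'" "nonzero_module B'" "graded_iso R B B'"
    using copy_exists[OF B] by blast
  obtain C' :: "('a, 'm) graded_module"
    where C': "fg_graded_mod R C'" "nonzero_module C'" "graded_iso R C C'"
    using copy_exists[OF C] by blast
  have g: "graded_mod R A" "graded_mod R A'" "graded_mod R B" "graded_mod R B'" "graded_mod R C"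
    "graded_mod R C'"
    using A A' B B' C C' unfolding fg_graded_mod_def by auto
  obtain f' g' where "short_exact R A' B' C' f' g'"
    using short_exact_iso[OF g A'(3) B'(3) C'(3) ex] by blast
  then have "\<Gamma> C' \<le> max (\<Gamma> B') (\<Gamma> A' - 1)"
    by (rule exact[OF fgI[OF A'(1)] A'(2) fgI[OF B'(1)] B'(2) fgI[OF C'(1)] C'(2)])
  then show ?thesis using reg_eq[OF A(1) A'] reg_eq[OF B(1) B'] reg_eq[OF C(1) C'] by simp
qed

end

section \<open>Asymptotic behaviour\<close>

text \<open>
  The least \<open>b\<close> with \<open>h (n - l) \<le> b + l - 1\<close> for \<open>1 \<le> l \<le> v\<close> does not increase with \<open>n\<close>, and it
  drops as soon as \<open>h n < b\<close>.
\<close>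

lemma eventually_constant:
  fixes h :: "nat \<Rightarrow> int"
  assumes rec: "\<And>n b. n \<ge> N \<Longrightarrow> (\<And>l. 1 \<le> l \<Longrightarrow> l \<le> v \<Longrightarrow> h (n - l) \<le> b + int l - 1) \<Longrightarrow> h n \<le> b"
    and low: "\<And>n. n \<ge> N \<Longrightarrow> d \<le> h n"
  shows "\<exists>e\<ge>d. \<exists>n0. \<forall>n\<ge>n0. h n = e"
proof -
  define G where "G n b \<longleftrightarrow> (\<forall>l. 1 \<le> l \<longrightarrow> l \<le> v \<longrightarrow> h (n - l) \<le> b + int l - 1)" for n b
  have G_le: "h n \<le> b" if "n \<ge> N" "G n b" for n b using rec that unfolding G_def by blast
  \<comment> \<open>Passing from \<open>n\<close> to \<open>Suc n\<close> turns distance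
    \<open>l - 1\<close> into distance \<open>l\<close>, where the permitted bound is larger by one.
    This slack allows \<open>b\<close> to be lowered by one, provided that the new entry
    \<open>h n\<close> respects the lower value.\<close>
  have G_next: "G (Suc n) c" if "G n b" "h n \<le> c" "b \<le> c + 1" for n b c
    unfolding G_def
  proof (intro allI impI)
    fix l assume l: "1 \<le> l" "l \<le> v"
    show "h (Suc n - l) \<le> c + int l - 1"
    proof (cases "l = 1")
      case False
      then have "h (n - (l - 1)) \<le> b + int (l - 1) - 1"
        using that(1)[unfolded G_def, rule_format, of "l - 1"] l by simp
      moreover have "n - (l - 1) = Suc n - l" using l by simp
      ultimately show ?thesis using l that(3) by simp
    qed (use that(2) in simp)
  qed
  let ?Q = "\<lambda>b. \<exists>n\<ge>N. G n b"
  have "G N (Max ((\<lambda>l. h (N - l)) ` {..v}))" unfolding G_def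
  proof (intro allI impI)
    fix l assume "1 \<le> l" "l \<le> v"
    moreover have "h (N - l) \<le> Max ((\<lambda>l. h (N - l)) ` {..v})" by (rule Max_ge) (use \<open>l \<le> v\<close> in auto)
    ultimately show "h (N - l) \<le> Max ((\<lambda>l. h (N - l)) ` {..v}) + int l - 1" by linarith
  qed
  then have ex: "?Q (Max ((\<lambda>l. h (N - l)) ` {..v}))" by blast
  \<comment> \<open>A bound for the preceding window is by \<open>rec\<close> a bound for
    \<open>h n\<close> itself, so it cannot fall below \<open>d\<close>; hence the least bound
    \<open>e\<close> exists.\<close>
  have bnd: "d \<le> b" if "?Q b" for b using that G_le low order_trans by blast
  define e where "e = Least ?Q"
  have e: "?Q e" "\<And>b. ?Q b \<Longrightarrow> e \<le> b" unfolding e_def using int_Least[of ?Q, OF ex bnd] by blast+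
  then obtain n0 where n0: "n0 \<ge> N" "G n0 e" by blast
  have G_all: "G n e" if "n \<ge> n0" for n
    using that
  proof (induction rule: dec_induct)
    case (step n)
    then show ?case using G_next[of n e e] G_le[of n e] n0 by simp
  qed (rule n0(2))
  have "h n = e" if n: "n \<ge> n0" for n
  proof (rule ccontr)
    assume "h n \<noteq> e"
    then have "h n \<le> e - 1" using G_le[OF _ G_all[OF n]] n n0(1) by force
    then have "G (Suc n) (e - 1)" using G_next[OF G_all[OF n], of "e - 1"] by simp
    then have "?Q (e - 1)" using n n0(1) by (intro exI[of _ "Suc n"]) simp
    then show False using e(2) by force
  qed
  then show ?thesis using bnd[OF e(1)] by blast
qed

section \<open>The recursive bound for the regularity of powers\<close>

context regularity begin

text \<open>The functions supported at \<open>s\<close> form a copy of \<open>N\<close> shifted by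
  \<open>d s\<close>.\<close>

lemma reg_fun_single:
  assumes M: "fg_graded_mod R M" and T: "finite T" "s \<in> T" and N: "graded_sub R M N" "N \<noteq> {\<zero>\<^bsub>M\<^esub>}"
  shows "reg (graded_submodule (fun_module M T d) (fun_sub M {s} N)) =
    reg (graded_submodule M N) + d s"
proof -
  interpret M: fg_graded_mod R M by fact
  let ?F = "fun_module M T d" and ?\<delta> = "\<lambda>x t. if t = s then x else \<zero>\<^bsub>M\<^esub>"
  interpret F: fg_graded_mod R ?F by (rule M.fun_module_fg[OF T(1)])
  let ?A = "shift (d s) (graded_submodule M N)" and ?B = "graded_submodule ?F (fun_sub M {s} N)"
  note sN = M.gsub_subgroup[OF N(1)]
  have fgN: "fg_graded_mod R (graded_submodule M N)" by (rule M.fg_graded_mod_sub[OF N(1)])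
  have nzN: "nonzero_module (graded_submodule M N)" using N(2) unfolding nonzero_module_def by simp
  have g: "graded_sub R ?F (fun_sub M {s} N)" using M.fun_sub_gsub[OF T(1) N(1)] T(2) by simp
  have fgB: "fg_graded_mod R ?B" by (rule F.fg_graded_mod_sub[OF g])
  have "graded_hom R ?A ?B ?\<delta>"
    unfolding graded_hom_def
    using T(2) M.MG.comp_zero by (auto simp: fun_sub_def)
  moreover have "bij_betw ?\<delta> N (fun_sub M {s} N)"
  proof (rule bij_betwI[where g = "\<lambda>f. f s"])
    show "?\<delta> (f s) = f" if "f \<in> fun_sub M {s} N" for f using that unfolding fun_sub_def by auto
  qed (auto simp: fun_sub_def)
  ultimately have "graded_iso R ?A ?B" unfolding graded_iso_def by (intro exI[of _ ?\<delta>]) simp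
  moreover have "nonzero_module ?A" using nzN unfolding nonzero_module_def by simp
  ultimately have "reg ?A = reg ?B"
    using reg_iso[OF fg_graded_mod.shift_fg[OF fgN] _ fgB] by blast
  then show ?thesis using reg_shift[OF fgN nzN] by simp
qed

lemma fun_sub_nonzero:
  assumes "fg_graded_mod R M" "graded_sub R M N" "N \<noteq> {\<zero>\<^bsub>M\<^esub>}" "S \<noteq> {}"
  shows "nonzero_module (graded_submodule (fun_module M T d) (fun_sub M S N))"
proof -
  interpret M: fg_graded_mod R M by fact
  have z: "\<zero>\<^bsub>M\<^esub> \<in> N" using sub_zero[OF M.gsub_subgroup[OF assms(2)]] .
  obtain x where x: "x \<in> N" "x \<noteq> \<zero>\<^bsub>M\<^esub>" using assms(3) z by blast
  obtain s where s: "s \<in> S" using assms(4) by blast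
  have "(\<lambda>t. if t = s then x else \<zero>\<^bsub>M\<^esub>) \<in> fun_sub M S N" unfolding fun_sub_def using x s z by auto
  moreover have "(\<lambda>t. if t = s then x else \<zero>\<^bsub>M\<^esub>) \<noteq> (\<lambda>_. \<zero>\<^bsub>M\<^esub>)" using x(2) by (auto simp: fun_eq_iff)
  ultimately show ?thesis unfolding nonzero_module_def by auto
qed

text \<open>One index at a time is split off as a direct summand. The index set has to be nonempty
  because \<open>\<Gamma>\<close> has no integer value at the zero module.\<close>

lemma reg_fun_sub_le:
  assumes M: "fg_graded_mod R M" and T: "finite T" and N: "graded_sub R M N" "N \<noteq> {\<zero>\<^bsub>M\<^esub>}"
    and S: "finite S" "S \<noteq> {}" "S \<subseteq> T" and le: "\<And>s. s \<in> S \<Longrightarrow> reg (graded_submodule M N) + d s \<le> b"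
  shows "reg (graded_submodule (fun_module M T d) (fun_sub M S N)) \<le> b"
  using S le
proof (induction S rule: finite_ne_induct)
  case (singleton s)
  then show ?case using reg_fun_single[OF M T _ N, of s d] by simp
next
  case (insert s S)
  interpret M: fg_graded_mod R M by fact
  let ?F = "fun_module M T d"
  interpret F: fg_graded_mod R ?F by (rule M.fun_module_fg[OF T])
  let ?m = "\<lambda>S. graded_submodule ?F (fun_sub M S N)"
  have z: "\<zero>\<^bsub>M\<^esub> \<in> N" using sub_zero[OF M.gsub_subgroup[OF N(1)]] .
  have fg: "fg_graded_mod R (?m S')" if "S' \<subseteq> T" for S'
    by (rule F.fg_graded_mod_sub[OF M.fun_sub_gsub[OF T N(1) that]])
  have nz: "nonzero_module (?m S')" if "S' \<noteq> {}" for S' by (rule fun_sub_nonzero[OF M N that])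
  have sT: "{s} \<subseteq> T" "S \<subseteq> T" "insert s S \<subseteq> T" using insert by auto
  let ?i = "\<lambda>f. (\<lambda>t. if t = s then f s else \<zero>\<^bsub>M\<^esub>, f(s := \<zero>\<^bsub>M\<^esub>))"
  have c: "f t \<in> carrier M" if "f \<in> fun_sub M (insert s S) N" for f t
    using that M.gsub_carrier[OF N(1)] unfolding fun_sub_def by (cases "t \<in> insert s S") auto
  have "graded_hom R (?m (insert s S)) (direct_sum_module (?m {s}) (?m S)) ?i"
    unfolding graded_hom_def direct_sum_module_def
    using insert.hyps M.MG.comp_zero by (auto simp: fun_sub_def fun_eq_iff)
  moreover have "bij_betw ?i (fun_sub M (insert s S) N) (fun_sub M {s} N \<times> fun_sub M S N)"
  proof (rule bij_betwI[where g = "\<lambda>(f, g). g(s := f s)"])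
    show "?i ((\<lambda>(f, g). g(s := f s)) p) = p" if "p \<in> fun_sub M {s} N \<times> fun_sub M S N" for p
      using that insert.hyps by (auto simp: fun_sub_def fun_eq_iff)
  qed (use insert.hyps in \<open>auto simp: fun_sub_def\<close>)
  ultimately have "graded_iso R (?m (insert s S)) (direct_sum_module (?m {s}) (?m S))"
    unfolding graded_iso_def by (intro exI[of _ ?i]) (simp add: direct_sum_module_def)
  then have "reg (?m (insert s S)) = max (reg (?m {s})) (reg (?m S))"
    using reg_direct_sum[OF fg[OF sT(1)] nz fg[OF sT(2)] nz fg[OF sT(3)] nz] insert.hyps by simp
  moreover have "reg (?m {s}) \<le> b"
    using reg_fun_single[OF M T _ N, of s d] insert sT by simp
  moreover have "reg (?m S) \<le> b" using insert sT by simp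
  ultimately show ?case by simp
qed

text \<open>Descending induction on \<open>i\<close> shows that the cycles
  \<open>Z i (m - i)\<close> have regularity at most \<open>b + i\<close>: they are the quotient of
  \<open>Kc (Suc i)\<close> by \<open>Z (Suc i)\<close>, the hypothesis for \<open>l = Suc i\<close>
  bounds the middle term by \<open>b + i\<close>, and the bound \<open>b + i + 1\<close> for the
  left term loses one by the exactness axiom. At \<open>i = 0\<close> the cycles are all of
  \<open>P m\<close>.\<close>

lemma reg_koszul_bound:
  assumes K: "koszul_filtration R M v y dg P n0" and nz: "\<And>n. P n \<noteq> {\<zero>\<^bsub>M\<^esub>}"
  shows "\<exists>n1\<ge>v. \<forall>m\<ge>n1. \<forall>b. (\<forall>l S. 1 \<le> l \<longrightarrow> l \<le> v \<longrightarrow> S \<subseteq> {..<v} \<longrightarrow> card S = l \<longrightarrow>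
    reg (graded_submodule M (P (m - l))) + int (\<Sum>j\<in>S. dg j) \<le> b + int l - 1) \<longrightarrow>
    reg (graded_submodule M (P m)) \<le> b"
proof -
  interpret K: koszul_filtration R M v y dg P n0 by fact
  let ?m = "\<lambda>U. graded_submodule K.F U"
  obtain n1 where n1: "\<And>n i. n \<ge> n1 \<Longrightarrow> i \<le> v \<Longrightarrow> K.Z i (Suc n) = K.bd v ` K.Kc (Suc i) n"
    using K.koszul_exact by blast
  have fgK: "fg_graded_mod R (?m (K.Kc i n))" and fgZ: "fg_graded_mod R (?m (K.Z i n))" for i n
    using K.F.fg_graded_mod_sub K.Kc_gsub K.Z_gsub by blast+
  have M: "fg_graded_mod R M" by (rule K.fg_graded_mod_axioms)
  have zZ: "\<zero>\<^bsub>K.F\<^esub> \<in> K.Z i n" for i n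
    using sub_zero[OF K.F.gsub_subgroup[OF K.Z_gsub]] .
  have "reg (graded_submodule M (P m)) \<le> b"
    if m: "m \<ge> n1 + v + 1" and b: "\<And>l S. 1 \<le> l \<Longrightarrow> l \<le> v \<Longrightarrow> S \<subseteq> {..<v} \<Longrightarrow> card S = l \<Longrightarrow>
      reg (graded_submodule M (P (m - l))) + int (\<Sum>j\<in>S. dg j) \<le> b + int l - 1" for m b
  proof -
    \<comment> \<open>The bound is conditional because cycle modules may vanish. The assumption on
      \<open>m\<close> keeps every index \<open>m - i - 1\<close> with \<open>i \<le> v\<close> in
      the range where the complex is exact.\<close>
    have "K.Z i (m - i) \<noteq> {\<zero>\<^bsub>K.F\<^esub>} \<longrightarrow> reg (?m (K.Z i (m - i))) \<le> b + int i" if "i \<le> v" for i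
      using that
    proof (induction rule: inc_induct)
      case base
      \<comment> \<open>There are no subsets of size \<open>Suc v\<close>, so at the left end
        exactness makes the cycles zero.\<close>
      have "K.Z v (Suc (m - v - 1)) = K.bd v ` K.Kc (Suc v) (m - v - 1)" by (rule n1) (use m in auto)
      then have "K.Z v (m - v) = {\<zero>\<^bsub>K.F\<^esub>}" using m K.Kc_top K.bd_zero[of v] by (simp add: Suc_diff_Suc)
      then show ?case by simp
    next
      case (step i)
      define n where "n = m - Suc i"
      have n: "n \<ge> n1" "m - i = Suc n" using m step unfolding n_def by auto
      have ZB: "K.Z i (Suc n) = K.bd v ` K.Kc (Suc i) n" by (rule n1[OF n(1)]) (use step in simp)
      show ?case
      proof
        assume nzZ: "K.Z i (m - i) \<noteq> {\<zero>\<^bsub>K.F\<^esub>}"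
        let ?K = "?m (K.Kc (Suc i) n)" and ?Z = "?m (K.Z i (Suc n))"
        have T: "K.T (Suc i) \<noteq> {}"
        proof -
          have "{..i} \<in> K.T (Suc i)" unfolding K.T_def using step by auto
          then show ?thesis by blast
        qed
        have regK: "reg ?K \<le> b + int i" unfolding K.Kc_def
        proof (rule reg_fun_sub_le[OF M _ K.gP nz K.T_sub(2) T K.T_sub(1)])
          fix S assume "S \<in> K.T (Suc i)"
          then show "reg (graded_submodule M (P n)) + K.dS S \<le> b + int i"
            using b[of "Suc i" S] step unfolding K.T_def K.dS_def n_def by simp
        qed simp
        have nzK: "nonzero_module ?K" unfolding K.Kc_def by (rule fun_sub_nonzero[OF M K.gP nz T])
        have nzZ': "nonzero_module ?Z" using nzZ n unfolding nonzero_module_def by simp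
        have ex: "short_exact R (?m (K.Z (Suc i) n)) ?K ?Z (\<lambda>x. x) (K.bd v)"
          by (rule K.koszul_short_exact[OF ZB])
        have "reg ?Z \<le> b + int i"
        proof (cases "K.Z (Suc i) n = {\<zero>\<^bsub>K.F\<^esub>}")
          case True
          \<comment> \<open>With a zero module on the left the exactness axiom does not apply;
            instead the differential is an isomorphism onto the cycles and the regularity is carried
            over.\<close>
          have inj: "inj_on (K.bd v) (K.Kc (Suc i) n)"
          proof (rule inj_onI)
            fix x x' assume x: "x \<in> K.Kc (Suc i) n" "x' \<in> K.Kc (Suc i) n" and e: "K.bd v x =
              K.bd v x'"
            note sK = K.F.gsub_subgroup[OF K.Kc_gsub]
            have c: "x \<in> carrier K.F" "x' \<in> carrier K.F" using x K.Kc_F by auto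
            have bm: "K.bd v (\<ominus>\<^bsub>K.F\<^esub> x') = \<ominus>\<^bsub>K.F\<^esub> K.bd v x'"
              using additive_hom_preimage(2)[OF K.F.M.abelian_group_axioms
                K.F.M.abelian_group_axioms _ _ c(2), of "K.bd v"]
                K.bd_closed[OF le_refl] K.bd_add[OF le_refl] by blast
            have "K.bd v (x \<oplus>\<^bsub>K.F\<^esub> \<ominus>\<^bsub>K.F\<^esub> x') = \<zero>\<^bsub>K.F\<^esub>"
              using K.bd_add[OF le_refl c(1), of "\<ominus>\<^bsub>K.F\<^esub> x'"] c bm e K.bd_closed[OF le_refl]
                K.F.M.r_neg[of "K.bd v x'"] K.F.M.a_inv_closed[OF c(2)] by metis
            moreover have "x \<oplus>\<^bsub>K.F\<^esub> \<ominus>\<^bsub>K.F\<^esub> x' \<in> K.Kc (Suc i) n"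
              by (rule sub_add[OF sK x(1) sub_neg[OF sK x(2)]])
            ultimately have "x \<oplus>\<^bsub>K.F\<^esub> \<ominus>\<^bsub>K.F\<^esub> x' = \<zero>\<^bsub>K.F\<^esub>" using True unfolding K.Z_def by blast
            then show "x = x'"
              using c K.F.M.minus_equality[of x "\<ominus>\<^bsub>K.F\<^esub> x'"] K.F.M.minus_minus K.F.M.a_inv_closed
                by metis
          qed
          have "graded_iso R ?K ?Z"
            unfolding graded_iso_def using ex inj ZB unfolding short_exact_def bij_betw_def by auto
          then show ?thesis using reg_iso[OF fgK nzK fgZ] regK by simp
        next
          case False
          then have "nonzero_module (?m (K.Z (Suc i) n))" unfolding nonzero_module_def by simp
          then have "reg ?Z \<le> max (reg ?K) (reg (?m (K.Z (Suc i) n)) - 1)"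
            using reg_exact[OF fgZ _ fgK nzK fgZ nzZ' ex] by blast
          moreover have "reg (?m (K.Z (Suc i) n)) \<le> b + int (Suc i)"
            using step.IH False unfolding n_def by blast
          ultimately show ?thesis using regK by simp
        qed
        then show "reg (?m (K.Z i (m - i))) \<le> b + int i" using n by simp
      qed
    qed
    from this[of 0] have le: "K.Kc 0 m \<noteq> {\<zero>\<^bsub>K.F\<^esub>} \<longrightarrow> reg (?m (K.Kc 0 m)) \<le> b" by (simp add: K.Z_0)
    have T0: "K.T 0 = {{}}" unfolding K.T_def by (auto simp: card_eq_0_iff dest: finite_subset)
    have "nonzero_module (?m (K.Kc 0 m))"
      unfolding K.Kc_def T0 by (rule fun_sub_nonzero[OF M K.gP nz]) simp
    then have "reg (?m (K.Kc 0 m)) \<le> b" using le unfolding nonzero_module_def by simp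
    moreover have "reg (?m (K.Kc 0 m)) = reg (graded_submodule M (P m)) + K.dS {}"
      unfolding K.Kc_def T0 by (rule reg_fun_single[OF M _ _ K.gP nz]) auto
    ultimately show ?thesis by (simp add: K.dS_def)
  qed
  then show ?thesis by (intro exI[of _ "n1 + v + 1"]) auto
qed

end

locale regularity_powers = regularity R \<Gamma> emb + graded_powers R M I
  for R :: "'a graded_ring" (structure) and \<Gamma> :: "('a, 'm) graded_module \<Rightarrow> int"
    and emb and M :: "('a, 'm) graded_module" (structure) and I +
  assumes nonzero: "\<And>n. P n \<noteq> {\<zero>\<^bsub>M\<^esub>}"
begin

text \<open>The \<open>y j\<close> are homogeneous generators of a reduction that attains
  \<open>rho\<close>. Since \<open>P n\<close> is a submodule, coefficients can be moved onto its
  elements, and \<open>J P n\<close> is the sum of the \<open>y j P n\<close>.\<close>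

lemma reduction_filtration:
  "\<exists>v y dg n0. koszul_filtration R M v y dg P n0 \<and> (\<forall>j<v. int (dg j) \<le> rho R I M)"
proof -
  obtain J where J: "is_reduction R M I J" "rho R I M = Dmax R (ideal_module R J)"
    using rho_spec[OF nonzero] by blast
  note Jp = reduction_nonzero[OF nonzero J(1)]
  obtain ys where ys: "J = set_smult RM (carrier R) (set ys)"
    "\<And>y. y \<in> set ys \<Longrightarrow> \<exists>i. y \<in> J \<inter> rcomp R i \<and> int i \<le> rho R I M"
    using generated_by_degrees(3)[OF Jp] J(2) by auto
  then obtain deg where deg: "\<And>y. y \<in> set ys \<Longrightarrow> y \<in> J \<and> y \<in> rcomp R (deg y) \<and> int (deg y) \<le> rho R I M"
    by (metis IntD1 IntD2)
  obtain n0 where n0: "\<And>n. n \<ge> n0 \<Longrightarrow> P (Suc n) = set_smult M J (P n)"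
    using reduction_eventually[OF J(1)] by blast
  have ysc: "set ys \<subseteq> carrier R" using deg RG.comp_carrier by blast
  interpret RMM: graded_mod R RM by (rule RM_graded_mod)
  have gen: "set_smult M J (P n) \<subseteq> lsum M ys (P n)" for n
  proof -
    have L: "additive_subgroup (lsum M ys (P n)) M"
      by (rule lsum_subgroup[OF ysc gsub_subgroup[OF gsub_P]])
    show ?thesis
    proof (rule set_smult_least[OF L])
      fix a p assume a: "a \<in> J" and p: "p \<in> P n"
      have pc: "p \<in> carrier M" using p P_carrier by blast
      have "set_smult RM (carrier R) (set ys) \<subseteq> {a \<in> carrier R. a \<odot>\<^bsub>M\<^esub> p \<in> lsum M ys (P n)}"
      proof (rule RMM.set_smult_least)
        show "additive_subgroup {a \<in> carrier R. a \<odot>\<^bsub>M\<^esub> p \<in> lsum M ys (P n)} RM"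
          unfolding RM_subgroup_iff by (rule scalar_preimage_subgroup[OF L pc])
        fix r z assume r: "r \<in> carrier R" and z: "z \<in> set ys"
        have zc: "z \<in> carrier R" using z ysc by blast
        have "z \<odot>\<^bsub>M\<^esub> (r \<odot>\<^bsub>M\<^esub> p) \<in> lsum M ys (P n)"
          by (rule lsumI[OF ysc gsub_subgroup[OF gsub_P] z gsub_smult[OF gsub_P p r]])
        then show "r \<odot>\<^bsub>RM\<^esub> z \<in> {a \<in> carrier R. a \<odot>\<^bsub>M\<^esub> p \<in> lsum M ys (P n)}"
          using r zc pc smult_smult_comm[of r z p] by (simp add: smult_assoc1)
      qed
      then show "a \<odot>\<^bsub>M\<^esub> p \<in> lsum M ys (P n)" using a ys(1) by blast
    qed
  qed
  have map: "map (\<lambda>j. ys ! j) [0..<length ys] = ys" by (rule map_nth)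
  have "koszul_filtration R M (length ys) (\<lambda>j. ys ! j) (\<lambda>j. deg (ys ! j)) P n0"
  proof (intro koszul_filtration.intro koszul.intro koszul_axioms.intro
    koszul_filtration_axioms.intro)
    show "fg_graded_mod R M" by (rule fg_graded_mod_axioms)
    show "ys ! j \<in> rcomp R (deg (ys ! j))" if "j < length ys" for j using deg that by simp
    show "graded_sub R M (P n)" for n by (rule gsub_P)
    show "(ys ! j) \<odot>\<^bsub>M\<^esub> x \<in> P (Suc n)" if "j < length ys" "x \<in> P n" for j x n
    proof -
      have "ys ! j \<in> I" using deg that(1) J(1) unfolding is_reduction_def by auto
      then show ?thesis unfolding power_smult_Suc using that(2) by (rule set_smultI)
    qed
    show "P (Suc n) \<subseteq> lsum M (map (\<lambda>j. ys ! j) [0..<length ys]) (P n)" if "n \<ge> n0" for n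
      unfolding map n0[OF that] by (rule gen)
  qed
  then show ?thesis using deg by (intro exI[of _ "length ys"] exI) (auto intro: nth_mem)
qed

theorem eventually_linear:
  "\<exists>e\<ge>dmin M. \<exists>n0. \<forall>n\<ge>n0. \<Gamma> (graded_submodule M (P n)) = rho R I M * int n + e"
proof -
  let ?r = "rho R I M" and ?m = "\<lambda>n. graded_submodule M (P n)"
  obtain v y dg n0 where K: "koszul_filtration R M v y dg P n0" and dg: "\<And>j. j < v \<Longrightarrow> int (dg j) \<le> ?r"
    using reduction_filtration by blast
  obtain n1 where n1: "n1 \<ge> v" "\<And>m b. m \<ge> n1 \<Longrightarrow> (\<And>l S. 1 \<le> l \<Longrightarrow> l \<le> v \<Longrightarrow> S \<subseteq> {..<v} \<Longrightarrow> card S = l \<Longrightarrow>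
      reg (?m (m - l)) + int (\<Sum>j\<in>S. dg j) \<le> b + int l - 1) \<Longrightarrow> reg (?m m) \<le> b"
    using reg_koszul_bound[OF K nonzero] by blast
  have fgP: "fg_graded_mod R (?m n)" for n by (rule fg_graded_mod_sub[OF gsub_P])
  have nzP: "nonzero_module (?m n)" for n using nonzero unfolding nonzero_module_def by simp
  define h where "h n = reg (?m n) - ?r * int n" for n
  \<comment> \<open>The threshold \<open>n1 + 2\<close> serves both hypotheses: it exceeds
    \<open>n1\<close> for the recursion, and it makes \<open>n\<close> the successor of a positive
    number, as \<open>Dmax_lower_bound\<close> requires.\<close>
  have "\<exists>e\<ge>dmin M. \<exists>n0. \<forall>n\<ge>n0. h n = e"
  proof (rule eventually_constant[of "n1 + 2" v h])
    fix n b assume n: "n1 + 2 \<le> n" and le: "\<And>l. 1 \<le> l \<Longrightarrow> l \<le> v \<Longrightarrow> h (n - l) \<le> b + int l - 1"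
    have "reg (?m n) \<le> b + ?r * int n"
    proof (rule n1(2))
      fix l S assume l: "1 \<le> l" "l \<le> v" and S: "S \<subseteq> {..<v}" "card S = l"
      \<comment> \<open>The \<open>l\<close> degrees add up to at most \<open>l\<close> times
        \<open>rho\<close>, which is the amount by which the linear term drops from \<open>n\<close>
        to \<open>n - l\<close>.\<close>
      have "(\<Sum>j\<in>S. int (dg j)) \<le> of_nat (card S) * ?r"
        by (rule sum_bounded_above) (use dg S in auto)
      then have "int (\<Sum>j\<in>S. dg j) \<le> int l * ?r" using S(2) by simp
      moreover have "int (n - l) = int n - int l" using l n n1(1) by simp
      ultimately show "reg (?m (n - l)) + int (\<Sum>j\<in>S. dg j) \<le> b + ?r * int n + int l - 1"
        using le[OF l] unfolding h_def by (simp add: algebra_simps)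
    qed (use n in simp)
    then show "h n \<le> b" unfolding h_def by simp
  next
    fix n assume n: "n1 + 2 \<le> n"
    then obtain k where k: "n = Suc k" "k > 0" by (cases n) auto
    have "?r * int n + dmin M \<le> Dmax R (?m n)"
      using Dmax_lower_bound[OF nonzero k(2)] unfolding k(1) .
    also have "\<dots> \<le> reg (?m n)" using ge_D[OF fgI[OF fgP] nzP] reg_\<Gamma>[OF fgP nzP] by simp
    finally show "dmin M \<le> h n" unfolding h_def by simp
  qed
  then obtain e n0 where "e \<ge> dmin M" and e: "\<And>n. n \<ge> n0 \<Longrightarrow> h n = e" by blast
  moreover have "\<Gamma> (?m n) = ?r * int n + e" if "n \<ge> n0" for n
    using e[OF that] reg_\<Gamma>[OF fgP nzP] unfolding h_def by simp
  ultimately show ?thesis by blast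
qed

end

text \<open>The powers \<open>I^n M\<close> decrease, so either all of them are nonzero or all are
  zero from some exponent on. The premise on nonzero modules separates the second case, in which
  \<open>\<Gamma>\<close> has no integer value.\<close>

theorem theorem1p3:
  fixes R :: "'a graded_ring"
    and I :: "'a set"
    and M :: "('a, 'm) graded_module"
    and \<Gamma> :: "('a, 'm) graded_module \<Rightarrow> int"
    and emb :: "(nat \<Rightarrow> 'a) set \<Rightarrow> 'm"
  assumes "inj emb"
    and "standard_graded R"
    and "noetherian_ring (base_ring R)"
    and "graded_ideal R I"
    and "fg_graded_module R M"
    and "nonzero_module M"
    and "generalized_regularity_function R \<Gamma>"
  shows "\<exists>e \<ge> dmin M. \<forall>\<^sub>F n in sequentially.
    nonzero_module (graded_submodule M (power_smult R I n M)) \<longrightarrow>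
    \<Gamma> (graded_submodule M (power_smult R I n M)) = rho R I M * int n + e"
proof -
  have sg: "std_graded R"
    using assms(2,3) unfolding std_graded_def std_graded_axioms_def standard_graded_def by blast
  have fg: "fg_graded_mod R M" using fg_graded_mod_iff assms(2,3,5) by blast
  have "homogeneous_ideal R I" using std_graded.graded_ideal_iff[OF sg] assms(4) by blast
  then interpret GP: graded_powers R M I
    by (intro graded_powers.intro graded_powers_axioms.intro fg)
  show ?thesis
  proof (cases "\<exists>n. GP.P n = {\<zero>\<^bsub>M\<^esub>}")
    case True
    \<comment> \<open>All later powers vanish too, so the implication holds vacuously for large
      \<open>n\<close> with any \<open>e \<ge> dmin M\<close>.\<close>
    then obtain n0 where n0: "GP.P n0 = {\<zero>\<^bsub>M\<^esub>}" by blast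
    have "GP.P n = {\<zero>\<^bsub>M\<^esub>}" if "n \<ge> n0" for n
    proof -
      have "GP.P n \<subseteq> GP.P n0" using lift_Suc_antimono_le[of GP.P n0 n] GP.P_mono that by blast
      then show ?thesis
        using n0 sub_zero[OF GP.gsub_subgroup[OF GP.gsub_P[of n]]] by blast
    qed
    then have "\<forall>n\<ge>n0. \<not> nonzero_module (graded_submodule M (GP.P n))" unfolding nonzero_module_def
      by simp
    then show ?thesis unfolding eventually_sequentially by blast
  next
    case False
    interpret regularity_powers R \<Gamma> emb M I
      by (intro regularity_powers.intro regularity_powers_axioms.intro regularity.intro
        regularity_axioms.intro
          sg assms(1,7) GP.graded_powers_axioms) (use False in blast)
    show ?thesis unfolding eventually_sequentially using eventually_linear by blast
  qed
qed

end
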